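(* Let $(Q,W,d)$ be a graded quiver with potential, with graded Euler matrix $\mathcal{E}(t)=\mathcal{E}_{(Q,W,d)}(t)$. Then for all $i,j\in Q_0$ $$\mathcal{E}_{ij}(t)=(1-t)\delta_{ij}-\sum_{a:j\to i}t^{d(a)}+\sum_{a:i\to j}t^{1-d(a)},$$ where the sums run over the arrows $a\in Q_1$ with the indicated source and target.
   Context: Work over $\Bbbk=\mathbb{C}$; quivers are finite without loops; paths compose right-to-left. A graded quiver with potential $(Q,W,d)$ consists of a quiver $Q$, a potential $W$ (an element of the completed path algebra $\widehat{\Bbbk Q}$ modulo the closure of commutators, lying in the image of the square of the arrow ideal), and a function $d:Q_1\to\mathbb{Z}$, extended additively to paths, for which $W$ is homogeneous of degree one. Let $R_Q=\bigoplus_{i\in Q_0}\Bbbk e_i$. The complete bigraded Ginzburg dg algebra $\Gamma=\Gamma(Q,W,d)$ is the completed path algebra on generators $a:i\to j$ (for $a\in Q_1$), $a^*:j\to i$, $t_i:i\to i$ (for $i\in Q_0$) of bidegrees (cohomological, internal) $(0,d(a))$, $(-1,1-d(a))$, $(-2,1)$ respectively, with differential $\partial a=0$, $\partial a^*=\partial_aW$, $\partial t_i=e_i\sum_{a\in Q_1}[a,a^*]e_i$. In the derived category $\mathcal{D}^{\mathrm{gr}}_{\mathrm{cont}}(\Gamma)$ of continuous internally graded right dg $\Gamma$-modules (morphisms of bidegree $(0,0)$), with cohomological shift $[p]$ and internal shift $(N\langle r\rangle)_p=N_{p+r}$, set $\mathrm{Ext}^p_\Gamma(M,N)_r:=\mathrm{Hom}(M,N[p]\langle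 -r\rangle)$. The simple $S_i=e_iR_Q$ is a right dg module via the augmentation $\Gamma\to R_Q$ sending all generators $a,a^*,t_i$ to zero; it is concentrated in bidegree $(0,0)$. The graded Euler matrix is $$\mathcal{E}_{(Q,W,d)}(t)_{ij}:=\sum_{p,r\in\mathbb{Z}}(-1)^p\dim_\Bbbk\mathrm{Ext}^p_\Gamma(S_i,S_j)_r\,t^r .$$ *)

theory Defs
  imports
    "Graph_Theory.Graph_Theory"
    "Jordan_Normal_Form.VS_Connect"
    "HOL-Library.Function_Algebras"
    "HOL-Library.Infinite_Typeclass"
    "HOL-Library.Groups_Big_Fun"
    "HOL-Library.Poly_Mapping"
begin

definition fscale :: "complex \<Rightarrow> ('x \<Rightarrow> complex) \<Rightarrow> 'x \<Rightarrow> complex"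
  where "fscale c f = (\<lambda>x. c * f x)"

interpretation fscale: vector_space "fscale :: complex \<Rightarrow> ('x \<Rightarrow> complex) \<Rightarrow> 'x \<Rightarrow> complex"
  by unfold_locales (auto simp: fscale_def fun_eq_iff algebra_simps)

definition linear_map_on ::
  "('x \<Rightarrow> complex) set \<Rightarrow> ('y \<Rightarrow> complex) set \<Rightarrow> (('x \<Rightarrow> complex) \<Rightarrow> ('y \<Rightarrow> complex)) \<Rightarrow> bool"
  where "linear_map_on V W f \<longleftrightarrow>
    (\<forall>x\<in>V. f x \<in> W) \<and>
    (\<forall>x\<in>V. \<forall>y\<in>V. f (x + y) = f x + f y) \<and>
    (\<forall>c. \<forall>x\<in>V. f (fscale c x) = fscale c (f x))"

definition parity_sign :: "int \<Rightarrow> 'r::ring_1"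
  where "parity_sign p = (if even p then 1 else - 1)"


section \<open>Completed path algebras\<close>

text \<open>
  A path is a triple (source, arcs in order of traversal, target). Composition is
  right-to-left, so \<open>path_comp x y\<close> runs through \<open>y\<close> first.
\<close>

type_synonym ('v, 'e) path = "'v \<times> 'e list \<times> 'v"
type_synonym ('v, 'e) series = "('v, 'e) path \<Rightarrow> complex"

definition psrc :: "('v, 'e) path \<Rightarrow> 'v" where "psrc x = fst x"
definition parcs :: "('v, 'e) path \<Rightarrow> 'e list" where "parcs x = fst (snd x)"
definition ptgt :: "('v, 'e) path \<Rightarrow> 'v" where "ptgt x = snd (snd x)"

definition paths :: "('v, 'e) pre_digraph \<Rightarrow> ('v, 'e) path set"
  where "paths G = {(u, p, v). pre_digraph.awalk G u p v}"

definition path_comp :: "('v, 'e) path \<Rightarrow> ('v, 'e) path \<Rightarrow> ('v, 'e) path"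
  where "path_comp x y = (psrc y, parcs y @ parcs x, ptgt x)"

definition arc_path :: "('v, 'e) pre_digraph \<Rightarrow> 'e \<Rightarrow> ('v, 'e) path"
  where "arc_path G e = (tail G e, [e], head G e)"

definition splits :: "('v, 'e) pre_digraph \<Rightarrow> ('v, 'e) path \<Rightarrow> (('v, 'e) path \<times> ('v, 'e) path) set"
  where "splits G z = {(x, y). x \<in> paths G \<and> y \<in> paths G \<and> psrc x = ptgt y \<and> path_comp x y = z}"

definition single_path :: "('v, 'e) path \<Rightarrow> ('v, 'e) series"
  where "single_path x = (\<lambda>z. if z = x then 1 else 0)"

definition path_series :: "('v, 'e) pre_digraph \<Rightarrow> ('v, 'e) series set"
  where "path_series G = {f. \<forall>z. f z \<noteq> 0 \<longrightarrow> z \<in> paths G}"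

definition series_mult ::
  "('v, 'e) pre_digraph \<Rightarrow> ('v, 'e) series \<Rightarrow> ('v, 'e) series \<Rightarrow> ('v, 'e) series"
  where "series_mult G f g = (\<lambda>z. \<Sum>(x, y)\<in>splits G z. f x * g y)"

definition arrow_ideal_power :: "('v, 'e) pre_digraph \<Rightarrow> nat \<Rightarrow> ('v, 'e) series set"
  where "arrow_ideal_power G n = {f \<in> path_series G. \<forall>z. length (parcs z) < n \<longrightarrow> f z = 0}"

definition path_degree :: "('e \<Rightarrow> int) \<Rightarrow> ('v, 'e) path \<Rightarrow> int"
  where "path_degree d x = sum_list (map d (parcs x))"


section \<open>Graded quivers with potential\<close>

definition commutators :: "('v, 'e) pre_digraph \<Rightarrow> ('v, 'e) series set"
  where "commutators G = {series_mult G f g - series_mult G g f | f g.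
    f \<in> path_series G \<and> g \<in> path_series G}"

definition commutator_closure :: "('v, 'e) pre_digraph \<Rightarrow> ('v, 'e) series set"
  where "commutator_closure G = {c \<in> path_series G.
    \<forall>n. \<exists>b \<in> fscale.span (commutators G). c - b \<in> arrow_ideal_power G n}"

text \<open>Potentials are cosets of the closure of the commutators.\<close>

definition potential_class :: "('v, 'e) pre_digraph \<Rightarrow> ('v, 'e) series \<Rightarrow> ('v, 'e) series set"
  where "potential_class G w = {w + c | c. c \<in> commutator_closure G}"

locale graded_quiver_potential = fin_digraph Q + loopfree_digraph Q
  for Q :: "('v, 'a) pre_digraph" +
  fixes W :: "('v, 'a) series set" and d :: "'a \<Rightarrow> int"
  assumes potential: "\<exists>w \<in> arrow_ideal_power Q 2. W = potential_class Q w"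
    and homogeneous: "\<exists>w \<in> path_series Q.
      W = potential_class Q w \<and> (\<forall>z. w z \<noteq> 0 \<longrightarrow> path_degree d z = 1)"

text \<open>
  The cyclic derivative sends a cycle \<open>c\<close> to the sum of all \<open>v u\<close> with \<open>c = u a v\<close>. Below this
  is read off coefficientwise: the coefficient at \<open>z\<close> collects the coefficients of \<open>u a v\<close>
  over the finitely many factorisations \<open>z = v u\<close>.
\<close>

definition cyclic_derivative ::
  "('v, 'a) pre_digraph \<Rightarrow> 'a \<Rightarrow> ('v, 'a) series \<Rightarrow> ('v, 'a) series"
  where "cyclic_derivative Q a w = (\<lambda>z.
    \<Sum>(v, u) \<in> {(v, u) \<in> splits Q z. ptgt v = tail Q a \<and> psrc u = head Q a}.
      w (path_comp u (path_comp (arc_path Q a) v)))"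

text \<open>The derivative is constant on each coset, hence \<open>the_elem\<close>.\<close>

definition potential_derivative ::
  "('v, 'a) pre_digraph \<Rightarrow> ('v, 'a) series set \<Rightarrow> 'a \<Rightarrow> ('v, 'a) series"
  where "potential_derivative Q W a = the_elem (cyclic_derivative Q a ` W)"


section \<open>Continuous bigraded dg modules\<close>

text \<open>
  Bidegrees are pairs (cohomological, internal). The homogeneous components of algebras and
  modules are subspaces of a space of functions into the complex numbers. A topology is given
  componentwise by a neighbourhood base of 0, whose members are indexed families of subspaces.
\<close>

record 'x dg_algebra =
  acomp :: "int \<Rightarrow> int \<Rightarrow> ('x \<Rightarrow> complex) set"
  amult :: "('x \<Rightarrow> complex) \<Rightarrow> ('x \<Rightarrow> complex) \<Rightarrow> ('x \<Rightarrow> complex)"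
  aone  :: "'x \<Rightarrow> complex"
  adiff :: "('x \<Rightarrow> complex) \<Rightarrow> ('x \<Rightarrow> complex)"
  abase :: "(int \<Rightarrow> int \<Rightarrow> ('x \<Rightarrow> complex) set) set"

text \<open>
  The type \<open>'u\<close> is a universe: a family of vector spaces of dimension at most the cardinality of
  \<open>'u\<close> can be realised by subspaces of \<open>'u \<Rightarrow> complex\<close>. The structure maps carry
  the bidegree of their module argument, as components may overlap as sets.
\<close>

record ('u, 'x) dg_module =
  mcomp :: "int \<Rightarrow> int \<Rightarrow> ('u \<Rightarrow> complex) set"
  mdiff :: "int \<Rightarrow> int \<Rightarrow> ('u \<Rightarrow> complex) \<Rightarrow> ('u \<Rightarrow> complex)"
  mact  :: "int \<Rightarrow> int \<Rightarrow> ('u \<Rightarrow> complex) \<Rightarrow> ('x \<Rightarrow> complex) \<Rightarrow> ('u \<Rightarrow> complex)"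
  mbase :: "(int \<Rightarrow> int \<Rightarrow> ('u \<Rightarrow> complex) set) set"

text \<open>
  Right dg modules with a complete separated linear topology for which the action is continuous.
  As the base consists of submodules, joint continuity of the action reduces to
  \<open>act_continuous\<close>; the differential is continuous by \<open>base_diff\<close>.
  Separatedness and completeness say that each component maps bijectively onto the inverse limit
  of its quotients by the members of the base.
\<close>

locale continuous_dg_module =
  fixes A :: "'x dg_algebra" and M :: "('u, 'x) dg_module"
  assumes comp_subspace: "fscale.subspace (mcomp M p q)"
    and diff_linear: "linear_map_on (mcomp M p q) (mcomp M (p + 1) q) (mdiff M p q)"
    and diff_diff: "m \<in> mcomp M p q \<Longrightarrow> mdiff M (p + 1) q (mdiff M p q m) = 0"
    and act_linear_left: "x \<in> acomp A a b \<Longrightarrow>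
      linear_map_on (mcomp M p q) (mcomp M (p + a) (q + b)) (\<lambda>m. mact M p q m x)"
    and act_linear_right: "m \<in> mcomp M p q \<Longrightarrow>
      linear_map_on (acomp A a b) (mcomp M (p + a) (q + b)) (mact M p q m)"
    and act_one: "m \<in> mcomp M p q \<Longrightarrow> mact M p q m (aone A) = m"
    and act_mult: "m \<in> mcomp M p q \<Longrightarrow> x \<in> acomp A a b \<Longrightarrow> y \<in> acomp A a' b' \<Longrightarrow>
      mact M p q m (amult A x y) = mact M (p + a) (q + b) (mact M p q m x) y"
    and leibniz: "m \<in> mcomp M p q \<Longrightarrow> x \<in> acomp A a b \<Longrightarrow>
      mdiff M (p + a) (q + b) (mact M p q m x) =
        mact M (p + 1) q (mdiff M p q m) x + fscale (parity_sign p) (mact M p q m (adiff A x))"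
    and base_nonempty: "mbase M \<noteq> {}"
    and base_directed: "U \<in> mbase M \<Longrightarrow> V \<in> mbase M \<Longrightarrow>
      \<exists>T \<in> mbase M. \<forall>p q. T p q \<subseteq> U p q \<inter> V p q"
    and base_subspace: "U \<in> mbase M \<Longrightarrow> fscale.subspace (U p q) \<and> U p q \<subseteq> mcomp M p q"
    and base_diff: "U \<in> mbase M \<Longrightarrow> m \<in> U p q \<Longrightarrow> mdiff M p q m \<in> U (p + 1) q"
    and base_act: "U \<in> mbase M \<Longrightarrow> m \<in> U p q \<Longrightarrow> x \<in> acomp A a b \<Longrightarrow>
      mact M p q m x \<in> U (p + a) (q + b)"
    and act_continuous: "U \<in> mbase M \<Longrightarrow> m \<in> mcomp M p q \<Longrightarrow>
      \<exists>I \<in> abase A. \<forall>x \<in> I a b. mact M p q m x \<in> U (p + a) (q + b)"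
    and separated: "(\<Inter>U \<in> mbase M. U p q) = {0}"
    and complete: "(\<And>U. U \<in> mbase M \<Longrightarrow> c U \<in> mcomp M p q) \<Longrightarrow>
      (\<And>U V. U \<in> mbase M \<Longrightarrow> V \<in> mbase M \<Longrightarrow> V p q \<subseteq> U p q \<Longrightarrow> c V - c U \<in> U p q) \<Longrightarrow>
      \<exists>m \<in> mcomp M p q. \<forall>U \<in> mbase M. m - c U \<in> U p q"

definition shift :: "int \<Rightarrow> int \<Rightarrow> ('u, 'x) dg_module \<Rightarrow> ('u, 'x) dg_module"
  \<comment> \<open>\<open>shift k r N\<close> is N[k]\<langle>r\<rangle>; for right modules the action carries no sign\<close>
  where "shift k r N = \<lparr>
    mcomp = (\<lambda>p q. mcomp N (p + k) (q + r)),
    mdiff = (\<lambda>p q m. fscale (parity_sign k) (mdiff N (p + k) (q + r) m)),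
    mact = (\<lambda>p q. mact N (p + k) (q + r)),
    mbase = (\<lambda>U p q. U (p + k) (q + r)) ` mbase N\<rparr>"

type_synonym 'u graded_map = "int \<Rightarrow> int \<Rightarrow> ('u \<Rightarrow> complex) \<Rightarrow> ('u \<Rightarrow> complex)"

text \<open>Continuous module maps of bidegree (k, 0), not necessarily compatible with differentials.\<close>

definition graded_hom ::
  "'x dg_algebra \<Rightarrow> int \<Rightarrow> ('u, 'x) dg_module \<Rightarrow> ('u, 'x) dg_module \<Rightarrow> 'u graded_map \<Rightarrow> bool"
  where "graded_hom A k M N f \<longleftrightarrow>
    (\<forall>p q. linear_map_on (mcomp M p q) (mcomp N (p + k) q) (f p q)) \<and>
    (\<forall>p q a b. \<forall>m \<in> mcomp M p q. \<forall>x \<in> acomp A a b.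
      f (p + a) (q + b) (mact M p q m x) = mact N (p + k) q (f p q m) x) \<and>
    (\<forall>p q. \<forall>V \<in> mbase N. \<exists>U \<in> mbase M. \<forall>m \<in> U p q. f p q m \<in> V (p + k) q)"

definition dg_hom ::
  "'x dg_algebra \<Rightarrow> ('u, 'x) dg_module \<Rightarrow> ('u, 'x) dg_module \<Rightarrow> 'u graded_map \<Rightarrow> bool"
  where "dg_hom A M N f \<longleftrightarrow> graded_hom A 0 M N f \<and>
    (\<forall>p q. \<forall>m \<in> mcomp M p q. f (p + 1) q (mdiff M p q m) = mdiff N p q (f p q m))"

definition homotopic ::
  "'x dg_algebra \<Rightarrow> ('u, 'x) dg_module \<Rightarrow> ('u, 'x) dg_module \<Rightarrow>
    'u graded_map \<Rightarrow> 'u graded_map \<Rightarrow> bool"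
  where "homotopic A M N f g \<longleftrightarrow> (\<exists>h. graded_hom A (- 1) M N h \<and>
    (\<forall>p q. \<forall>m \<in> mcomp M p q.
      f p q m - g p q m = mdiff N (p - 1) q (h p q m) + h (p + 1) q (mdiff M p q m)))"

definition cocycles :: "('u, 'x) dg_module \<Rightarrow> int \<Rightarrow> int \<Rightarrow> ('u \<Rightarrow> complex) set"
  where "cocycles M p q = {m \<in> mcomp M p q. mdiff M p q m = 0}"

definition coboundaries :: "('u, 'x) dg_module \<Rightarrow> int \<Rightarrow> int \<Rightarrow> ('u \<Rightarrow> complex) set"
  where "coboundaries M p q = mdiff M (p - 1) q ` mcomp M (p - 1) q"

text \<open>The two clauses are injectivity and surjectivity on cohomology.\<close>

definition quasi_iso ::
  "'x dg_algebra \<Rightarrow> ('u, 'x) dg_module \<Rightarrow> ('u, 'x) dg_module \<Rightarrow> 'u graded_map \<Rightarrow> bool"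
  where "quasi_iso A M N f \<longleftrightarrow> dg_hom A M N f \<and>
    (\<forall>p q. \<forall>m \<in> cocycles M p q. f p q m \<in> coboundaries N p q \<longrightarrow> m \<in> coboundaries M p q) \<and>
    (\<forall>p q. \<forall>n \<in> cocycles N p q. \<exists>m \<in> cocycles M p q. n - f p q m \<in> coboundaries N p q)"


section \<open>Morphisms in the derived category\<close>

text \<open>
  The derived category is the localisation of the homotopy category of continuous dg modules at
  the quasi-isomorphisms. A morphism from \<open>M\<close> to \<open>N\<close> is a class of roofs \<open>M \<leftarrow> X \<rightarrow> N\<close> (left leg a
  quasi-isomorphism); two roofs are identified if a third one dominates both up to homotopy.
  Sums are formed on roofs with a common left leg.
\<close>

type_synonym ('u, 'x) roof = "('u, 'x) dg_module \<times> 'u graded_map \<times> 'u graded_map"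

definition roofs ::
  "'x dg_algebra \<Rightarrow> ('u, 'x) dg_module \<Rightarrow> ('u, 'x) dg_module \<Rightarrow> ('u, 'x) roof set"
  where "roofs A M N = {(X, s, f).
    continuous_dg_module A X \<and> quasi_iso A X M s \<and> dg_hom A X N f}"

definition graded_comp :: "'u graded_map \<Rightarrow> 'u graded_map \<Rightarrow> 'u graded_map"
  where "graded_comp g f = (\<lambda>p q. g p q \<circ> f p q)"

definition roof_rel ::
  "'x dg_algebra \<Rightarrow> ('u, 'x) dg_module \<Rightarrow> ('u, 'x) dg_module \<Rightarrow>
    (('u, 'x) roof \<times> ('u, 'x) roof) set"
  where "roof_rel A M N = {((X, s, f), (X', s', f')).
    (X, s, f) \<in> roofs A M N \<and> (X', s', f') \<in> roofs A M N \<and>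
    (\<exists>Y u u'. continuous_dg_module A Y \<and> dg_hom A Y X u \<and> dg_hom A Y X' u' \<and>
      quasi_iso A Y M (graded_comp s u) \<and>
      homotopic A Y M (graded_comp s u) (graded_comp s' u') \<and>
      homotopic A Y N (graded_comp f u) (graded_comp f' u'))}"

text \<open>
  Each union below is over a family whose members all coincide. The fields \<open>mult\<close> and \<open>one\<close>
  are not used by vector spaces.
\<close>

definition derived_hom ::
  "'x dg_algebra \<Rightarrow> ('u, 'x) dg_module \<Rightarrow> ('u, 'x) dg_module \<Rightarrow>
    (complex, ('u, 'x) roof set) module"
  where "derived_hom A M N = \<lparr>
    carrier = roofs A M N // roof_rel A M N,
    mult = undefined,
    one = undefined,
    zero = roof_rel A M N `` {(M, (\<lambda>p q. id), (\<lambda>p q. 0))},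
    add = (\<lambda>F G. \<Union>{roof_rel A M N `` {(X, s, \<lambda>p q m. f p q m + g p q m)} | X s f g.
      (X, s, f) \<in> F \<and> (X, s, g) \<in> G}),
    smult = (\<lambda>c F. \<Union>{roof_rel A M N `` {(X, s, \<lambda>p q m. fscale c (f p q m))} | X s f.
      (X, s, f) \<in> F})\<rparr>"


section \<open>The complete bigraded Ginzburg dg algebra\<close>

datatype ('v, 'a) ginzburg_arrow = is_Arr: Arr (arr_of: 'a) | Dual 'a | Loop 'v

definition ginzburg_quiver :: "('v, 'a) pre_digraph \<Rightarrow> ('v, ('v, 'a) ginzburg_arrow) pre_digraph"
  where "ginzburg_quiver Q = \<lparr>
    verts = verts Q,
    arcs = Arr ` arcs Q \<union> Dual ` arcs Q \<union> Loop ` verts Q,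
    tail = (\<lambda>g. case g of Arr a \<Rightarrow> tail Q a | Dual a \<Rightarrow> head Q a | Loop i \<Rightarrow> i),
    head = (\<lambda>g. case g of Arr a \<Rightarrow> head Q a | Dual a \<Rightarrow> tail Q a | Loop i \<Rightarrow> i)\<rparr>"

fun coh_degree :: "('v, 'a) ginzburg_arrow \<Rightarrow> int" where
  "coh_degree (Arr a) = 0"
| "coh_degree (Dual a) = - 1"
| "coh_degree (Loop i) = - 2"

fun int_degree :: "('a \<Rightarrow> int) \<Rightarrow> ('v, 'a) ginzburg_arrow \<Rightarrow> int" where
  "int_degree d (Arr a) = d a"
| "int_degree d (Dual a) = 1 - d a"
| "int_degree d (Loop i) = 1"

type_synonym ('v, 'a) gpath = "('v, ('v, 'a) ginzburg_arrow) path"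

definition idempotent :: "'v \<Rightarrow> ('v, 'e) series"
  where "idempotent i = single_path (i, [], i)"

definition embed_series :: "('v, 'a) series \<Rightarrow> ('v, ('v, 'a) ginzburg_arrow) series"
  where "embed_series f = (\<lambda>(u, p, v). if list_all is_Arr p then f (u, map arr_of p, v) else 0)"

fun generator_diff ::
  "('v, 'a) pre_digraph \<Rightarrow> ('v, 'a) series set \<Rightarrow> ('v, 'a) ginzburg_arrow \<Rightarrow>
    ('v, ('v, 'a) ginzburg_arrow) series" where
  "generator_diff Q W (Arr a) = 0"
| "generator_diff Q W (Dual a) = embed_series (potential_derivative Q W a)"
| "generator_diff Q W (Loop i) =
    (let G = ginzburg_quiver Q;
         gen = (\<lambda>g. single_path (arc_path G g));
         comm = (\<lambda>a. series_mult G (gen (Arr a)) (gen (Dual a))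
                   - series_mult G (gen (Dual a)) (gen (Arr a)))
     in series_mult G (idempotent i) (series_mult G (\<Sum>a\<in>arcs Q. comm a) (idempotent i)))"

text \<open>
  The continuous derivation extending \<open>generator_diff\<close>: a path \<open>x g y\<close> contributes
  \<open>(-1)^|x| x (dg) y\<close> for each of its arrows \<open>g\<close>. The coefficient at \<open>z\<close> collects these
  contributions over the finitely many factorisations \<open>z = x m y\<close> and arrows \<open>g\<close> parallel to \<open>m\<close>.
\<close>

definition ginzburg_diff ::
  "('v, 'a) pre_digraph \<Rightarrow> ('v, 'a) series set \<Rightarrow>
    ('v, ('v, 'a) ginzburg_arrow) series \<Rightarrow> ('v, ('v, 'a) ginzburg_arrow) series"
  where "ginzburg_diff Q W f = (\<lambda>z. let G = ginzburg_quiver Q in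
    \<Sum>(x, z') \<in> splits G z. \<Sum>(m, y) \<in> splits G z'.
      \<Sum>g \<in> {g \<in> arcs G. tail G g = psrc m \<and> head G g = ptgt m}.
        parity_sign (path_degree coh_degree x)
        * f (path_comp x (path_comp (arc_path G g) y)) * generator_diff Q W g m)"

text \<open>
  Completion is taken in the category of bigraded spaces: each component is the product of the
  lines spanned by the paths of its bidegree, with the adic topology of the arrow ideal.
\<close>

definition ginzburg_comp ::
  "('v, 'a) pre_digraph \<Rightarrow> ('a \<Rightarrow> int) \<Rightarrow> int \<Rightarrow> int \<Rightarrow> ('v, ('v, 'a) ginzburg_arrow) series set"
  where "ginzburg_comp Q d p q = {f \<in> path_series (ginzburg_quiver Q). \<forall>z. f z \<noteq> 0 \<longrightarrow>
    path_degree coh_degree z = p \<and> path_degree (int_degree d) z = q}"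

definition ginzburg ::
  "('v, 'a) pre_digraph \<Rightarrow> ('v, 'a) series set \<Rightarrow> ('a \<Rightarrow> int) \<Rightarrow> ('v, 'a) gpath dg_algebra"
  where "ginzburg Q W d = \<lparr>
    acomp = ginzburg_comp Q d,
    amult = series_mult (ginzburg_quiver Q),
    aone = (\<Sum>i\<in>verts Q. idempotent i),
    adiff = ginzburg_diff Q W,
    abase = {(\<lambda>p q. ginzburg_comp Q d p q \<inter> arrow_ideal_power (ginzburg_quiver Q) n) | n. True}\<rparr>"


section \<open>Simple modules and the graded Euler matrix\<close>

text \<open>
  The line \<open>e\<^sub>i R\<^sub>Q\<close> in bidegree (0, 0) is realised by the functions supported at one point of the
  universe. An algebra element acts through the augmentation, that is, by its coefficient at the
  trivial path at \<open>i\<close>.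
\<close>

definition simple_module :: "'v \<Rightarrow> ('u, ('v, 'a) gpath) dg_module"
  where "simple_module i = \<lparr>
    mcomp = (\<lambda>p q. if p = 0 \<and> q = 0 then {m. \<forall>t. t \<noteq> undefined \<longrightarrow> m t = 0} else {0}),
    mdiff = (\<lambda>p q m. 0),
    mact = (\<lambda>p q m x. fscale (x (i, [], i)) m),
    mbase = {\<lambda>p q. {0}}\<rparr>"

definition ginzburg_ext ::
  "('v, 'a) pre_digraph \<Rightarrow> ('v, 'a) series set \<Rightarrow> ('a \<Rightarrow> int) \<Rightarrow> int \<Rightarrow> int \<Rightarrow>
    ('u, ('v, 'a) gpath) dg_module \<Rightarrow> ('u, ('v, 'a) gpath) dg_module \<Rightarrow>
    (complex, ('u, ('v, 'a) gpath) roof set) module"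
  where "ginzburg_ext Q W d p r M N = derived_hom (ginzburg Q W d) M (shift p (- r) N)"

definition simple_ext ::
  "'u itself \<Rightarrow> ('v, 'a) pre_digraph \<Rightarrow> ('v, 'a) series set \<Rightarrow> ('a \<Rightarrow> int) \<Rightarrow> int \<Rightarrow> int \<Rightarrow>
    'v \<Rightarrow> 'v \<Rightarrow> (complex, ('u, ('v, 'a) gpath) roof set) module"
  where "simple_ext U Q W d p r i j =
    ginzburg_ext Q W d p r (simple_module i) (simple_module j)"

abbreviation ext_dim ::
  "'u itself \<Rightarrow> ('v, 'a) pre_digraph \<Rightarrow> ('v, 'a) series set \<Rightarrow> ('a \<Rightarrow> int) \<Rightarrow> int \<Rightarrow> int \<Rightarrow>
    'v \<Rightarrow> 'v \<Rightarrow> nat"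
  where "ext_dim U Q W d p r i j \<equiv> vectorspace.dim class_ring (simple_ext U Q W d p r i j)"

text \<open>
  Laurent polynomials in \<open>t\<close> with integer coefficients are the finitely supported functions from
  exponents to coefficients, \<open>Poly_Mapping.single r c\<close> being \<open>c t\<^sup>r\<close>.
\<close>

type_synonym laurent = "int \<Rightarrow>\<^sub>0 int"

definition tpow :: "int \<Rightarrow> laurent"
  where "tpow r = Poly_Mapping.single r 1"

definition euler_matrix ::
  "'u itself \<Rightarrow> ('v, 'a) pre_digraph \<Rightarrow> ('v, 'a) series set \<Rightarrow> ('a \<Rightarrow> int) \<Rightarrow> 'v \<Rightarrow> 'v \<Rightarrow> laurent"
  where "euler_matrix U Q W d i j =
    Sum_any (\<lambda>(p, r). parity_sign p * of_nat (ext_dim U Q W d p r i j) * tpow r)"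

end

theory Submission
  imports Defs
begin

text \<open>
  Write \<open>\<Gamma>\<close> for the Ginzburg algebra and \<open>J\<close> for its arrow ideal. The kernel \<open>e\<^sub>i J\<close> of the
  augmentation \<open>e\<^sub>i \<Gamma> \<rightarrow> S\<^sub>i\<close> is the free right module on the arrows of the Ginzburg quiver that
  end at \<open>i\<close>, so the cone over its inclusion is a resolution of \<open>S\<^sub>i\<close> with finitely many
  generators: one of bidegree \<open>(0, 0)\<close> at \<open>i\<close>, and for each arrow \<open>g : k \<rightarrow> i\<close> of bidegree
  \<open>(p, r)\<close> one of bidegree \<open>(p - 1, r)\<close> at \<open>k\<close>. Since \<open>\<Gamma>\<close> lives in nonpositive cohomological
  degrees, the differential of a generator involves only generators of higher degree; hence maps
  out of the cone lift along quasi-isomorphisms onto \<open>S\<^sub>i\<close>, uniquely up to homotopy, and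
  morphisms in the derived category are homotopy classes of maps out of the cone. Such maps into
  \<open>S\<^sub>j[p]\<langle>-r\<rangle>\<close> are functions on the generators of bidegree \<open>(-p, r)\<close> at \<open>j\<close>. Two-cycles in the
  potential make the differential of this complex nonzero, but its Euler characteristic is still
  the signed count of generators: \<open>1\<close> and \<open>-t\<close> if \<open>i = j\<close> (the latter from \<open>t\<^sub>i\<close>),
  \<open>-t\<^sup>d\<^sup>(\<^sup>a\<^sup>)\<close> for \<open>a : j \<rightarrow> i\<close> and \<open>t\<^sup>1\<^sup>-\<^sup>d\<^sup>(\<^sup>a\<^sup>)\<close> for \<open>a : i \<rightarrow> j\<close>.
\<close>


section \<open>Factorisations of paths\<close>

text \<open>The cone is used rather than a minimal resolution because its differential
  \<open>(x, y) \<mapsto> (dx + y, - dy)\<close> makes exactness immediate, while freeness is a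
  statement about the underlying graded module only, obtained by stripping the leftmost arrow of a
  path. Completion does no harm: there are finitely many generators, so every element is a finite
  combination of them with coefficients in the completed algebra, and continuity of the action makes
  each choice of values on generators a continuous map. That the Ginzburg differential squares to
  zero is not built into the definitions; it rests on two facts about cyclic derivatives: they kill
  the closure of the commutators, and the commutators of the arrows with the derivatives along them
  sum to zero. The condition \<open>k \<le> 0\<close> in the lifting argument reflects that
  \<open>S_i\<close> sits in degree 0 and all generators but one in negative degree, so that a map
  to \<open>S_i\<close> of nonpositive degree is known from a single value. For the Euler
  characteristic the rank of each coboundary map enters in two neighbouring degrees and
  cancels.\<close>

lemma psrc_simps [simp]: "psrc (u, p, v) = u" "psrc (path_comp x y) = psrc y"
    "psrc (arc_path G e) = tail G e"
  by (simp_all add: psrc_def path_comp_def arc_path_def)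

lemma ptgt_simps [simp]: "ptgt (u, p, v) = v" "ptgt (path_comp x y) = ptgt x"
    "ptgt (arc_path G e) = head G e"
  by (simp_all add: ptgt_def path_comp_def arc_path_def)

lemma parcs_simps [simp]: "parcs (u, p, v) = p" "parcs (path_comp x y) = parcs y @ parcs x"
    "parcs (arc_path G e) = [e]"
  by (simp_all add: parcs_def path_comp_def arc_path_def)

lemma path_eqI: "psrc x = psrc y \<Longrightarrow> parcs x = parcs y \<Longrightarrow> ptgt x = ptgt y \<Longrightarrow> x = y"
  by (cases x; cases y) simp

lemma path_comp_triple [simp]: "path_comp (u, p, v) (u', q, v') = (u', q @ p, v)"
  by (simp add: path_comp_def psrc_def parcs_def ptgt_def)

lemma path_comp_assoc: "path_comp (path_comp x y) z = path_comp x (path_comp y z)"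
  by (rule path_eqI) auto

lemma path_comp_trivial [simp]:
  "ptgt y = v \<Longrightarrow> path_comp (v, [], v) y = y"
  "psrc x = v \<Longrightarrow> path_comp x (v, [], v) = x"
  by (auto intro!: path_eqI)

text \<open>A composite keeps the source and the arcs of its right factor but forgets its target,
  which the hypothesis restores.\<close>

lemma path_comp_left_cancel: "ptgt y = ptgt y' \<Longrightarrow> path_comp x y = path_comp x y' \<longleftrightarrow> y = y'"
  by (metis append_same_eq parcs_simps(2) path_eqI psrc_simps(2))

lemma path_degree_comp [simp]:
  "path_degree d (path_comp x y) = path_degree d x + path_degree d y"
  by (simp add: path_degree_def)

lemma path_degree_arc [simp]: "path_degree d (arc_path G e) = d e"
  by (simp add: path_degree_def)

lemma path_degree_trivial [simp]: "path_degree d (u, [], v) = 0"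
  by (simp add: path_degree_def)

lemma path_series_subspace: "fscale.subspace (path_series G :: ('v, 'e) series set)"
proof -
  have "path_series G = {f. \<forall>z. z \<notin> paths G \<longrightarrow> f z = 0}"
    unfolding path_series_def by blast
  then show ?thesis
    by (simp add: fscale.subspace_def fscale_def)
qed

lemma path_seriesD: "f \<in> path_series G \<Longrightarrow> z \<notin> paths G \<Longrightarrow> f z = 0"
  unfolding path_series_def by blast

lemma single_path_in_path_series: "x \<in> paths G \<Longrightarrow> single_path x \<in> path_series G"
  by (simp add: path_series_def single_path_def)

lemma parity_sign_add: "parity_sign (p + q) = (parity_sign p * parity_sign q :: 'r::ring_1)"
  by (auto simp: parity_sign_def)

lemma parity_sign_simps [simp]:
  "parity_sign p * parity_sign p = (1 :: 'r::ring_1)"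
  "parity_sign (p + 1) = (- parity_sign p :: 'r)"
  "parity_sign (p - 1) = (- parity_sign p :: 'r)"
  "parity_sign 0 = (1 :: 'r)"
  "parity_sign (- 1) = (- 1 :: 'r)"
  by (auto simp: parity_sign_def)

lemma fscale_apply [simp]: "fscale c f x = c * f x"
  by (simp add: fscale_def)

lemma sum_fun_apply: "(\<Sum>a\<in>A. f a) x = (\<Sum>a\<in>A. (f a x :: complex))"
  by (induction A rule: infinite_finite_induct) auto

context wf_digraph
begin

lemma path_iff [simp]: "(u, p, v) \<in> paths G \<longleftrightarrow> awalk u p v"
  by (simp add: paths_def)

lemma path_iff_awalk: "x \<in> paths G \<longleftrightarrow> awalk (psrc x) (parcs x) (ptgt x)"
  by (cases x) simp

lemma trivial_path: "u \<in> verts G \<Longrightarrow> (u, [], u) \<in> paths G"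
  by (simp add: awalk_Nil_iff)

lemma path_comp_in_paths [simp]:
  "x \<in> paths G \<Longrightarrow> y \<in> paths G \<Longrightarrow> psrc x = ptgt y \<Longrightarrow> path_comp x y \<in> paths G"
  by (auto simp: path_iff_awalk intro: awalk_appendI)

lemma arc_path_in_paths [simp]: "e \<in> arcs G \<Longrightarrow> arc_path G e \<in> paths G"
  by (simp add: arc_path_def arc_implies_awalk)

lemma psrc_in_verts: "x \<in> paths G \<Longrightarrow> psrc x \<in> verts G"
  and ptgt_in_verts: "x \<in> paths G \<Longrightarrow> ptgt x \<in> verts G"
  by (auto simp: path_iff_awalk)

lemma splits_iff:
  "(x, y) \<in> splits G z \<longleftrightarrow> x \<in> paths G \<and> y \<in> paths G \<and> psrc x = ptgt y \<and> path_comp x y = z"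
  by (simp add: splits_def)

lemma splits_path: "(x, y) \<in> splits G z \<Longrightarrow> z \<in> paths G"
  by (auto simp: splits_iff)

lemma trivial_path_eq: "x \<in> paths G \<Longrightarrow> parcs x = [] \<Longrightarrow> x = (psrc x, [], psrc x)"
  by (cases x) (auto simp: awalk_Nil_iff)

lemma path_eq_of_arcs:
  assumes "x \<in> paths G" "y \<in> paths G" "parcs x = parcs y" "psrc x = psrc y"
  shows "x = y"
proof (rule path_eqI)
  have "awlast (psrc x) (parcs x) = ptgt x" "awlast (psrc y) (parcs y) = ptgt y"
    using assms(1,2) by (simp_all add: path_iff_awalk)
  with assms(3,4) show "ptgt x = ptgt y" by simp
qed (use assms in auto)

text \<open>A factorisation is determined by the length of its right factor, that is, by the
  position of the cut.\<close>

lemma finite_splits [simp]: "finite (splits G z)"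
proof (rule inj_on_finite)
  show "inj_on (\<lambda>(x, y). length (parcs y)) (splits G z)"
  proof (rule inj_onI, clarify)
    fix x y x' y'
    assume a: "(x, y) \<in> splits G z" "(x', y') \<in> splits G z" "length (parcs y) = length (parcs y')"
    then have e: "path_comp x y = path_comp x' y'"
      by (simp add: splits_iff)
    from arg_cong[OF e, of parcs] a(3) have arcs: "parcs y = parcs y'" "parcs x = parcs x'"
      by auto
    have "y = y'"
      using a arcs arg_cong[OF e, of psrc] unfolding psrc_simps by (intro path_eq_of_arcs) (auto simp: splits_iff)
    moreover have "x = x'"
      using a arcs \<open>y = y'\<close> by (intro path_eq_of_arcs) (auto simp: splits_iff)
    ultimately show "x = x' \<and> y = y'" by simp
  qed
  show "(\<lambda>(x, y). length (parcs y)) ` splits G z \<subseteq> {..length (parcs z)}"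
    by (auto simp: splits_iff)
qed simp

text \<open>Deconcatenation is coassociative: both sides run over the factorisations of
  \<open>z\<close> into three paths. Associativity of the product and the Leibniz rule both rest on
  this.\<close>

lemma sum_splits_assoc:
  "(\<Sum>(x, w)\<in>splits G z. \<Sum>(m, y)\<in>splits G w. F x m y) =
   (\<Sum>(v, y)\<in>splits G z. \<Sum>(x, m)\<in>splits G v. F x m y)"
proof -
  have "(\<Sum>(x, w)\<in>splits G z. \<Sum>(m, y)\<in>splits G w. F x m y) =
        (\<Sum>((x, w), (m, y))\<in>Sigma (splits G z) (\<lambda>(x, w). splits G w). F x m y)"
    by (subst sum.Sigma[symmetric]) (auto simp: case_prod_unfold)
  also have "\<dots> = (\<Sum>((v, y), (x, m))\<in>Sigma (splits G z) (\<lambda>(v, y). splits G v). F x m y)"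
    by (rule sum.reindex_bij_witness[where
          i = "\<lambda>((v, y), (x, m)). ((x, path_comp m y), (m, y))" and
          j = "\<lambda>((x, w), (m, y)). ((path_comp x m, y), (x, m))"])
       (auto simp: splits_iff path_comp_assoc)
  also have "\<dots> = (\<Sum>(v, y)\<in>splits G z. \<Sum>(x, m)\<in>splits G v. F x m y)"
    by (subst sum.Sigma[symmetric]) (auto simp: case_prod_unfold)
  finally show ?thesis .
qed

text \<open>A cut never divides the arrow \<open>g\<close>, so it falls inside \<open>x\<close> or
  inside \<open>y\<close>, their ends included. Summed, this dichotomy gives the two terms of every
  product rule below.\<close>

lemma splits_comp_arc:
  assumes x: "x \<in> paths G" and y: "y \<in> paths G" and g: "g \<in> arcs G"
    and xg: "psrc x = head G g" and gy: "ptgt y = tail G g"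
  shows "splits G (path_comp x (path_comp (arc_path G g) y)) =
    (\<lambda>(x1, x2). (x1, path_comp x2 (path_comp (arc_path G g) y))) ` splits G x \<union>
    (\<lambda>(y1, y2). (path_comp x (path_comp (arc_path G g) y1), y2)) ` splits G y"
    (is "?L = ?A \<union> ?B")
proof (intro equalityI subsetI)
  fix pq assume "pq \<in> ?L"
  then obtain p q where pq: "pq = (p, q)" and p: "p \<in> paths G" and q: "q \<in> paths G"
    and c: "psrc p = ptgt q" and e: "path_comp p q = path_comp x (path_comp (arc_path G g) y)"
    by (cases pq) (auto simp: splits_iff)
  have src: "psrc q = psrc y" and tgt: "ptgt p = ptgt x"
    and l: "parcs q @ parcs p = parcs y @ [g] @ parcs x"
    using arg_cong[OF e, of psrc] arg_cong[OF e, of ptgt] arg_cong[OF e, of parcs] by auto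
  from l consider us where "parcs q = parcs y @ g # us" "us @ parcs p = parcs x"
    | us where "parcs q @ us = parcs y" "parcs p = us @ g # parcs x"
    by (auto simp: append_eq_append_conv2 Cons_eq_append_conv append_eq_Cons_conv)
  then show "pq \<in> ?A \<union> ?B"
  proof cases
    case 1
    define x2 where "x2 = (head G g, us, psrc p)"
    have x2: "x2 \<in> paths G"
      using q c 1(1) by (auto simp: path_iff_awalk x2_def awalk_append_iff awalk_Cons_iff)
    have "path_comp p x2 = x"
      using 1 tgt xg by (intro path_eqI) (auto simp: x2_def)
    then have "(p, x2) \<in> splits G x"
      using p x2 by (auto simp: splits_iff x2_def)
    moreover have "q = path_comp x2 (path_comp (arc_path G g) y)"
      using 1 src c by (intro path_eqI) (auto simp: x2_def)
    ultimately show ?thesis unfolding pq by force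
  next
    case 2
    define y1 where "y1 = (ptgt q, us, tail G g)"
    have y1: "y1 \<in> paths G"
      using p c 2(2) by (auto simp: path_iff_awalk y1_def awalk_append_iff awalk_Cons_iff)
    have "path_comp y1 q = y"
      using 2 src gy by (intro path_eqI) (auto simp: y1_def)
    then have "(y1, q) \<in> splits G y"
      using q y1 by (auto simp: splits_iff y1_def)
    moreover have "p = path_comp x (path_comp (arc_path G g) y1)"
      using 2 tgt c by (intro path_eqI) (auto simp: y1_def)
    ultimately show ?thesis unfolding pq by force
  qed
next
  fix pq assume "pq \<in> ?A \<union> ?B"
  then show "pq \<in> ?L"
    using assms by (auto simp: splits_iff intro!: path_eqI)
qed

lemma sum_splits_comp_arc:
  assumes x: "x \<in> paths G" and y: "y \<in> paths G" and g: "g \<in> arcs G"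
    and xg: "psrc x = head G g" and gy: "ptgt y = tail G g"
  shows "(\<Sum>(p, q)\<in>splits G (path_comp x (path_comp (arc_path G g) y)). F p q) =
    (\<Sum>(x1, x2)\<in>splits G x. F x1 (path_comp x2 (path_comp (arc_path G g) y))) +
    (\<Sum>(y1, y2)\<in>splits G y. F (path_comp x (path_comp (arc_path G g) y1)) y2)"
proof -
  have inj1: "inj_on (\<lambda>(x1, x2). (x1, path_comp x2 (path_comp (arc_path G g) y))) (splits G x)"
    using gy by (auto simp: inj_on_def splits_iff arc_path_def dest: arg_cong[of _ _ parcs] arg_cong[of _ _ ptgt])
  have inj2: "inj_on (\<lambda>(y1, y2). (path_comp x (path_comp (arc_path G g) y1), y2)) (splits G y)"
    by (auto simp: inj_on_def splits_iff intro!: path_eqI dest: arg_cong[of _ _ parcs] arg_cong[of _ _ psrc])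
  show ?thesis
    unfolding splits_comp_arc[OF assms]
  proof (subst sum.union_disjoint)
    \<comment> \<open>The length of the right factor tells the two kinds of cuts apart: a cut inside
      \<open>x\<close> leaves \<open>g\<close> and all of \<open>y\<close> on the right, a cut
      inside \<open>y\<close> leaves at most \<open>y\<close>.\<close>
    have "length (parcs y) < length (parcs (snd t))"
      if "t \<in> (\<lambda>(x1, x2). (x1, path_comp x2 (path_comp (arc_path G g) y))) ` splits G x" for t
      using that by auto
    moreover have "length (parcs (snd t)) \<le> length (parcs y)"
      if "t \<in> (\<lambda>(y1, y2). (path_comp x (path_comp (arc_path G g) y1), y2)) ` splits G y" for t
      using that by (auto simp: splits_iff)
    ultimately show "(\<lambda>(x1, x2). (x1, path_comp x2 (path_comp (arc_path G g) y))) ` splits G x \<inter>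
      (\<lambda>(y1, y2). (path_comp x (path_comp (arc_path G g) y1), y2)) ` splits G y = {}"
      by (metis (no_types, lifting) disjoint_iff not_le)
  qed (auto simp: sum.reindex[OF inj1[unfolded case_prod_unfold]]
      sum.reindex[OF inj2[unfolded case_prod_unfold]] case_prod_unfold o_def)
qed

lemma series_mult_apply: "series_mult G f g z = (\<Sum>(x, y)\<in>splits G z. f x * g y)"
  by (simp add: series_mult_def)

lemma series_mult_in_path_series [simp]: "series_mult G f g \<in> path_series G"
proof -
  have "splits G z = {}" if "z \<notin> paths G" for z
    using that splits_path by fast
  then show ?thesis by (fastforce simp: path_series_def series_mult_apply)
qed

lemma series_mult_assoc:
  "series_mult G (series_mult G f g) h = series_mult G f (series_mult G g h)"
  using sum_splits_assoc[of "\<lambda>x m y. f x * g m * h y"]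
  by (auto simp: fun_eq_iff series_mult_apply sum_distrib_left sum_distrib_right case_prod_unfold mult.assoc)

lemma series_mult_linear [simp]:
  "series_mult G (f + f') g = series_mult G f g + series_mult G f' g"
  "series_mult G f (g + g') = series_mult G f g + series_mult G f g'"
  "series_mult G (f - f') g = series_mult G f g - series_mult G f' g"
  "series_mult G f (g - g') = series_mult G f g - series_mult G f g'"
  "series_mult G (- f) g = - series_mult G f g"
  "series_mult G f (- g) = - series_mult G f g"
  "series_mult G (fscale c f) g = fscale c (series_mult G f g)"
  "series_mult G f (fscale c g) = fscale c (series_mult G f g)"
  "series_mult G 0 g = 0"
  "series_mult G f 0 = 0"
  by (auto simp: fun_eq_iff series_mult_apply sum_distrib_left algebra_simps case_prod_unfold
      sum.distrib sum_subtractf sum_negf)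

lemma series_mult_sum:
  "series_mult G (\<Sum>a\<in>A. f a) g = (\<Sum>a\<in>A. series_mult G (f a) g)"
  "series_mult G g (\<Sum>a\<in>A. f a) = (\<Sum>a\<in>A. series_mult G g (f a))"
  by (induction A rule: infinite_finite_induct)
    (simp_all only: sum.infinite sum.empty sum.insert series_mult_linear not_False_eq_True)

lemma series_mult_single_path:
  assumes "x \<in> paths G"
  shows "series_mult G (single_path x) f z =
    (\<Sum>p\<in>{p \<in> splits G z. fst p = x}. f (snd p))"
proof -
  have "series_mult G (single_path x) f z = (\<Sum>p\<in>splits G z. if fst p = x then f (snd p) else 0)"
    by (auto simp: series_mult_apply single_path_def case_prod_unfold intro!: sum.cong)
  also have "\<dots> = (\<Sum>p\<in>{p \<in> splits G z. fst p = x}. f (snd p))"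
    by (simp add: sum.inter_filter)
  finally show ?thesis .
qed

lemma series_mult_single_left:
  assumes "x \<in> paths G" "y \<in> paths G" "psrc x = ptgt y"
  shows "series_mult G (single_path x) f (path_comp x y) = f y"
proof -
  have "{p \<in> splits G (path_comp x y). fst p = x} = {(x, y)}"
  proof (intro equalityI subsetI)
    fix p assume "p \<in> {p \<in> splits G (path_comp x y). fst p = x}"
    then obtain q where "p = (x, q)" "(x, q) \<in> splits G (path_comp x y)"
      by (cases p) simp
    then have "path_comp x q = path_comp x y" "ptgt q = ptgt y"
      using assms(3) unfolding splits_iff by metis+
    with \<open>p = (x, q)\<close> show "p \<in> {(x, y)}"
      by (simp add: path_comp_left_cancel)
  qed (use assms in \<open>simp add: splits_iff\<close>)
  then show ?thesis using assms by (simp only: series_mult_single_path) simp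
qed

lemma series_mult_single_left_eq_0:
  assumes "x \<in> paths G" "\<And>y. y \<in> paths G \<Longrightarrow> psrc x = ptgt y \<Longrightarrow> z \<noteq> path_comp x y"
  shows "series_mult G (single_path x) f z = 0"
proof -
  have "{p \<in> splits G z. fst p = x} = {}"
    using assms(2) unfolding splits_def by fastforce
  then show ?thesis using assms(1) by (simp only: series_mult_single_path sum.empty)
qed

lemma single_path_mult:
  assumes "x \<in> paths G" "y \<in> paths G" "psrc x = ptgt y"
  shows "series_mult G (single_path x) (single_path y) = single_path (path_comp x y)"
proof
  fix z
  show "series_mult G (single_path x) (single_path y) z = single_path (path_comp x y) z"
  proof (cases "\<exists>y' \<in> paths G. psrc x = ptgt y' \<and> z = path_comp x y'")
    case True
    then obtain y' where y': "y' \<in> paths G" "psrc x = ptgt y'" "z = path_comp x y'" by blast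
    have "path_comp x y' = path_comp x y \<longleftrightarrow> y' = y"
      using assms y' by (intro path_comp_left_cancel) simp
    then show ?thesis
      using assms y' by (simp add: series_mult_single_left) (simp add: single_path_def)
  next
    case False
    then show ?thesis
      using assms by (subst series_mult_single_left_eq_0) (auto simp: single_path_def)
  qed
qed

lemma idempotent_mult_left:
  assumes "i \<in> verts G" "f \<in> path_series G"
  shows "series_mult G (idempotent i) f = (\<lambda>z. if ptgt z = i then f z else 0)"
proof
  fix z
  show "series_mult G (idempotent i) f z = (if ptgt z = i then f z else 0)"
  proof (cases "z \<in> paths G \<and> ptgt z = i")
    case True
    then show ?thesis
      using series_mult_single_left[of "(i, [], i)" z f] assms
      by (simp add: idempotent_def awalk_Nil_iff)
  next
    case False
    have "series_mult G (idempotent i) f z = 0"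
      unfolding idempotent_def using assms False
      by (intro series_mult_single_left_eq_0) (auto simp: awalk_Nil_iff)
    then show ?thesis using False assms by (auto simp: path_seriesD)
  qed
qed

lemma idempotent_mult_right:
  assumes "i \<in> verts G" "f \<in> path_series G"
  shows "series_mult G f (idempotent i) = (\<lambda>z. if psrc z = i then f z else 0)"
proof
  fix z
  have "series_mult G f (idempotent i) z
      = (\<Sum>p\<in>splits G z. if snd p = (i, [], i) then f (fst p) else 0)"
    by (auto simp: series_mult_apply single_path_def idempotent_def case_prod_unfold intro!: sum.cong)
  also have "\<dots> = (\<Sum>p\<in>{p \<in> splits G z. snd p = (i, [], i)}. f (fst p))"
    by (simp add: sum.inter_filter)
  also have "\<dots> = (if psrc z = i then f z else 0)"
  proof (cases "z \<in> paths G \<and> psrc z = i")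
    case True
    then have "{p \<in> splits G z. snd p = (i, [], i)} = {(z, (i, [], i))}"
      using assms by (auto simp: splits_iff awalk_Nil_iff)
    then show ?thesis using True by simp
  next
    case False
    then have "{p \<in> splits G z. snd p = (i, [], i)} = {}"
      by (auto simp: splits_iff)
    then show ?thesis using False assms by (simp only: sum.empty) (auto simp: path_seriesD)
  qed
  finally show "series_mult G f (idempotent i) z = (if psrc z = i then f z else 0)" .
qed

end


section \<open>Derivations of the completed path algebra\<close>

text \<open>Written as an operator on functions of two paths, nested cuts become nested
  applications, to which the congruence and reassociation rules below apply without pair
  patterns.\<close>

definition split_sum ::
  "('v, 'e) pre_digraph \<Rightarrow> (('v, 'e) path \<Rightarrow> ('v, 'e) path \<Rightarrow> complex) \<Rightarrow> ('v, 'e) series"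
  where "split_sum G F z = (\<Sum>(x, y)\<in>splits G z. F x y)"

text \<open>The formula of \<open>ginzburg_diff\<close> for an arbitrary quiver, degree function and
  values \<open>D\<close> on arrows, so that the Leibniz rule and the square of the differential can
  be treated without distinguishing the three types of arrows.\<close>

definition path_diff ::
  "('v, 'e) pre_digraph \<Rightarrow> ('e \<Rightarrow> int) \<Rightarrow> ('e \<Rightarrow> ('v, 'e) series) \<Rightarrow> ('v, 'e) series \<Rightarrow> ('v, 'e) series"
  where "path_diff G cd D f = split_sum G (\<lambda>x. split_sum G (\<lambda>m y.
    \<Sum>g\<in>{g \<in> arcs G. tail G g = psrc m \<and> head G g = ptgt m}.
      parity_sign (path_degree cd x) * f (path_comp x (path_comp (arc_path G g) y)) * D g m))"

definition bidegree_part ::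
  "('v, 'e) pre_digraph \<Rightarrow> ('e \<Rightarrow> int) \<Rightarrow> ('e \<Rightarrow> int) \<Rightarrow> int \<Rightarrow> int \<Rightarrow> ('v, 'e) series set"
  where "bidegree_part G cd idg p q = {f \<in> path_series G. \<forall>z. f z \<noteq> 0 \<longrightarrow>
    path_degree cd z = p \<and> path_degree idg z = q}"

context wf_digraph
begin

lemma series_mult_eq_split_sum: "series_mult G f g = split_sum G (\<lambda>x y. f x * g y)"
  by (simp add: series_mult_def split_sum_def fun_eq_iff)

lemma split_sum_cong:
  assumes "\<And>x y. x \<in> paths G \<Longrightarrow> y \<in> paths G \<Longrightarrow> psrc x = ptgt y \<Longrightarrow> path_comp x y = z \<Longrightarrow> F x y = F' x y"
  shows "split_sum G F z = split_sum G F' z"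
  unfolding split_sum_def by (rule sum.cong) (use assms in \<open>auto simp only: splits_iff split: prod.splits\<close>)

lemma split_sum_0 [simp]: "split_sum G (\<lambda>x y. 0) z = 0"
  by (simp add: split_sum_def)

lemma split_sum_nonzero:
  assumes "split_sum G F z \<noteq> 0"
  obtains x y where "x \<in> paths G" "y \<in> paths G" "psrc x = ptgt y" "path_comp x y = z" "F x y \<noteq> 0"
proof -
  have "\<exists>x y. x \<in> paths G \<and> y \<in> paths G \<and> psrc x = ptgt y \<and> path_comp x y = z \<and> F x y \<noteq> 0"
  proof (rule ccontr)
    assume "\<not> ?thesis"
    then have "split_sum G F z = split_sum G (\<lambda>x y. 0) z"
      by (intro split_sum_cong) blast
    with assms show False by simp
  qed
  then show ?thesis using that by blast
qed

lemma split_sum_add: "split_sum G (\<lambda>x y. F x y + F' x y) = (\<lambda>z. split_sum G F z + split_sum G F' z)"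
  by (simp add: fun_eq_iff split_sum_def case_prod_unfold sum.distrib)

lemma split_sum_mult_left: "split_sum G (\<lambda>x y. c * F x y) = (\<lambda>z. c * split_sum G F z)"
  by (simp add: fun_eq_iff split_sum_def case_prod_unfold sum_distrib_left)

lemma split_sum_mult_right: "split_sum G (\<lambda>x y. F x y * c) = (\<lambda>z. split_sum G F z * c)"
  by (simp add: fun_eq_iff split_sum_def case_prod_unfold sum_distrib_right)

lemma split_sum_sum:
  "split_sum G (\<lambda>x y. \<Sum>a\<in>A. F a x y) z = (\<Sum>a\<in>A. split_sum G (F a) z)"
  unfolding split_sum_def case_prod_unfold by (rule sum.swap)

lemma split_sum_assoc:
  "split_sum G (\<lambda>x. split_sum G (F x)) z =
   split_sum G (\<lambda>v y. split_sum G (\<lambda>x m. F x m y) v) z"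
  unfolding split_sum_def by (rule sum_splits_assoc)

lemma split_sum_comp_arc:
  assumes "x \<in> paths G" "y \<in> paths G" "g \<in> arcs G" "psrc x = head G g" "ptgt y = tail G g"
  shows "split_sum G F (path_comp x (path_comp (arc_path G g) y)) =
    split_sum G (\<lambda>x1 x2. F x1 (path_comp x2 (path_comp (arc_path G g) y))) x +
    split_sum G (\<lambda>y1 y2. F (path_comp x (path_comp (arc_path G g) y1)) y2) y"
  unfolding split_sum_def by (rule sum_splits_comp_arc[OF assms])

lemma split_sum_left_trivial:
  assumes "\<And>x y. x \<in> paths G \<Longrightarrow> y \<in> paths G \<Longrightarrow> parcs x \<noteq> [] \<Longrightarrow> path_comp x y = z \<Longrightarrow> F x y = 0"
  shows "split_sum G F z = (if z \<in> paths G then F (ptgt z, [], ptgt z) z else 0)"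
proof (cases "z \<in> paths G")
  case True
  define t where "t = (ptgt z, [] :: 'b list, ptgt z)"
  have t: "(t, z) \<in> splits G z"
    using True ptgt_in_verts[of z] by (simp add: splits_iff t_def awalk_Nil_iff del: path_iff_awalk)
  have "F (fst p) (snd p) = 0" if "p \<in> splits G z - {(t, z)}" for p
  proof -
    obtain x y where p: "p = (x, y)" by (cases p)
    with that have xy: "x \<in> paths G" "y \<in> paths G" "psrc x = ptgt y" "path_comp x y = z"
      by (simp_all add: splits_iff)
    have "parcs x \<noteq> []"
    proof
      assume "parcs x = []"
      then have x: "x = (ptgt y, [], ptgt y)"
        using trivial_path_eq[OF xy(1)] xy(3) by simp
      then have "y = z" using xy(4) by simp
      then show False using that x p by (simp add: t_def)
    qed
    then show ?thesis using assms[of x y] xy p by simp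
  qed
  then have "split_sum G F z = (\<Sum>p\<in>{(t, z)}. F (fst p) (snd p))"
    unfolding split_sum_def case_prod_unfold
    using t by (intro sum.mono_neutral_right) auto
  then show ?thesis using True by (simp add: t_def)
next
  case False
  then have "split_sum G F z = split_sum G (\<lambda>x y. 0) z"
    by (intro split_sum_cong) auto
  then show ?thesis using False by simp
qed

lemma split_sum_right_trivial:
  assumes "\<And>x y. x \<in> paths G \<Longrightarrow> y \<in> paths G \<Longrightarrow> parcs y \<noteq> [] \<Longrightarrow> path_comp x y = z \<Longrightarrow> F x y = 0"
  shows "split_sum G F z = (if z \<in> paths G then F z (psrc z, [], psrc z) else 0)"
proof (cases "z \<in> paths G")
  case True
  define t where "t = (psrc z, [] :: 'b list, psrc z)"
  have t: "(z, t) \<in> splits G z"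
    using True psrc_in_verts[of z] by (simp add: splits_iff t_def awalk_Nil_iff del: path_iff_awalk)
  have "F (fst p) (snd p) = 0" if "p \<in> splits G z - {(z, t)}" for p
  proof -
    obtain x y where p: "p = (x, y)" by (cases p)
    with that have xy: "x \<in> paths G" "y \<in> paths G" "psrc x = ptgt y" "path_comp x y = z"
      by (simp_all add: splits_iff)
    have "parcs y \<noteq> []"
    proof
      assume "parcs y = []"
      then obtain u where y: "y = (u, [], u)"
        using trivial_path_eq[OF xy(2)] by blast
      then have "x = z" "u = psrc z" using xy(3,4) by auto
      then show False using that y p by (simp add: t_def)
    qed
    then show ?thesis using assms[of x y] xy p by simp
  qed
  then have "split_sum G F z = (\<Sum>p\<in>{(z, t)}. F (fst p) (snd p))"
    unfolding split_sum_def case_prod_unfold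
    using t by (intro sum.mono_neutral_right) auto
  then show ?thesis using True by (simp add: t_def)
next
  case False
  then have "split_sum G F z = split_sum G (\<lambda>x y. 0) z"
    by (intro split_sum_cong) auto
  then show ?thesis using False by simp
qed

lemma path_diff_linear:
  "path_diff G cd D (f + g) = path_diff G cd D f + path_diff G cd D g"
  "path_diff G cd D (fscale c f) = fscale c (path_diff G cd D f)"
proof -
  show "path_diff G cd D (f + g) = path_diff G cd D f + path_diff G cd D g"
    by (rule ext) (simp add: path_diff_def split_sum_add sum.distrib distrib_left distrib_right)
  have scalar: "parity_sign p * (c * a) * b = c * (parity_sign p * a * b)" for p and a b :: complex
    by simp
  show "path_diff G cd D (fscale c f) = fscale c (path_diff G cd D f)"
    by (simp add: fun_eq_iff path_diff_def scalar sum_distrib_left[symmetric] split_sum_mult_left)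
qed

lemma path_diff_simps [simp]:
  "path_diff G cd D 0 = 0"
  "path_diff G cd D (- f) = - path_diff G cd D f"
  "path_diff G cd D (f - g) = path_diff G cd D f - path_diff G cd D g"
proof -
  have m: "fscale (- 1) f = - f" for f :: "('a, 'b) series" by (simp add: fscale_def fun_eq_iff)
  show "path_diff G cd D 0 = 0"
    using path_diff_linear(1)[of cd D 0 0] by simp
  show "path_diff G cd D (- f) = - path_diff G cd D f" for f
    using path_diff_linear(2)[of cd D "- 1" f] by (simp add: m)
  then show "path_diff G cd D (f - g) = path_diff G cd D f - path_diff G cd D g"
    using path_diff_linear(1)[of cd D f "- g"] by simp
qed

lemma path_diff_sum: "path_diff G cd D (\<Sum>a\<in>A. f a) = (\<Sum>a\<in>A. path_diff G cd D (f a))"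
  by (induction A rule: infinite_finite_induct)
    (simp_all only: sum.infinite sum.empty sum.insert path_diff_simps path_diff_linear not_False_eq_True)

lemma path_diff_nonzero:
  assumes "path_diff G cd D f z \<noteq> 0"
  obtains x g m y where "x \<in> paths G" "y \<in> paths G" "m \<in> paths G" "g \<in> arcs G"
    "tail G g = psrc m" "head G g = ptgt m" "psrc x = head G g" "ptgt y = tail G g"
    "z = path_comp x (path_comp m y)" "f (path_comp x (path_comp (arc_path G g) y)) \<noteq> 0" "D g m \<noteq> 0"
proof -
  from assms obtain x w where xw: "x \<in> paths G" "w \<in> paths G" "psrc x = ptgt w" "path_comp x w = z"
    and *: "split_sum G (\<lambda>m y. \<Sum>g\<in>{g \<in> arcs G. tail G g = psrc m \<and> head G g = ptgt m}.
      parity_sign (path_degree cd x) * f (path_comp x (path_comp (arc_path G g) y)) * D g m) w \<noteq> 0"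
    unfolding path_diff_def by (rule split_sum_nonzero)
  from * obtain m y where my: "m \<in> paths G" "y \<in> paths G" "psrc m = ptgt y" "path_comp m y = w"
    and **: "(\<Sum>g\<in>{g \<in> arcs G. tail G g = psrc m \<and> head G g = ptgt m}.
      parity_sign (path_degree cd x) * f (path_comp x (path_comp (arc_path G g) y)) * D g m) \<noteq> 0"
    by (rule split_sum_nonzero)
  from ** obtain g where g: "g \<in> arcs G" "tail G g = psrc m" "head G g = ptgt m"
    "f (path_comp x (path_comp (arc_path G g) y)) \<noteq> 0" "D g m \<noteq> 0"
    by (auto elim: sum.not_neutral_contains_not_neutral)
  show ?thesis
    using that[of x y m g] xw my g by (metis ptgt_simps(2))
qed

lemma path_diff_in_path_series [simp]: "path_diff G cd D f \<in> path_series G"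
proof -
  have "z \<in> paths G" if "path_diff G cd D f z \<noteq> 0" for z
    using that by (rule path_diff_nonzero) simp
  then show ?thesis unfolding path_series_def by blast
qed

text \<open>
  Cutting the path \<open>x g y\<close> in two cuts either \<open>x\<close> or \<open>y\<close>; these are the two terms of the rule.
\<close>

lemma path_diff_mult:
  assumes f: "\<And>z. f z \<noteq> 0 \<Longrightarrow> path_degree cd z = p"
  shows "path_diff G cd D (series_mult G f h) =
    series_mult G (path_diff G cd D f) h + fscale (parity_sign p) (series_mult G f (path_diff G cd D h))"
proof
  fix z
  define par where "par m = {g \<in> arcs G. tail G g = psrc m \<and> head G g = ptgt m}" for m :: "('a, 'b) path"
  define K where "K f' x m y = (\<Sum>g\<in>par m.
      parity_sign (path_degree cd x) * f' (path_comp x (path_comp (arc_path G g) y)) * D g m)"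
    for f' :: "('a, 'b) series" and x m y
  have diff: "path_diff G cd D f' = split_sum G (\<lambda>x. split_sum G (K f' x))" for f'
    unfolding path_diff_def K_def par_def by (rule refl)
  have sgn: "parity_sign (path_degree cd x) * f x = parity_sign p * f x" for x
    using f[of x] by (cases "f x = 0") auto
  have K: "K (series_mult G f h) x m y =
      split_sum G (\<lambda>x1 x2. parity_sign p * (f x1 * K h x2 m y)) x +
      split_sum G (\<lambda>y1 y2. K f x m y1 * h y2) y"
    if x: "x \<in> paths G" and m: "m \<in> paths G" and y: "y \<in> paths G" and c: "psrc x = ptgt m" "psrc m = ptgt y"
    for x m y
  proof -
    have "K (series_mult G f h) x m y = (\<Sum>g\<in>par m.
        split_sum G (\<lambda>x1 x2. parity_sign (path_degree cd x) *
          (f x1 * h (path_comp x2 (path_comp (arc_path G g) y))) * D g m) x +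
        split_sum G (\<lambda>y1 y2. parity_sign (path_degree cd x) *
          (f (path_comp x (path_comp (arc_path G g) y1)) * h y2) * D g m) y)"
      unfolding K_def
    proof (rule sum.cong[OF refl])
      fix g assume "g \<in> par m"
      then show "parity_sign (path_degree cd x) * series_mult G f h (path_comp x (path_comp (arc_path G g) y)) * D g m =
        split_sum G (\<lambda>x1 x2. parity_sign (path_degree cd x) *
          (f x1 * h (path_comp x2 (path_comp (arc_path G g) y))) * D g m) x +
        split_sum G (\<lambda>y1 y2. parity_sign (path_degree cd x) *
          (f (path_comp x (path_comp (arc_path G g) y1)) * h y2) * D g m) y"
        using x y c unfolding series_mult_eq_split_sum
        by (subst split_sum_comp_arc)
          (simp_all add: par_def split_sum_mult_left split_sum_mult_right distrib_left distrib_right)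
    qed
    also have "\<dots> = split_sum G (\<lambda>x1 x2. \<Sum>g\<in>par m. parity_sign (path_degree cd x) *
          (f x1 * h (path_comp x2 (path_comp (arc_path G g) y))) * D g m) x +
        split_sum G (\<lambda>y1 y2. \<Sum>g\<in>par m. parity_sign (path_degree cd x) *
          (f (path_comp x (path_comp (arc_path G g) y1)) * h y2) * D g m) y"
      by (simp add: sum.distrib split_sum_sum)
    also have "split_sum G (\<lambda>x1 x2. \<Sum>g\<in>par m. parity_sign (path_degree cd x) *
          (f x1 * h (path_comp x2 (path_comp (arc_path G g) y))) * D g m) x =
        split_sum G (\<lambda>x1 x2. parity_sign p * (f x1 * K h x2 m y)) x"
    proof (rule split_sum_cong)
      fix x1 x2 assume "path_comp x1 x2 = x"
      \<comment> \<open>On the support of \<open>f\<close> the left part \<open>x1\<close> has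
        degree \<open>p\<close>, which accounts for the sign of the rule; the remaining sign, that
        of \<open>x2\<close>, is the one inside the differential of \<open>h\<close>.\<close>
      then have e: "parity_sign (path_degree cd x) * f x1 = parity_sign p * f x1 * parity_sign (path_degree cd x2)"
        using sgn[of x1] by (auto simp: parity_sign_add)
      have "(\<Sum>g\<in>par m. (parity_sign (path_degree cd x) * f x1) *
          h (path_comp x2 (path_comp (arc_path G g) y)) * D g m) = parity_sign p * (f x1 * K h x2 m y)"
        unfolding e K_def sum_distrib_left by (intro sum.cong refl) simp
      then show "(\<Sum>g\<in>par m. parity_sign (path_degree cd x) *
          (f x1 * h (path_comp x2 (path_comp (arc_path G g) y))) * D g m) = parity_sign p * (f x1 * K h x2 m y)"
        by (simp add: mult_ac)
    qed
    also have "split_sum G (\<lambda>y1 y2. \<Sum>g\<in>par m. parity_sign (path_degree cd x) *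
          (f (path_comp x (path_comp (arc_path G g) y1)) * h y2) * D g m) y =
        split_sum G (\<lambda>y1 y2. K f x m y1 * h y2) y"
      unfolding K_def sum_distrib_right by (intro split_sum_cong sum.cong refl) simp
    finally show ?thesis .
  qed
  have "path_diff G cd D (series_mult G f h) z =
      split_sum G (\<lambda>x. split_sum G (\<lambda>m y.
        split_sum G (\<lambda>x1 x2. parity_sign p * (f x1 * K h x2 m y)) x +
        split_sum G (\<lambda>y1 y2. K f x m y1 * h y2) y)) z"
    unfolding diff
  proof (rule split_sum_cong)
    fix x w :: "('a, 'b) path"
    assume x: "x \<in> paths G" and c: "psrc x = ptgt w"
    show "split_sum G (K (series_mult G f h) x) w = split_sum G (\<lambda>m y.
        split_sum G (\<lambda>x1 x2. parity_sign p * (f x1 * K h x2 m y)) x +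
        split_sum G (\<lambda>y1 y2. K f x m y1 * h y2) y) w"
      using x c by (intro split_sum_cong K) auto
  qed
  also have "\<dots> = split_sum G (\<lambda>x w. split_sum G (\<lambda>x1 x2. split_sum G (\<lambda>m y. parity_sign p * (f x1 * K h x2 m y)) w) x) z
      + split_sum G (\<lambda>x w. split_sum G (\<lambda>m y. split_sum G (\<lambda>y1 y2. K f x m y1 * h y2) y) w) z"
  proof -
    have swap: "split_sum G (\<lambda>m y. split_sum G (\<lambda>x1 x2. F x1 x2 m y) x) w =
      split_sum G (\<lambda>x1 x2. split_sum G (\<lambda>m y. F x1 x2 m y) w) x" for F :: "('a,'b) path \<Rightarrow> _ \<Rightarrow> _ \<Rightarrow> _ \<Rightarrow> complex" and x w
      unfolding split_sum_def case_prod_unfold by (rule sum.swap)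
    show ?thesis by (simp add: split_sum_add) (intro split_sum_cong swap)
  qed
  also have "split_sum G (\<lambda>x w. split_sum G (\<lambda>x1 x2. split_sum G (\<lambda>m y. parity_sign p * (f x1 * K h x2 m y)) w) x) z =
      split_sum G (\<lambda>x1. split_sum G (\<lambda>x2. split_sum G (\<lambda>m y. parity_sign p * (f x1 * K h x2 m y)))) z"
    by (rule split_sum_assoc[symmetric])
  also have "\<dots> = parity_sign p * series_mult G f (path_diff G cd D h) z"
    by (simp add: split_sum_mult_left diff series_mult_eq_split_sum)
  also have "split_sum G (\<lambda>x w. split_sum G (\<lambda>m y. split_sum G (\<lambda>y1 y2. K f x m y1 * h y2) y) w) z =
      split_sum G (\<lambda>x w. split_sum G (\<lambda>v y2. split_sum G (\<lambda>m y1. K f x m y1 * h y2) v) w) z"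
    by (intro split_sum_cong split_sum_assoc)
  also have "\<dots> = split_sum G (\<lambda>u y2. split_sum G (\<lambda>x v. split_sum G (\<lambda>m y1. K f x m y1 * h y2) v) u) z"
    by (rule split_sum_assoc)
  also have "\<dots> = series_mult G (path_diff G cd D f) h z"
    by (simp add: split_sum_mult_right diff series_mult_eq_split_sum)
  finally show "path_diff G cd D (series_mult G f h) z = (series_mult G (path_diff G cd D f) h +
      fscale (parity_sign p) (series_mult G f (path_diff G cd D h))) z"
    by simp
qed

end

text \<open>Paths are triples; otherwise the simplifier would break every quantifier over paths into
  components.\<close>

declare split_paired_All [simp del] split_paired_Ex [simp del]

section \<open>Bidegree components, powers of the arrow ideal, and left division by an arrow\<close>

lemma bidegree_part_subspace: "fscale.subspace (bidegree_part G cd idg p q)"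
proof -
  have "bidegree_part G cd idg p q = {f. \<forall>z. \<not> (z \<in> paths G \<and> path_degree cd z = p \<and>
      path_degree idg z = q) \<longrightarrow> f z = 0}"
    unfolding bidegree_part_def path_series_def by blast
  then show ?thesis by (simp add: fscale.subspace_def fscale_def)
qed

lemma arrow_ideal_power_subspace: "fscale.subspace (arrow_ideal_power G n)"
proof -
  have "arrow_ideal_power G n = {f. \<forall>z. z \<notin> paths G \<or> length (parcs z) < n \<longrightarrow> f z = 0}"
    unfolding arrow_ideal_power_def path_series_def by blast
  then show ?thesis by (simp add: fscale.subspace_def fscale_def)
qed

lemma bidegree_partI:
  assumes "\<And>z. f z \<noteq> 0 \<Longrightarrow> z \<in> paths G \<and> path_degree cd z = p \<and> path_degree idg z = q"
  shows "f \<in> bidegree_part G cd idg p q"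
  using assms unfolding bidegree_part_def path_series_def by blast

lemma bidegree_partD:
  assumes "f \<in> bidegree_part G cd idg p q" "f z \<noteq> 0"
  shows "z \<in> paths G" "path_degree cd z = p" "path_degree idg z = q"
  using assms unfolding bidegree_part_def path_series_def by blast+

lemma bidegree_part_series: "f \<in> bidegree_part G cd idg p q \<Longrightarrow> f \<in> path_series G"
  unfolding bidegree_part_def by blast

lemma arrow_ideal_power_series: "f \<in> arrow_ideal_power G n \<Longrightarrow> f \<in> path_series G"
  unfolding arrow_ideal_power_def by blast

lemma arrow_ideal_powerI:
  assumes "f \<in> path_series G" "\<And>z. f z \<noteq> 0 \<Longrightarrow> n \<le> length (parcs z)"
  shows "f \<in> arrow_ideal_power G n"
  using assms by (simp add: arrow_ideal_power_def) (meson leD)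

lemma arrow_ideal_powerD: "f \<in> arrow_ideal_power G n \<Longrightarrow> f z \<noteq> 0 \<Longrightarrow> n \<le> length (parcs z)"
  by (simp add: arrow_ideal_power_def) (meson not_le)

text \<open>The coordinate of \<open>f\<close> at the basis element \<open>g\<close> when the arrow
  ideal is regarded as a free right module on the arrows. With right-to-left composition the arrow
  removed is the one traversed last.\<close>

definition left_div ::
  "('v, 'e) pre_digraph \<Rightarrow> 'e \<Rightarrow> ('v, 'e) series \<Rightarrow> ('v, 'e) series"
  where "left_div G g f =
    (\<lambda>z. if z \<in> paths G \<and> ptgt z = tail G g then f (path_comp (arc_path G g) z) else 0)"

context wf_digraph
begin

lemma nontrivial_path_cases:
  assumes "z \<in> paths G" "parcs z \<noteq> []"
  obtains g y where "g \<in> arcs G" "y \<in> paths G" "ptgt y = tail G g" "z = path_comp (arc_path G g) y"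
proof -
  from assms(2) obtain l g where l: "parcs z = l @ [g]"
    by (cases "parcs z" rule: rev_cases) auto
  have "awalk (psrc z) (l @ [g]) (ptgt z)"
    using assms(1) l by (simp add: path_iff_awalk)
  then have *: "awalk (psrc z) l (tail G g)" "g \<in> arcs G" "head G g = ptgt z"
    by (auto simp: awalk_Cons_iff awalk_Nil_iff)
  show ?thesis
    by (rule that[of g "(psrc z, l, tail G g)"]) (use * l in \<open>auto intro!: path_eqI\<close>)
qed

lemma nontrivial_path_cases_last:
  assumes "z \<in> paths G" "parcs z \<noteq> []"
  obtains g y where "g \<in> arcs G" "y \<in> paths G" "psrc y = head G g" "z = path_comp y (arc_path G g)"
proof -
  from assms(2) obtain l g where l: "parcs z = g # l"
    by (cases "parcs z") auto
  have "awalk (psrc z) (g # l) (ptgt z)"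
    using assms(1) l by (simp add: path_iff_awalk)
  then have *: "awalk (head G g) l (ptgt z)" "g \<in> arcs G" "tail G g = psrc z"
    by (auto simp: awalk_Cons_iff)
  show ?thesis
    by (rule that[of g "(head G g, l, ptgt z)"]) (use * l in \<open>auto intro!: path_eqI\<close>)
qed

lemma series_mult_nonzero:
  assumes "series_mult G f g z \<noteq> 0"
  obtains x y where "x \<in> paths G" "y \<in> paths G" "psrc x = ptgt y" "z = path_comp x y"
    "f x \<noteq> 0" "g y \<noteq> 0"
  using assms unfolding series_mult_eq_split_sum by (rule split_sum_nonzero) (use that in auto)

lemma series_mult_single_right_eq_0:
  assumes "\<And>x. x \<in> paths G \<Longrightarrow> psrc x = ptgt y \<Longrightarrow> z \<noteq> path_comp x y"
  shows "series_mult G f (single_path y) z = 0"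
proof (rule ccontr)
  assume "series_mult G f (single_path y) z \<noteq> 0"
  then show False
    by (rule series_mult_nonzero) (use assms in \<open>auto simp: single_path_def split: if_splits\<close>)
qed

lemma series_mult_single_right:
  assumes x: "x \<in> paths G" and y: "y \<in> paths G" and c: "psrc x = ptgt y"
  shows "series_mult G f (single_path y) (path_comp x y) = f x"
proof -
  have "f (fst p) * single_path y (snd p) = 0" if "p \<in> splits G (path_comp x y) - {(x, y)}" for p
  proof -
    have "snd p \<noteq> y"
    proof
      assume "snd p = y"
      then have p: "path_comp (fst p) y = path_comp x y" "psrc (fst p) = psrc x" "p = (fst p, y)"
        using that c by (auto simp: splits_def)
      have "fst p = x"
        using arg_cong[OF p(1), of parcs] arg_cong[OF p(1), of ptgt] p(2) by (intro path_eqI) auto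
      with p(3) that show False by auto
    qed
    then show ?thesis by (simp add: single_path_def)
  qed
  then have "series_mult G f (single_path y) (path_comp x y) = (\<Sum>p\<in>{(x, y)}. f (fst p) * single_path y (snd p))"
    unfolding series_mult_apply case_prod_unfold
    using assms by (intro sum.mono_neutral_right) (auto simp: splits_iff)
  then show ?thesis by (simp add: single_path_def)
qed

lemma series_mult_bidegree_part:
  assumes "f \<in> bidegree_part G cd idg p q" "g \<in> bidegree_part G cd idg p' q'"
  shows "series_mult G f g \<in> bidegree_part G cd idg (p + p') (q + q')"
proof (rule bidegree_partI)
  fix z assume "series_mult G f g z \<noteq> 0"
  then obtain x y where "x \<in> paths G" "y \<in> paths G" "psrc x = ptgt y" "z = path_comp x y"
      "f x \<noteq> 0" "g y \<noteq> 0" by (rule series_mult_nonzero)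
  with bidegree_partD[OF assms(1), of x] bidegree_partD[OF assms(2), of y]
  show "z \<in> paths G \<and> path_degree cd z = p + p' \<and> path_degree idg z = q + q'"
    by simp
qed

lemma series_mult_arrow_ideal:
  assumes "f \<in> arrow_ideal_power G n"
  shows "series_mult G f g \<in> arrow_ideal_power G n" "series_mult G g f \<in> arrow_ideal_power G n"
proof -
  show "series_mult G f g \<in> arrow_ideal_power G n"
    by (rule arrow_ideal_powerI) (auto elim!: series_mult_nonzero dest: arrow_ideal_powerD[OF assms])
  show "series_mult G g f \<in> arrow_ideal_power G n"
    by (rule arrow_ideal_powerI) (auto elim!: series_mult_nonzero dest: arrow_ideal_powerD[OF assms])
qed

lemma series_mult_trivial_coeff:
  "i \<in> verts G \<Longrightarrow> series_mult G f g (i, [], i) = f (i, [], i) * g (i, [], i)"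
  unfolding series_mult_eq_split_sum
  by (subst split_sum_left_trivial) (auto simp: awalk_Nil_iff dest: arg_cong[of _ _ parcs])

lemma idempotent_part: "i \<in> verts G \<Longrightarrow> idempotent i \<in> bidegree_part G cd idg 0 0"
  by (rule bidegree_partI) (auto simp: idempotent_def single_path_def awalk_Nil_iff split: if_splits)

lemma single_path_part:
  "x \<in> paths G \<Longrightarrow> single_path x \<in> bidegree_part G cd idg (path_degree cd x) (path_degree idg x)"
  by (rule bidegree_partI) (auto simp: single_path_def split: if_splits)

lemma path_diff_idempotent [simp]: "path_diff G cd D (idempotent i) = 0"
proof (rule ccontr)
  assume "path_diff G cd D (idempotent i) \<noteq> 0"
  then obtain z where "path_diff G cd D (idempotent i) z \<noteq> 0" by (auto simp: fun_eq_iff)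
  then show False
    by (rule path_diff_nonzero)
      (auto simp: idempotent_def single_path_def dest: arg_cong[of _ _ parcs] split: if_splits)
qed

lemma left_div_apply:
  "z \<in> paths G \<Longrightarrow> ptgt z = tail G g \<Longrightarrow> left_div G g f z = f (path_comp (arc_path G g) z)"
  by (simp add: left_div_def)

lemma left_div_linear [simp]:
  "left_div G g (f + f') = left_div G g f + left_div G g f'"
  "left_div G g (fscale c f) = fscale c (left_div G g f)"
  "left_div G g (- f) = - left_div G g f"
  "left_div G g 0 = 0"
  by (rule ext; simp add: left_div_def)+

lemma left_div_in_path_series: "left_div G g f \<in> path_series G"
proof -
  have "z \<in> paths G" if "left_div G g f z \<noteq> 0" for z
    using that by (simp add: left_div_def split: if_splits)
  then show ?thesis unfolding path_series_def by blast
qed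

lemma left_div_part:
  assumes "f \<in> bidegree_part G cd idg p q"
  shows "left_div G g f \<in> bidegree_part G cd idg (p - cd g) (q - idg g)"
proof (rule bidegree_partI)
  fix z assume "left_div G g f z \<noteq> 0"
  then have "z \<in> paths G" "f (path_comp (arc_path G g) z) \<noteq> 0"
    by (auto simp: left_div_def split: if_splits)
  with bidegree_partD[OF assms, of "path_comp (arc_path G g) z"]
  show "z \<in> paths G \<and> path_degree cd z = p - cd g \<and> path_degree idg z = q - idg g"
    by simp
qed

lemma left_div_arrow_ideal:
  assumes "f \<in> arrow_ideal_power G (Suc n)"
  shows "left_div G g f \<in> arrow_ideal_power G n"
proof (rule arrow_ideal_powerI[OF left_div_in_path_series])
  fix z assume "left_div G g f z \<noteq> 0"
  then have "f (path_comp (arc_path G g) z) \<noteq> 0"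
    by (simp add: left_div_def split: if_splits)
  from arrow_ideal_powerD[OF assms this] show "n \<le> length (parcs z)" by simp
qed

text \<open>In a cut of \<open>g z\<close> the arrow \<open>g\<close> falls into the right factor
  only if the left factor is trivial, and there \<open>f\<close> vanishes because it lies in the
  arrow ideal. Hence coordinates are linear over the right action.\<close>

lemma left_div_mult:
  assumes g: "g \<in> arcs G" and f: "f \<in> arrow_ideal_power G 1"
  shows "left_div G g (series_mult G f h) = series_mult G (left_div G g f) h"
proof
  fix z
  show "left_div G g (series_mult G f h) z = series_mult G (left_div G g f) h z"
  proof (cases "z \<in> paths G \<and> ptgt z = tail G g")
    case True
    \<comment> \<open>Prefixing a trivial path brings \<open>g z\<close> into the shape
      \<open>x g y\<close> of the cutting rule.\<close>
    define t where "t = (head G g, [] :: 'b list, head G g)"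
    have t: "t \<in> paths G" "psrc t = head G g"
      using g by (auto simp: t_def awalk_Nil_iff)
    have z: "path_comp (arc_path G g) z = path_comp t (path_comp (arc_path G g) z)"
      by (simp add: t_def)
    have f0: "f x = 0" if "parcs x = []" for x
      using arrow_ideal_powerD[OF f, of x] that by auto
    have "left_div G g (series_mult G f h) z =
        split_sum G (\<lambda>x y. f x * h y) (path_comp t (path_comp (arc_path G g) z))"
      using True by (simp add: left_div_apply series_mult_eq_split_sum z[symmetric])
    also have "\<dots> = split_sum G (\<lambda>x1 x2. f x1 * h (path_comp x2 (path_comp (arc_path G g) z))) t +
        split_sum G (\<lambda>y1 y2. f (path_comp t (path_comp (arc_path G g) y1)) * h y2) z"
      using True t g by (intro split_sum_comp_arc) auto
    also have "split_sum G (\<lambda>x1 x2. f x1 * h (path_comp x2 (path_comp (arc_path G g) z))) t =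
        split_sum G (\<lambda>_ _. 0) t"
    proof (rule split_sum_cong)
      fix x1 x2 assume "path_comp x1 x2 = t"
      then have "parcs x1 = []" by (auto simp: t_def dest!: arg_cong[of _ _ parcs])
      then show "f x1 * h (path_comp x2 (path_comp (arc_path G g) z)) = 0" by (simp add: f0)
    qed
    also have "split_sum G (\<lambda>y1 y2. f (path_comp t (path_comp (arc_path G g) y1)) * h y2) z =
        series_mult G (left_div G g f) h z"
      unfolding series_mult_eq_split_sum
    proof (rule split_sum_cong)
      fix y1 y2 assume y: "y1 \<in> paths G" "path_comp y1 y2 = z"
      have "path_comp t (path_comp (arc_path G g) y1) = path_comp (arc_path G g) y1"
        by (simp add: t_def)
      moreover have "ptgt y1 = tail G g" using y True by auto
      ultimately show "f (path_comp t (path_comp (arc_path G g) y1)) * h y2 = left_div G g f y1 * h y2"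
        using y by (simp add: left_div_apply)
    qed
    finally show ?thesis by simp
  next
    case False
    have "series_mult G (left_div G g f) h z = 0"
    proof (rule ccontr)
      assume "series_mult G (left_div G g f) h z \<noteq> 0"
      then show False
        by (rule series_mult_nonzero) (use False in \<open>auto simp: left_div_def split: if_splits\<close>)
    qed
    then show ?thesis using False by (auto simp: left_div_def)
  qed
qed

lemma left_div_single_arc:
  assumes "g \<in> arcs G" "g' \<in> arcs G"
  shows "left_div G g (single_path (arc_path G g')) = (if g = g' then idempotent (tail G g) else 0)"
proof -
  have "path_comp (arc_path G g) z = arc_path G g' \<longleftrightarrow> g = g' \<and> z = (tail G g, [], tail G g)"
    if z: "ptgt z = tail G g" for z
  proof
    assume e: "path_comp (arc_path G g) z = arc_path G g'"
    from arg_cong[OF e, of parcs] have "parcs z = []" "g = g'"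
      by (auto simp: append_eq_Cons_conv)
    moreover have "psrc z = tail G g'"
      using arg_cong[OF e, of psrc] by simp
    ultimately show "g = g' \<and> z = (tail G g, [], tail G g)"
      using z by (auto intro: path_eqI)
  qed (auto intro: path_eqI)
  then show ?thesis
    using assms by (auto simp: fun_eq_iff left_div_def single_path_def idempotent_def awalk_Nil_iff)
qed

end

context fin_digraph
begin

text \<open>Every nontrivial path has exactly one leftmost arrow, so at each path a single summand
  survives. Together with \<open>left_div_mult\<close> and \<open>left_div_single_arc\<close> this
  is the freeness of the arrow ideal as a right module.\<close>

lemma left_div_decomp:
  assumes f: "f \<in> arrow_ideal_power G 1" and i: "\<And>z. f z \<noteq> 0 \<Longrightarrow> ptgt z = i"
  shows "(\<Sum>g\<in>{g \<in> arcs G. head G g = i}. series_mult G (single_path (arc_path G g)) (left_div G g f)) = f"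
proof
  fix z
  let ?A = "{g \<in> arcs G. head G g = i}"
  have "(\<Sum>g\<in>?A. series_mult G (single_path (arc_path G g)) (left_div G g f) z) = f z"
  proof (cases "f z = 0 \<and> \<not> (\<exists>g\<in>?A. series_mult G (single_path (arc_path G g)) (left_div G g f) z \<noteq> 0)")
    case False
    have "\<exists>g\<in>?A. \<exists>y\<in>paths G. ptgt y = tail G g \<and> z = path_comp (arc_path G g) y"
    proof (cases "f z = 0")
      case False
      then have "z \<in> paths G" "parcs z \<noteq> []"
        using path_seriesD[OF arrow_ideal_power_series[OF f], of z] arrow_ideal_powerD[OF f, of z]
        by auto
      then obtain g y where "g \<in> arcs G" "y \<in> paths G" "ptgt y = tail G g" "z = path_comp (arc_path G g) y"
        by (rule nontrivial_path_cases)
      then show ?thesis using i[OF False] by auto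
    next
      case True
      with False obtain g where g: "g \<in> ?A"
        "series_mult G (single_path (arc_path G g)) (left_div G g f) z \<noteq> 0" by blast
      from g(2) obtain x y where "x \<in> paths G" "y \<in> paths G" "psrc x = ptgt y" "z = path_comp x y"
        "single_path (arc_path G g) x \<noteq> 0" by (rule series_mult_nonzero)
      then show ?thesis using g(1)
        by (intro bexI[of _ g] bexI[of _ y]) (auto simp: single_path_def split: if_splits)
    qed
    then obtain g y where g: "g \<in> ?A" and y: "y \<in> paths G" "ptgt y = tail G g"
      and z: "z = path_comp (arc_path G g) y" by blast
    have "(\<Sum>g\<in>?A. series_mult G (single_path (arc_path G g)) (left_div G g f) z) =
        (\<Sum>g'\<in>{g}. series_mult G (single_path (arc_path G g')) (left_div G g' f) z)"
    proof (rule sum.mono_neutral_right)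
      show "\<forall>g'\<in>?A - {g}. series_mult G (single_path (arc_path G g')) (left_div G g' f) z = 0"
      proof
        fix g' assume "g' \<in> ?A - {g}"
        then show "series_mult G (single_path (arc_path G g')) (left_div G g' f) z = 0"
          unfolding z by (intro series_mult_single_left_eq_0) (auto dest: arg_cong[of _ _ parcs])
      qed
    qed (use g in auto)
    also have "\<dots> = f z"
      using g y unfolding z by (simp add: series_mult_single_left left_div_apply)
    finally show ?thesis .
  qed auto
  then show "(\<Sum>g\<in>?A. series_mult G (single_path (arc_path G g)) (left_div G g f)) z = f z"
    by (simp only: sum_fun_apply)
qed

lemma one_mult:
  assumes "f \<in> path_series G"
  shows "series_mult G (\<Sum>i\<in>verts G. idempotent i) f = f"
    "series_mult G f (\<Sum>i\<in>verts G. idempotent i) = f"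
proof -
  have z: "ptgt z \<in> verts G" "psrc z \<in> verts G" if "f z \<noteq> 0" for z
    using that assms ptgt_in_verts psrc_in_verts unfolding path_series_def by blast+
  have "(\<Sum>i\<in>verts G. if ptgt z = i then f z else 0) = f z" "(\<Sum>i\<in>verts G. if psrc z = i then f z else 0) = f z" for z
    using z[of z] by (auto simp: sum.delta)
  then show "series_mult G (\<Sum>i\<in>verts G. idempotent i) f = f"
    "series_mult G f (\<Sum>i\<in>verts G. idempotent i) = f"
    using assms by (simp_all add: series_mult_sum idempotent_mult_left idempotent_mult_right sum_fun_apply
        fun_eq_iff)
qed

lemma finite_paths_upto: "finite {z \<in> paths G. length (parcs z) \<le> n}"
proof (rule finite_subset)
  show "{z \<in> paths G. length (parcs z) \<le> n} \<subseteq>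
      verts G \<times> {p. set p \<subseteq> arcs G \<and> length p \<le> n} \<times> verts G"
  proof
    fix z assume z: "z \<in> {z \<in> paths G. length (parcs z) \<le> n}"
    then have "psrc z \<in> verts G" "set (parcs z) \<subseteq> arcs G" "ptgt z \<in> verts G"
      using psrc_in_verts[of z] ptgt_in_verts[of z] by (auto simp: path_iff_awalk awalk_def)
    moreover have "z = (psrc z, parcs z, ptgt z)" by (rule path_eqI) simp_all
    ultimately show "z \<in> verts G \<times> {p. set p \<subseteq> arcs G \<and> length p \<le> n} \<times> verts G"
      using z by (metis (mono_tags, lifting) SigmaI mem_Collect_eq)
  qed
  show "finite (verts G \<times> {p. set p \<subseteq> arcs G \<and> length p \<le> n} \<times> verts G)"
    by (intro finite_cartesian_product finite_lists_length_le) auto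
qed

end

text \<open>\<open>D_ideal\<close> ensures that differentiation never shortens a path, whence
  continuity and locality. \<open>path_diff\<close> reads \<open>D g\<close> only at paths parallel
  to \<open>g\<close>; \<open>D_parallel\<close> guarantees that nothing of \<open>D g\<close> is
  lost in this way.\<close>

locale path_derivation = fin_digraph G
  for G :: "('v, 'e) pre_digraph" +
  fixes cd idg :: "'e \<Rightarrow> int" and D :: "'e \<Rightarrow> ('v, 'e) series"
  assumes cd_nonpos: "g \<in> arcs G \<Longrightarrow> cd g \<le> 0"
    and D_part: "g \<in> arcs G \<Longrightarrow> D g \<in> bidegree_part G cd idg (cd g + 1) (idg g)"
    and D_ideal: "g \<in> arcs G \<Longrightarrow> D g \<in> arrow_ideal_power G 1"
    and D_parallel: "g \<in> arcs G \<Longrightarrow> D g z \<noteq> 0 \<Longrightarrow> psrc z = tail G g \<and> ptgt z = head G g"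
begin

abbreviation "part \<equiv> bidegree_part G cd idg"
abbreviation "diff \<equiv> path_diff G cd D"

text \<open>A path in the differential arises from a path of \<open>f\<close> by replacing one arrow
  \<open>g\<close> by a path of \<open>D g\<close>; how degrees, end points and length behave is
  read off from this replacement.\<close>

lemma diff_support:
  assumes "diff f z \<noteq> 0"
  obtains w where "w \<in> paths G" "f w \<noteq> 0" "psrc w = psrc z" "ptgt w = ptgt z"
    "path_degree cd z = path_degree cd w + 1" "path_degree idg z = path_degree idg w"
    "length (parcs w) \<le> length (parcs z)" "parcs z \<noteq> []"
proof -
  from assms obtain x g m y where *: "x \<in> paths G" "y \<in> paths G" "m \<in> paths G" "g \<in> arcs G"
    "tail G g = psrc m" "head G g = ptgt m" "psrc x = head G g" "ptgt y = tail G g"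
    "z = path_comp x (path_comp m y)" "f (path_comp x (path_comp (arc_path G g) y)) \<noteq> 0" "D g m \<noteq> 0"
    by (rule path_diff_nonzero)
  have "path_degree cd m = cd g + 1" "path_degree idg m = idg g" "1 \<le> length (parcs m)"
    using bidegree_partD[OF D_part[OF *(4)] *(11)] arrow_ideal_powerD[OF D_ideal[OF *(4)] *(11)] by auto
  then show ?thesis
    using * by (intro that[of "path_comp x (path_comp (arc_path G g) y)"]) auto
qed

lemma diff_part: "f \<in> part p q \<Longrightarrow> diff f \<in> part (p + 1) q"
proof (rule bidegree_partI)
  fix z assume f: "f \<in> part p q" and "diff f z \<noteq> 0"
  from this(2) obtain w where "w \<in> paths G" "f w \<noteq> 0"
    "path_degree cd z = path_degree cd w + 1" "path_degree idg z = path_degree idg w"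
    by (rule diff_support)
  with bidegree_partD[OF f, of w] \<open>diff f z \<noteq> 0\<close> path_seriesD[OF path_diff_in_path_series, of z cd D f]
  show "z \<in> paths G \<and> path_degree cd z = p + 1 \<and> path_degree idg z = q" by auto
qed

lemma diff_arrow_ideal: "f \<in> arrow_ideal_power G n \<Longrightarrow> diff f \<in> arrow_ideal_power G n"
proof (rule arrow_ideal_powerI)
  fix z assume f: "f \<in> arrow_ideal_power G n" and "diff f z \<noteq> 0"
  from this(2) obtain w where "f w \<noteq> 0" "length (parcs w) \<le> length (parcs z)"
    by (rule diff_support)
  with arrow_ideal_powerD[OF f, of w] show "n \<le> length (parcs z)" by auto
qed simp

lemma diff_in_ideal: "diff f \<in> arrow_ideal_power G 1"
  by (rule arrow_ideal_powerI) (auto elim!: diff_support simp: Suc_le_eq)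

lemma leibniz: "f \<in> part p q \<Longrightarrow>
  diff (series_mult G f h) = series_mult G (diff f) h + fscale (parity_sign p) (series_mult G f (diff h))"
  by (rule path_diff_mult) (rule bidegree_partD(2))

text \<open>Only trivial paths can surround the arrow, so both outer sums collapse to one cut each;
  \<open>D_parallel\<close> covers the paths at which no parallel arrow is found.\<close>

lemma diff_single_arc:
  assumes "g \<in> arcs G"
  shows "diff (single_path (arc_path G g)) = D g"
proof
  fix z
  let ?f = "single_path (arc_path G g)"
  let ?K = "\<lambda>x m y. \<Sum>g'\<in>{g' \<in> arcs G. tail G g' = psrc m \<and> head G g' = ptgt m}.
      parity_sign (path_degree cd x) * ?f (path_comp x (path_comp (arc_path G g') y)) * D g' m"
  have K0: "?K x m y = 0" if "parcs x \<noteq> [] \<or> parcs y \<noteq> []" for x m y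
  proof (rule sum.neutral, rule)
    fix g'
    have "path_comp x (path_comp (arc_path G g') y) \<noteq> arc_path G g"
      using that by (auto dest!: arg_cong[of _ _ parcs] simp: append_eq_Cons_conv)
    then show "parity_sign (path_degree cd x) * ?f (path_comp x (path_comp (arc_path G g') y)) * D g' m = 0"
      by (simp add: single_path_def)
  qed
  have "diff ?f z = split_sum G (\<lambda>x. split_sum G (?K x)) z"
    by (simp add: path_diff_def)
  also have "\<dots> = (if z \<in> paths G then split_sum G (?K (ptgt z, [], ptgt z)) z else 0)"
  proof (rule split_sum_left_trivial)
    fix x w :: "('v, 'e) path"
    assume x: "parcs x \<noteq> []"
    have "split_sum G (?K x) w = split_sum G (\<lambda>_ _. 0) w"
      by (rule split_sum_cong) (rule K0, simp add: x)
    then show "split_sum G (?K x) w = 0" by simp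
  qed
  also have "split_sum G (?K (ptgt z, [], ptgt z)) z =
      (if z \<in> paths G then ?K (ptgt z, [], ptgt z) z (psrc z, [], psrc z) else 0)"
    by (rule split_sum_right_trivial) (rule K0, simp)
  also have "?K (ptgt z, [], ptgt z) z (psrc z, [], psrc z) =
      (\<Sum>g'\<in>{g' \<in> arcs G. tail G g' = psrc z \<and> head G g' = ptgt z}. if g' = g then D g z else 0)"
  proof (rule sum.cong[OF refl])
    fix g' assume "g' \<in> {g' \<in> arcs G. tail G g' = psrc z \<and> head G g' = ptgt z}"
    then have "path_comp (ptgt z, [], ptgt z) (path_comp (arc_path G g') (psrc z, [], psrc z)) = arc_path G g'"
      by simp
    moreover have "arc_path G g' = arc_path G g \<longleftrightarrow> g' = g"
      by (auto dest: arg_cong[of _ _ parcs])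
    ultimately show "parity_sign (path_degree cd (ptgt z, [], ptgt z)) *
        ?f (path_comp (ptgt z, [], ptgt z) (path_comp (arc_path G g') (psrc z, [], psrc z))) * D g' z =
        (if g' = g then D g z else 0)"
      by (simp add: single_path_def)
  qed
  also have "\<dots> = (if tail G g = psrc z \<and> head G g = ptgt z then D g z else 0)"
    using assms by (auto simp: sum.delta)
  finally show "diff ?f z = D g z"
    using D_parallel[OF assms, of z] bidegree_partD(1)[OF D_part[OF assms], of z]
    by (cases "D g z = 0") auto
qed

text \<open>Since paths never get shorter, a coefficient of the differential depends on finitely
  many coefficients of the argument. This reduces identities for series to identities for single
  paths.\<close>

lemma diff_local:
  assumes "\<And>w. w \<in> paths G \<Longrightarrow> length (parcs w) \<le> length (parcs z) \<Longrightarrow> f w = f' w"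
  shows "diff f z = diff f' z"
proof (rule ccontr)
  assume "diff f z \<noteq> diff f' z"
  then have "diff (f - f') z \<noteq> 0" by simp
  then show False by (rule diff_support) (use assms in auto)
qed

end

locale path_dga = path_derivation G cd idg D
  for G :: "('v, 'e) pre_digraph" and cd idg :: "'e \<Rightarrow> int" and D :: "'e \<Rightarrow> ('v, 'e) series" +
  assumes D_closed: "g \<in> arcs G \<Longrightarrow> diff (D g) = 0"
begin

text \<open>Strip the leftmost arrow \<open>g\<close> and apply the Leibniz rule twice: the two
  mixed terms carry the signs of \<open>cd g + 1\<close> and \<open>cd g\<close> and cancel, and the
  outer terms vanish by \<open>D_closed\<close> and by induction on the length.\<close>

lemma diff_diff_single: "z \<in> paths G \<Longrightarrow> diff (diff (single_path z)) = 0"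
proof (induction "length (parcs z)" arbitrary: z)
  case 0
  then obtain i where "z = (i, [], i)" using trivial_path_eq[of z] by auto
  then have "diff (single_path z) = 0"
    using path_diff_idempotent[of cd D i] by (simp add: idempotent_def)
  then show ?case by (simp only: path_diff_simps)
next
  case (Suc n)
  have "parcs z \<noteq> []" using Suc.hyps(2) by auto
  with Suc.prems obtain g y where g: "g \<in> arcs G" and y: "y \<in> paths G"
    and gy: "ptgt y = tail G g" and z: "z = path_comp (arc_path G g) y"
    by (rule nontrivial_path_cases)
  have "diff (diff (single_path y)) = 0"
    using Suc.hyps(2) y by (intro Suc.hyps(1)) (auto simp: z)
  moreover have "single_path z = series_mult G (single_path (arc_path G g)) (single_path y)"
    unfolding z using g y gy by (intro single_path_mult[symmetric]) auto
  moreover have "single_path (arc_path G g) \<in> part (cd g) (idg g)"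
    using single_path_part[of "arc_path G g" cd idg] g by simp
  ultimately show ?case
    by (simp add: leibniz[OF D_part[OF g]] leibniz diff_single_arc[OF g] D_closed[OF g] path_diff_linear)
qed

lemma diff_diff [simp]:
  assumes f: "f \<in> path_series G"
  shows "diff (diff f) = 0"
proof
  fix z :: "('v, 'e) path"
  \<comment> \<open>The coefficient at \<open>z\<close> sees only paths no longer than
    \<open>z\<close>; \<open>f'\<close> is the corresponding truncation, a finite combination of
    single paths.\<close>
  define A where "A = {w \<in> paths G. length (parcs w) \<le> length (parcs z)}"
  have fin: "finite A" unfolding A_def by (rule finite_paths_upto)
  define f' where "f' = (\<Sum>w\<in>A. fscale (f w) (single_path w))"
  have f': "f' w = f w" if "w \<in> A" for w
    using fin that by (simp add: f'_def sum_fun_apply single_path_def if_distrib[of "(*) _"] cong: if_cong)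
  have "diff (diff f) z = diff (diff f') z"
  proof (rule diff_local)
    fix w assume "w \<in> paths G" "length (parcs w) \<le> length (parcs z)"
    then show "diff f w = diff f' w"
      by (intro diff_local) (simp add: f' A_def)
  qed
  also have "diff (diff f') = (\<Sum>w\<in>A. fscale (f w) (diff (diff (single_path w))))"
    by (simp add: f'_def path_diff_sum path_diff_linear)
  also have "\<dots> = 0"
    by (rule sum.neutral) (auto simp: A_def diff_diff_single fscale_def fun_eq_iff)
  finally show "diff (diff f) z = 0 z" .
qed

end


section \<open>Cyclic derivatives and the Ginzburg differential\<close>

lemma arrow_ideal_power_mono: "m \<le> n \<Longrightarrow> arrow_ideal_power G n \<subseteq> arrow_ideal_power G m"
  by (auto simp: arrow_ideal_power_def)

context wf_digraph
begin

text \<open>For \<open>z = v u\<close> the target of \<open>v\<close> and the source of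
  \<open>u\<close> are those of \<open>z\<close>, so the end conditions can be pulled out of the
  sum, leaving a plain sum over cuts.\<close>

lemma cyclic_derivative_eq_split_sum:
  "cyclic_derivative G a w z = (if ptgt z = tail G a \<and> psrc z = head G a
     then split_sum G (\<lambda>v u. w (path_comp u (path_comp (arc_path G a) v))) z else 0)"
proof -
  have "{(v, u) \<in> splits G z. ptgt v = tail G a \<and> psrc u = head G a} =
      (if ptgt z = tail G a \<and> psrc z = head G a then splits G z else {})"
    unfolding splits_def by auto
  then show ?thesis
    by (simp add: cyclic_derivative_def split_sum_def)
qed

lemma cyclic_derivative_linear:
  "cyclic_derivative G a (f + g) = cyclic_derivative G a f + cyclic_derivative G a g"
  "cyclic_derivative G a (fscale c f) = fscale c (cyclic_derivative G a f)"
  by (simp_all add: fun_eq_iff cyclic_derivative_eq_split_sum split_sum_add split_sum_mult_left)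

lemma cyclic_derivative_diff:
  "cyclic_derivative G a (f - g) = cyclic_derivative G a f - cyclic_derivative G a g"
proof -
  have "f - g = f + fscale (- 1) g" by (simp add: fun_eq_iff)
  then show ?thesis
    by (simp only: cyclic_derivative_linear) (simp add: fun_eq_iff)
qed

lemma cyclic_derivative_nonzero:
  assumes "cyclic_derivative G a w z \<noteq> 0"
  obtains v u where "v \<in> paths G" "u \<in> paths G" "psrc v = ptgt u" "z = path_comp v u"
    "ptgt v = tail G a" "psrc u = head G a" "w (path_comp u (path_comp (arc_path G a) v)) \<noteq> 0"
proof -
  from assms have z: "ptgt z = tail G a" "psrc z = head G a"
    and "split_sum G (\<lambda>v u. w (path_comp u (path_comp (arc_path G a) v))) z \<noteq> 0"
    by (auto simp: cyclic_derivative_eq_split_sum split: if_splits)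
  from this(3) show ?thesis
    by (rule split_sum_nonzero) (use that z in auto)
qed

text \<open>
  In the cycle \<open>u a v\<close> either \<open>u\<close> or \<open>v\<close> is cut in two; interchanging the factors of the
  product interchanges the two kinds of terms.
\<close>

lemma cyclic_derivative_mult_commute:
  assumes a: "a \<in> arcs G"
  shows "cyclic_derivative G a (series_mult G f g) = cyclic_derivative G a (series_mult G g f)"
proof -
  have expand: "cyclic_derivative G a (series_mult G f g) z =
      split_sum G (\<lambda>v. split_sum G (\<lambda>u1 u2. f u1 * g (path_comp u2 (path_comp (arc_path G a) v)))) z +
      split_sum G (\<lambda>v1. split_sum G (\<lambda>v2 u. g v2 * f (path_comp u (path_comp (arc_path G a) v1)))) z"
    if z: "ptgt z = tail G a \<and> psrc z = head G a" for f g z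
  proof -
    have "cyclic_derivative G a (series_mult G f g) z =
        split_sum G (\<lambda>v u.
          split_sum G (\<lambda>u1 u2. f u1 * g (path_comp u2 (path_comp (arc_path G a) v))) u +
          split_sum G (\<lambda>v1 v2. g v2 * f (path_comp u (path_comp (arc_path G a) v1))) v) z"
      unfolding cyclic_derivative_eq_split_sum if_P[OF z]
    proof (rule split_sum_cong)
      fix v u assume "v \<in> paths G" "u \<in> paths G" "path_comp v u = z"
      then show "series_mult G f g (path_comp u (path_comp (arc_path G a) v)) =
          split_sum G (\<lambda>u1 u2. f u1 * g (path_comp u2 (path_comp (arc_path G a) v))) u +
          split_sum G (\<lambda>v1 v2. g v2 * f (path_comp u (path_comp (arc_path G a) v1))) v"
        using a z unfolding series_mult_eq_split_sum
        by (subst split_sum_comp_arc) (auto simp: mult.commute)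
    qed
    then show ?thesis by (simp add: split_sum_add split_sum_assoc)
  qed
  show ?thesis
  proof
    fix z
    show "cyclic_derivative G a (series_mult G f g) z = cyclic_derivative G a (series_mult G g f) z"
    proof (cases "ptgt z = tail G a \<and> psrc z = head G a")
      case True
      show ?thesis by (simp only: expand[OF True] add.commute)
    qed (simp only: cyclic_derivative_eq_split_sum if_False)
  qed
qed

lemma cyclic_derivative_commutator_closure:
  assumes a: "a \<in> arcs G" and c: "c \<in> commutator_closure G"
  shows "cyclic_derivative G a c = 0"
proof
  fix z :: "('a, 'b) path"
  \<comment> \<open>The coefficient at \<open>z\<close> involves only paths \<open>u a v\<close> of
    length one more than that of \<open>z\<close>; an approximation modulo the power
    \<open>length (parcs z) + 2\<close> is exact on them.\<close>
  from c obtain b where b: "b \<in> fscale.span (commutators G)"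
    and cb: "c - b \<in> arrow_ideal_power G (length (parcs z) + 2)"
    unfolding commutator_closure_def by blast
  have "cyclic_derivative G a 0 = 0"
    using cyclic_derivative_diff[of a 0 0] by (simp only: diff_self)
  then have "fscale.subspace {f. cyclic_derivative G a f = 0}"
    by (simp add: fscale.subspace_def cyclic_derivative_linear fun_eq_iff)
  moreover have "commutators G \<subseteq> {f. cyclic_derivative G a f = 0}"
    using cyclic_derivative_mult_commute[OF a] by (auto simp: commutators_def cyclic_derivative_diff)
  ultimately have "cyclic_derivative G a b = 0"
    using b fscale.span_minimal[of "commutators G" "{f. cyclic_derivative G a f = 0}"] by auto
  moreover have "cyclic_derivative G a (c - b) z = 0"
  proof (rule ccontr)
    assume "cyclic_derivative G a (c - b) z \<noteq> 0"
    then obtain v u where "z = path_comp v u" "(c - b) (path_comp u (path_comp (arc_path G a) v)) \<noteq> 0"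
      by (rule cyclic_derivative_nonzero)
    with arrow_ideal_powerD[OF cb this(2)] show False by simp
  qed
  ultimately show "cyclic_derivative G a c z = 0 z"
    by (simp add: cyclic_derivative_diff)
qed

text \<open>The coset is not empty and the derivative is constant on it, so \<open>the_elem\<close>
  is applied to a singleton and any convenient representative of the potential may be used.\<close>

lemma potential_derivative_eq:
  assumes a: "a \<in> arcs G" and W: "W = potential_class G w"
  shows "potential_derivative G W a = cyclic_derivative G a w"
proof -
  have "0 \<in> path_series G" and ideal: "\<And>n. 0 \<in> arrow_ideal_power G n"
    using fscale.subspace_0[OF path_series_subspace] fscale.subspace_0[OF arrow_ideal_power_subspace] by auto
  moreover have "\<forall>n. \<exists>b\<in>fscale.span (commutators G). 0 - b \<in> arrow_ideal_power G n"
    by (intro allI bexI[of _ 0] fscale.span_zero) (simp only: diff_self ideal)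
  ultimately have "0 \<in> commutator_closure G"
    unfolding commutator_closure_def by blast
  then have "w \<in> W"
    unfolding W potential_class_def by (intro CollectI exI[of _ 0]) simp
  moreover have "cyclic_derivative G a w' = cyclic_derivative G a w" if "w' \<in> W" for w'
    using that cyclic_derivative_commutator_closure[OF a]
    by (auto simp: W potential_class_def cyclic_derivative_linear)
  ultimately have "cyclic_derivative G a ` W = {cyclic_derivative G a w}" by blast
  then show ?thesis by (simp add: potential_derivative_def)
qed

end

context fin_digraph
begin

text \<open>
  At a cycle \<open>z\<close>, both sums of products run over all cyclic rotations of \<open>z\<close>.
\<close>

lemma sum_commutator_cyclic_derivative:
  "(\<Sum>a\<in>arcs G. series_mult G (single_path (arc_path G a)) (cyclic_derivative G a w)) =
   (\<Sum>a\<in>arcs G. series_mult G (cyclic_derivative G a w) (single_path (arc_path G a)))"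
proof
  fix z :: "('a, 'b) path"
  \<comment> \<open>The two trivial cuts of the cycle \<open>z\<close> both give the rotation
    \<open>z\<close> itself; one copy of \<open>w z\<close> is subtracted so that each cyclic
    rotation counts once.\<close>
  have L: "(\<Sum>a\<in>arcs G. series_mult G (single_path (arc_path G a)) (cyclic_derivative G a w) z) =
      (if z \<in> paths G \<and> parcs z \<noteq> [] \<and> psrc z = ptgt z
       then split_sum G (\<lambda>x u. w (path_comp u x)) z - w z else 0)"
  proof (cases "z \<in> paths G \<and> parcs z \<noteq> []")
    case True
    then have "z \<in> paths G" "parcs z \<noteq> []" by auto
    then obtain b y where b: "b \<in> arcs G" and y: "y \<in> paths G" "ptgt y = tail G b"
      and z: "z = path_comp (arc_path G b) y" by (rule nontrivial_path_cases)
    have "(\<Sum>a\<in>arcs G. series_mult G (single_path (arc_path G a)) (cyclic_derivative G a w) z) =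
        (\<Sum>a\<in>{b}. series_mult G (single_path (arc_path G a)) (cyclic_derivative G a w) z)"
    proof (rule sum.mono_neutral_right)
      show "\<forall>a\<in>arcs G - {b}. series_mult G (single_path (arc_path G a)) (cyclic_derivative G a w) z = 0"
      proof
        fix a assume "a \<in> arcs G - {b}"
        then show "series_mult G (single_path (arc_path G a)) (cyclic_derivative G a w) z = 0"
          unfolding z by (intro series_mult_single_left_eq_0) (auto dest: arg_cong[of _ _ parcs])
      qed
    qed (use b in auto)
    also have "\<dots> = cyclic_derivative G b w y"
      unfolding z using b y by (simp add: series_mult_single_left)
    also have "\<dots> = (if psrc z = ptgt z then split_sum G (\<lambda>x u. w (path_comp u x)) z - w z else 0)"
    proof (cases "psrc z = ptgt z")
      case closed: True
      define t where "t = (head G b, [] :: 'b list, head G b)"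
      have t: "t \<in> paths G" "path_comp t z = z" "\<And>v. path_comp t (path_comp (arc_path G b) v) = path_comp (arc_path G b) v"
        using b by (auto simp: t_def z awalk_Nil_iff)
      have zt: "path_comp z t = z" using closed by (auto simp: t_def z)
      have "split_sum G (\<lambda>x u. w (path_comp u x)) (path_comp t (path_comp (arc_path G b) y)) =
          split_sum G (\<lambda>x1 x2. w (path_comp (path_comp x2 (path_comp (arc_path G b) y)) x1)) t +
          split_sum G (\<lambda>y1 y2. w (path_comp y2 (path_comp t (path_comp (arc_path G b) y1)))) y"
        using b y t by (intro split_sum_comp_arc) (auto simp: t_def)
      also have "split_sum G (\<lambda>x1 x2. w (path_comp (path_comp x2 (path_comp (arc_path G b) y)) x1)) t = w z"
      proof -
        have "splits G t = {(t, t)}"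
          using b by (auto simp: splits_iff t_def awalk_Nil_iff)
        then show ?thesis using t(2) zt by (simp add: split_sum_def z)
      qed
      also have "split_sum G (\<lambda>y1 y2. w (path_comp y2 (path_comp t (path_comp (arc_path G b) y1)))) y =
          cyclic_derivative G b w y"
        using closed y by (simp add: cyclic_derivative_eq_split_sum t z)
      finally show ?thesis using closed t by (simp add: z)
    next
      case False
      then show ?thesis by (auto simp: cyclic_derivative_eq_split_sum z)
    qed
    finally show ?thesis using True by simp
  next
    case False
    have "series_mult G (single_path (arc_path G a)) (cyclic_derivative G a w) z = 0" if "a \<in> arcs G" for a
      using False that by (intro series_mult_single_left_eq_0) auto
    then show ?thesis using False by auto
  qed
  have R: "(\<Sum>a\<in>arcs G. series_mult G (cyclic_derivative G a w) (single_path (arc_path G a)) z) =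
      (if z \<in> paths G \<and> parcs z \<noteq> [] \<and> psrc z = ptgt z
       then split_sum G (\<lambda>x u. w (path_comp u x)) z - w z else 0)"
  proof (cases "z \<in> paths G \<and> parcs z \<noteq> []")
    case True
    then have "z \<in> paths G" "parcs z \<noteq> []" by auto
    then obtain b y where b: "b \<in> arcs G" and y: "y \<in> paths G" "psrc y = head G b"
      and z: "z = path_comp y (arc_path G b)" by (rule nontrivial_path_cases_last)
    have "(\<Sum>a\<in>arcs G. series_mult G (cyclic_derivative G a w) (single_path (arc_path G a)) z) =
        (\<Sum>a\<in>{b}. series_mult G (cyclic_derivative G a w) (single_path (arc_path G a)) z)"
    proof (rule sum.mono_neutral_right)
      show "\<forall>a\<in>arcs G - {b}. series_mult G (cyclic_derivative G a w) (single_path (arc_path G a)) z = 0"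
      proof
        fix a assume a: "a \<in> arcs G - {b}"
        show "series_mult G (cyclic_derivative G a w) (single_path (arc_path G a)) z = 0"
          unfolding z using a by (intro series_mult_single_right_eq_0) (auto dest: arg_cong[of _ _ parcs])
      qed
    qed (use b in auto)
    also have "\<dots> = cyclic_derivative G b w y"
      unfolding z using b y by (simp add: series_mult_single_right)
    also have "\<dots> = (if psrc z = ptgt z then split_sum G (\<lambda>x u. w (path_comp u x)) z - w z else 0)"
    proof (cases "psrc z = ptgt z")
      case closed: True
      define t where "t = (tail G b, [] :: 'b list, tail G b)"
      have t: "t \<in> paths G" "path_comp (arc_path G b) t = arc_path G b"
        using b by (auto simp: t_def awalk_Nil_iff)
      have tz: "path_comp t z = z" using closed by (auto simp: t_def z)
      have "split_sum G (\<lambda>x u. w (path_comp u x)) (path_comp y (path_comp (arc_path G b) t)) =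
          split_sum G (\<lambda>x1 x2. w (path_comp (path_comp x2 (path_comp (arc_path G b) t)) x1)) y +
          split_sum G (\<lambda>y1 y2. w (path_comp y2 (path_comp y (path_comp (arc_path G b) y1)))) t"
        using b y t by (intro split_sum_comp_arc) (auto simp: t_def)
      also have "split_sum G (\<lambda>y1 y2. w (path_comp y2 (path_comp y (path_comp (arc_path G b) y1)))) t = w z"
      proof -
        have "splits G t = {(t, t)}"
          using b by (auto simp: splits_iff t_def awalk_Nil_iff)
        then show ?thesis using t(2) tz by (simp add: split_sum_def z)
      qed
      also have "split_sum G (\<lambda>x1 x2. w (path_comp (path_comp x2 (path_comp (arc_path G b) t)) x1)) y =
          cyclic_derivative G b w y"
        using closed y by (simp add: cyclic_derivative_eq_split_sum t z path_comp_assoc)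
      finally show ?thesis using closed t by (simp add: z)
    next
      case False
      then show ?thesis by (auto simp: cyclic_derivative_eq_split_sum z)
    qed
    finally show ?thesis using True by simp
  next
    case False
    have "series_mult G (cyclic_derivative G a w) (single_path (arc_path G a)) z = 0" if "a \<in> arcs G" for a
      using False that by (intro series_mult_single_right_eq_0) auto
    then show ?thesis using False by auto
  qed
  show "(\<Sum>a\<in>arcs G. series_mult G (single_path (arc_path G a)) (cyclic_derivative G a w)) z =
      (\<Sum>a\<in>arcs G. series_mult G (cyclic_derivative G a w) (single_path (arc_path G a))) z"
    by (simp only: sum_fun_apply L R)
qed

end


section \<open>The completed path algebra of the quiver inside that of the Ginzburg quiver\<close>

lemma ginzburg_quiver_simps [simp]:
  "verts (ginzburg_quiver Q) = verts Q"
  "arcs (ginzburg_quiver Q) = Arr ` arcs Q \<union> Dual ` arcs Q \<union> Loop ` verts Q"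
  "tail (ginzburg_quiver Q) (Arr a) = tail Q a" "head (ginzburg_quiver Q) (Arr a) = head Q a"
  "tail (ginzburg_quiver Q) (Dual a) = head Q a" "head (ginzburg_quiver Q) (Dual a) = tail Q a"
  "tail (ginzburg_quiver Q) (Loop i) = i" "head (ginzburg_quiver Q) (Loop i) = i"
  by (simp_all add: ginzburg_quiver_def)

lemma (in fin_digraph) fin_digraph_ginzburg_quiver: "fin_digraph (ginzburg_quiver G)"
  by unfold_locales auto

definition embed_path :: "('v, 'a) path \<Rightarrow> ('v, ('v, 'a) ginzburg_arrow) path"
  where "embed_path z = (psrc z, map Arr (parcs z), ptgt z)"

lemma embed_path_simps [simp]:
  "psrc (embed_path z) = psrc z" "ptgt (embed_path z) = ptgt z"
  "parcs (embed_path z) = map Arr (parcs z)"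
  by (simp_all add: embed_path_def)

lemma embed_path_comp: "embed_path (path_comp x y) = path_comp (embed_path x) (embed_path y)"
  by (rule path_eqI) auto

lemma inj_Arr: "inj Arr"
  by (auto simp: inj_def)

lemma map_arr_of_Arr [simp]: "map (arr_of \<circ> Arr) p = p"
  by (induction p) auto

lemma list_all_map_Arr [simp]: "list_all is_Arr (map Arr p)"
  by (induction p) auto

lemma embed_path_inject [simp]: "embed_path x = embed_path y \<longleftrightarrow> x = y"
proof
  assume e: "embed_path x = embed_path y"
  show "x = y"
    using arg_cong[OF e, of psrc] arg_cong[OF e, of ptgt] arg_cong[OF e, of parcs]
    by (intro path_eqI) (auto simp: inj_map_eq_map[OF inj_Arr])
qed simp

lemma list_all_is_Arr: "list_all is_Arr p \<Longrightarrow> map (Arr \<circ> arr_of) p = p"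
  by (induction p) auto

lemma embed_path_cases: "(\<exists>z'. z = embed_path z') \<longleftrightarrow> list_all is_Arr (parcs z)"
proof
  assume "list_all is_Arr (parcs z)"
  then have "z = embed_path (psrc z, map arr_of (parcs z), ptgt z)"
    by (intro path_eqI) (auto simp: list_all_is_Arr)
  then show "\<exists>z'. z = embed_path z'" ..
qed (auto simp: list_all_iff)

lemma embed_series_embed_path [simp]: "embed_series f (embed_path z) = f z"
  by (cases z) (simp add: embed_series_def embed_path_def)

lemma embed_series_eq_0: "\<not> (\<exists>z'. z = embed_path z') \<Longrightarrow> embed_series f z = 0"
  unfolding embed_path_cases by (cases z) (simp add: embed_series_def)

lemma embed_series_nonzero:
  assumes "embed_series f z \<noteq> 0"
  obtains z' where "z = embed_path z'" "f z' \<noteq> 0"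
proof -
  from assms obtain z' where "z = embed_path z'" using embed_series_eq_0 by blast
  then show ?thesis using that assms by simp
qed

lemma path_degree_embed [simp]:
  "path_degree coh_degree (embed_path z) = 0"
  "path_degree (int_degree d) (embed_path z) = path_degree d z"
  by (simp_all add: path_degree_def o_def)

context fin_digraph
begin

lemma embed_path_in_paths [simp]: "embed_path z \<in> paths (ginzburg_quiver G) \<longleftrightarrow> z \<in> paths G"
proof -
  interpret Gi: fin_digraph "ginzburg_quiver G" by (rule fin_digraph_ginzburg_quiver)
  have "Gi.awalk u (map Arr p) v \<longleftrightarrow> awalk u p v" for u p v
    by (induction p arbitrary: u) (auto simp: awalk_Nil_iff awalk_Cons_iff Gi.awalk_Nil_iff Gi.awalk_Cons_iff)
  then show ?thesis by (simp add: Gi.path_iff_awalk path_iff_awalk)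
qed

lemma embed_arc_path: "embed_path (arc_path G a) = arc_path (ginzburg_quiver G) (Arr a)"
  by (rule path_eqI) simp_all

lemma embed_single_path: "embed_series (single_path z) = single_path (embed_path z)"
proof
  fix w show "embed_series (single_path z) w = single_path (embed_path z) w"
    by (cases "\<exists>z'. w = embed_path z'") (auto simp: single_path_def embed_series_eq_0)
qed

text \<open>Every factor of a path in original arrows again consists of original arrows, so the cuts
  of a path and of its image correspond bijectively.\<close>

lemma embed_series_mult:
  "embed_series (series_mult G f g) = series_mult (ginzburg_quiver G) (embed_series f) (embed_series g)"
proof
  fix z
  interpret Gi: fin_digraph "ginzburg_quiver G" by (rule fin_digraph_ginzburg_quiver)
  show "embed_series (series_mult G f g) z =
    series_mult (ginzburg_quiver G) (embed_series f) (embed_series g) z"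
  proof (cases "\<exists>z'. z = embed_path z'")
    case True
    then obtain z' where z: "z = embed_path z'" by blast
    have "bij_betw (map_prod embed_path embed_path) (splits G z') (splits (ginzburg_quiver G) z)"
    proof (rule bij_betw_imageI)
      show "inj_on (map_prod embed_path embed_path) (splits G z')"
        by (auto simp: inj_on_def)
      show "map_prod embed_path embed_path ` splits G z' = splits (ginzburg_quiver G) z"
      proof (intro equalityI subsetI)
        fix p assume "p \<in> map_prod embed_path embed_path ` splits G z'"
        then obtain x y where "p = (embed_path x, embed_path y)" "(x, y) \<in> splits G z'" by auto
        then show "p \<in> splits (ginzburg_quiver G) z"
          by (simp add: splits_iff Gi.splits_iff z embed_path_comp[symmetric])
      next
        fix p assume "p \<in> splits (ginzburg_quiver G) z"
        then obtain x y where p: "p = (x, y)" "x \<in> paths (ginzburg_quiver G)" "y \<in> paths (ginzburg_quiver G)"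
          "psrc x = ptgt y" "path_comp x y = z" by (auto simp: splits_def)
        have "list_all is_Arr (parcs z)" using z embed_path_cases by blast
        then have "list_all is_Arr (parcs x)" "list_all is_Arr (parcs y)"
          using p(5) by auto
        then obtain x' y' where xy: "x = embed_path x'" "y = embed_path y'"
          using embed_path_cases by blast
        then have "(x', y') \<in> splits G z'"
          using p z by (simp add: splits_iff embed_path_comp[symmetric])
        then show "p \<in> map_prod embed_path embed_path ` splits G z'"
          using p xy by force
      qed
    qed
    then have "series_mult (ginzburg_quiver G) (embed_series f) (embed_series g) z =
        (\<Sum>p\<in>splits G z'. f (fst p) * g (snd p))"
      unfolding Gi.series_mult_apply case_prod_unfold
      by (subst sum.reindex_bij_betw[symmetric]) auto
    then show ?thesis by (simp add: z series_mult_apply case_prod_unfold)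
  next
    case False
    have "series_mult (ginzburg_quiver G) (embed_series f) (embed_series g) z = 0"
    proof (rule ccontr)
      assume "series_mult (ginzburg_quiver G) (embed_series f) (embed_series g) z \<noteq> 0"
      then obtain x y where "z = path_comp x y" "embed_series f x \<noteq> 0" "embed_series g y \<noteq> 0"
        by (rule Gi.series_mult_nonzero)
      then show False using False by (metis embed_path_comp embed_series_nonzero)
    qed
    then show ?thesis using False by (simp add: embed_series_eq_0)
  qed
qed

lemma embed_series_sum: "embed_series (\<Sum>a\<in>A. f a) = (\<Sum>a\<in>A. embed_series (f a))"
proof
  fix z show "embed_series (\<Sum>a\<in>A. f a) z = (\<Sum>a\<in>A. embed_series (f a)) z"
    by (cases "\<exists>z'. z = embed_path z'") (auto simp: sum_fun_apply embed_series_eq_0)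
qed

end

section \<open>The Ginzburg differential squares to zero\<close>

context graded_quiver_potential
begin

abbreviation "GQ \<equiv> ginzburg_quiver Q"

sublocale G: fin_digraph "ginzburg_quiver Q"
  by (rule fin_digraph_ginzburg_quiver)

text \<open>Two representatives of the potential are read through the same derivative: the
  homogeneous one yields degree and end points, the one in the square of the arrow ideal excludes
  trivial paths.\<close>

lemma potential_derivative_nonzero:
  assumes a: "a \<in> arcs Q" and z: "potential_derivative Q W a z \<noteq> 0"
  shows "z \<in> paths Q" "psrc z = head Q a" "ptgt z = tail Q a" "path_degree d z = 1 - d a" "parcs z \<noteq> []"
proof -
  obtain w where W: "W = potential_class Q w" and w: "\<And>z. w z \<noteq> 0 \<Longrightarrow> path_degree d z = 1"
    using homogeneous by blast
  from z have "cyclic_derivative Q a w z \<noteq> 0" by (simp add: potential_derivative_eq[OF a W])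
  then obtain v u where *: "v \<in> paths Q" "u \<in> paths Q" "psrc v = ptgt u" "z = path_comp v u"
    "ptgt v = tail Q a" "psrc u = head Q a" "w (path_comp u (path_comp (arc_path Q a) v)) \<noteq> 0"
    by (rule cyclic_derivative_nonzero)
  from w[OF *(7)] show "z \<in> paths Q" "psrc z = head Q a" "ptgt z = tail Q a" "path_degree d z = 1 - d a"
    using * by auto
  obtain w' where w': "w' \<in> arrow_ideal_power Q 2" and W': "W = potential_class Q w'"
    using potential by blast
  from z have "cyclic_derivative Q a w' z \<noteq> 0" by (simp add: potential_derivative_eq[OF a W'])
  then obtain v u where *: "z = path_comp v u" "w' (path_comp u (path_comp (arc_path Q a) v)) \<noteq> 0"
    by (rule cyclic_derivative_nonzero)
  from arrow_ideal_powerD[OF w' *(2)] show "parcs z \<noteq> []" using *(1) by auto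
qed

lemma generator_diff_Dual:
  assumes a: "a \<in> arcs Q"
  shows "generator_diff Q W (Dual a) \<in> bidegree_part GQ coh_degree (int_degree d) 0 (1 - d a)"
    "generator_diff Q W (Dual a) \<in> arrow_ideal_power GQ 1"
    "generator_diff Q W (Dual a) z \<noteq> 0 \<Longrightarrow> psrc z = head Q a \<and> ptgt z = tail Q a"
proof -
  have *: "\<exists>z'\<in>paths Q. z = embed_path z' \<and> psrc z = head Q a \<and> ptgt z = tail Q a \<and>
      path_degree d z' = 1 - d a \<and> parcs z \<noteq> []" if "generator_diff Q W (Dual a) z \<noteq> 0" for z
    using that potential_derivative_nonzero[OF a] by (auto elim!: embed_series_nonzero)
  show part: "generator_diff Q W (Dual a) \<in> bidegree_part GQ coh_degree (int_degree d) 0 (1 - d a)"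
  proof (rule bidegree_partI)
    fix z assume "generator_diff Q W (Dual a) z \<noteq> 0"
    from *[OF this] show "z \<in> paths GQ \<and> path_degree coh_degree z = 0 \<and>
        path_degree (int_degree d) z = 1 - d a" by auto
  qed
  show "generator_diff Q W (Dual a) \<in> arrow_ideal_power GQ 1"
  proof (rule arrow_ideal_powerI[OF bidegree_part_series[OF part]])
    fix z assume "generator_diff Q W (Dual a) z \<noteq> 0"
    from *[OF this] show "1 \<le> length (parcs z)" by (cases "parcs z") auto
  qed
  show "psrc z = head Q a \<and> ptgt z = tail Q a" if "generator_diff Q W (Dual a) z \<noteq> 0"
    using *[OF that] by blast
qed

text \<open>The differential of each loop is the corner of this one element at its vertex, so
  closedness is verified once for all vertices.\<close>

definition comm_sum :: "('v, ('v, 'a) ginzburg_arrow) series"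
  where "comm_sum = (\<Sum>a\<in>arcs Q.
    series_mult GQ (single_path (arc_path GQ (Arr a))) (single_path (arc_path GQ (Dual a))) -
    series_mult GQ (single_path (arc_path GQ (Dual a))) (single_path (arc_path GQ (Arr a))))"

lemma generator_diff_Loop:
  "generator_diff Q W (Loop i) = series_mult GQ (idempotent i) (series_mult GQ comm_sum (idempotent i))"
  by (simp add: comm_sum_def Let_def)

lemma single_arc_part: "g \<in> arcs GQ \<Longrightarrow>
  single_path (arc_path GQ g) \<in> bidegree_part GQ coh_degree (int_degree d) (coh_degree g) (int_degree d g)"
  using G.single_path_part[of "arc_path GQ g" coh_degree "int_degree d"] G.arc_path_in_paths[of g]
  by (simp only: path_degree_arc)

lemma comm_sum_part: "comm_sum \<in> bidegree_part GQ coh_degree (int_degree d) (- 1) 1"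
  unfolding comm_sum_def
proof (intro fscale.subspace_sum fscale.subspace_diff bidegree_part_subspace)
  fix a assume "a \<in> arcs Q"
  then have *: "single_path (arc_path GQ (Arr a)) \<in> bidegree_part GQ coh_degree (int_degree d) 0 (d a)"
    "single_path (arc_path GQ (Dual a)) \<in> bidegree_part GQ coh_degree (int_degree d) (- 1) (1 - d a)"
    using single_arc_part[of "Arr a"] single_arc_part[of "Dual a"] by auto
  show "series_mult GQ (single_path (arc_path GQ (Arr a))) (single_path (arc_path GQ (Dual a)))
      \<in> bidegree_part GQ coh_degree (int_degree d) (- 1) 1"
    using G.series_mult_bidegree_part[OF *] by simp
  show "series_mult GQ (single_path (arc_path GQ (Dual a))) (single_path (arc_path GQ (Arr a)))
      \<in> bidegree_part GQ coh_degree (int_degree d) (- 1) 1"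
    using G.series_mult_bidegree_part[OF *(2,1)] by simp
qed

lemma single_arc_ideal: "g \<in> arcs GQ \<Longrightarrow> single_path (arc_path GQ g) \<in> arrow_ideal_power GQ 1"
proof (rule arrow_ideal_powerI)
  assume "g \<in> arcs GQ"
  then show "single_path (arc_path GQ g) \<in> path_series GQ"
    by (intro single_path_in_path_series G.arc_path_in_paths)
qed (auto simp: single_path_def split: if_splits)

lemma comm_sum_ideal: "comm_sum \<in> arrow_ideal_power GQ 1"
  unfolding comm_sum_def
  by (intro fscale.subspace_sum fscale.subspace_diff arrow_ideal_power_subspace
      G.series_mult_arrow_ideal(1) single_arc_ideal) auto

sublocale ginzburg: path_derivation "ginzburg_quiver Q" coh_degree "int_degree d" "generator_diff Q W"
proof
  fix g assume g: "g \<in> arcs GQ"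
  then consider a where "g = Arr a" "a \<in> arcs Q" | a where "g = Dual a" "a \<in> arcs Q"
    | i where "g = Loop i" "i \<in> verts Q" by auto
  note g_cases = this
  show "coh_degree g \<le> 0" by (cases g) auto
  show "generator_diff Q W g \<in> bidegree_part GQ coh_degree (int_degree d) (coh_degree g + 1) (int_degree d g)"
    using g_cases
  proof cases
    case 1 then show ?thesis using fscale.subspace_0[OF bidegree_part_subspace] by simp
  next
    case 2 then show ?thesis using generator_diff_Dual(1) by simp
  next
    case 3
    have "series_mult GQ comm_sum (idempotent i) \<in> bidegree_part GQ coh_degree (int_degree d) (- 1) 1"
      using G.series_mult_bidegree_part[OF comm_sum_part G.idempotent_part[of i]] 3 by simp
    from G.series_mult_bidegree_part[OF G.idempotent_part[of i] this] 3 show ?thesis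
      unfolding 3(1) generator_diff_Loop by simp
  qed
  show "generator_diff Q W g \<in> arrow_ideal_power GQ 1"
    using g_cases
  proof cases
    case 1 then show ?thesis using fscale.subspace_0[OF arrow_ideal_power_subspace] by simp
  next
    case 2 then show ?thesis using generator_diff_Dual(2) by simp
  next
    case 3
    show ?thesis unfolding 3(1) generator_diff_Loop
      by (intro G.series_mult_arrow_ideal comm_sum_ideal)
  qed
  fix z assume z: "generator_diff Q W g z \<noteq> 0"
  show "psrc z = tail GQ g \<and> ptgt z = head GQ g"
    using g_cases
  proof cases
    case 1 then show ?thesis using z by simp
  next
    case 2 then show ?thesis using generator_diff_Dual(3)[of a z] z by simp
  next
    case 3
    from z obtain x y where "z = path_comp x y" "idempotent i x \<noteq> (0 :: complex)"
      and y: "series_mult GQ comm_sum (idempotent i) y \<noteq> 0"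
      unfolding 3(1) generator_diff_Loop by (rule G.series_mult_nonzero)
    moreover from y have "psrc y = i"
      using 3(2) by (simp add: G.idempotent_mult_right arrow_ideal_power_series[OF comm_sum_ideal] split: if_splits)
    ultimately show ?thesis
      by (auto simp: 3(1) idempotent_def single_path_def split: if_splits)
  qed
qed

text \<open>Each arrow that could be replaced in an embedded path is an original one, and those have
  differential zero.\<close>

lemma diff_embed_series: "ginzburg.diff (embed_series f) = 0"
proof (rule ccontr)
  assume "ginzburg.diff (embed_series f) \<noteq> 0"
  then obtain z where "ginzburg.diff (embed_series f) z \<noteq> 0" by (auto simp: fun_eq_iff)
  then obtain x g m y where "embed_series f (path_comp x (path_comp (arc_path GQ g) y)) \<noteq> 0"
    "generator_diff Q W g m \<noteq> 0"
    by (rule G.path_diff_nonzero)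
  moreover from this(1) obtain z' where "path_comp x (path_comp (arc_path GQ g) y) = embed_path z'"
    by (rule embed_series_nonzero)
  then have "list_all is_Arr (parcs (path_comp x (path_comp (arc_path GQ g) y)))"
    using embed_path_cases by blast
  then have "is_Arr g" by simp
  ultimately show False by (cases g) auto
qed

text \<open>Original arrows are closed of degree 0, so the differential of the commutator of
  \<open>a\<close> with its dual is the commutator of \<open>a\<close> with the cyclic derivative
  along \<open>a\<close>; the sum of these vanishes by
  \<open>sum_commutator_cyclic_derivative\<close>.\<close>

lemma diff_comm_sum: "ginzburg.diff comm_sum = 0"
proof -
  obtain w where W: "W = potential_class Q w" using potential by blast
  have "ginzburg.diff comm_sum = (\<Sum>a\<in>arcs Q.
      series_mult GQ (single_path (arc_path GQ (Arr a))) (embed_series (cyclic_derivative Q a w)) -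
      series_mult GQ (embed_series (cyclic_derivative Q a w)) (single_path (arc_path GQ (Arr a))))"
    unfolding comm_sum_def G.path_diff_sum G.path_diff_simps
  proof (rule sum.cong[OF refl])
    fix a assume a: "a \<in> arcs Q"
    then have g: "Arr a \<in> arcs GQ" "Dual a \<in> arcs GQ" by auto
    show "ginzburg.diff (series_mult GQ (single_path (arc_path GQ (Arr a))) (single_path (arc_path GQ (Dual a)))) -
        ginzburg.diff (series_mult GQ (single_path (arc_path GQ (Dual a))) (single_path (arc_path GQ (Arr a)))) =
        series_mult GQ (single_path (arc_path GQ (Arr a))) (embed_series (cyclic_derivative Q a w)) -
        series_mult GQ (embed_series (cyclic_derivative Q a w)) (single_path (arc_path GQ (Arr a)))"
      unfolding ginzburg.leibniz[OF single_arc_part[OF g(1)]] ginzburg.leibniz[OF single_arc_part[OF g(2)]]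
        ginzburg.diff_single_arc[OF g(1)] ginzburg.diff_single_arc[OF g(2)]
      by (simp add: potential_derivative_eq[OF a W] fun_eq_iff)
  qed
  also have "\<dots> = embed_series (\<Sum>a\<in>arcs Q. series_mult Q (single_path (arc_path Q a)) (cyclic_derivative Q a w)) -
      embed_series (\<Sum>a\<in>arcs Q. series_mult Q (cyclic_derivative Q a w) (single_path (arc_path Q a)))"
    by (simp only: sum_subtractf embed_series_sum embed_series_mult embed_single_path embed_arc_path)
  also have "\<dots> = 0" by (simp only: sum_commutator_cyclic_derivative diff_self)
  finally show ?thesis .
qed

sublocale ginzburg: path_dga "ginzburg_quiver Q" coh_degree "int_degree d" "generator_diff Q W"
proof
  fix g assume "g \<in> arcs GQ"
  then consider a where "g = Arr a" | a where "g = Dual a"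
    | i where "g = Loop i" "i \<in> verts Q" by auto
  then show "ginzburg.diff (generator_diff Q W g) = 0"
  proof cases
    case 1 then show ?thesis by (simp only: generator_diff.simps G.path_diff_simps)
  next
    case 2 then show ?thesis by (simp only: generator_diff.simps diff_embed_series)
  next
    case 3
    then have i: "idempotent i \<in> bidegree_part GQ coh_degree (int_degree d) 0 0"
      by (simp add: G.idempotent_part)
    show ?thesis
      unfolding 3(1) generator_diff_Loop ginzburg.leibniz[OF i] ginzburg.leibniz[OF comm_sum_part]
        diff_comm_sum G.path_diff_idempotent G.series_mult_linear
      by (simp add: fun_eq_iff)
  qed
qed

end


section \<open>Graded homomorphisms and homotopies\<close>

lemma linear_map_onD:
  assumes "linear_map_on V W f"
  shows "x \<in> V \<Longrightarrow> f x \<in> W"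
    and "x \<in> V \<Longrightarrow> y \<in> V \<Longrightarrow> f (x + y) = f x + f y"
    and "x \<in> V \<Longrightarrow> f (fscale c x) = fscale c (f x)"
  using assms unfolding linear_map_on_def by auto

lemma linear_map_onI:
  assumes "\<And>x. x \<in> V \<Longrightarrow> f x \<in> W"
    and "\<And>x y. x \<in> V \<Longrightarrow> y \<in> V \<Longrightarrow> f (x + y) = f x + f y"
    and "\<And>x c. x \<in> V \<Longrightarrow> f (fscale c x) = fscale c (f x)"
  shows "linear_map_on V W f"
  using assms unfolding linear_map_on_def by auto

lemma fscale_simps [simp]:
  "fscale 1 f = f" "fscale (- 1) f = - f" "fscale 0 f = 0" "fscale c 0 = 0"
  "fscale c (- f) = - fscale c f" "fscale (- c) f = - fscale c f"
  "fscale a (fscale b f) = fscale (a * b) f"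
  by (auto simp: fun_eq_iff)

lemma fscale_add: "fscale c (f + g) = fscale c f + fscale c g"
  and fscale_diff: "fscale c (f - g) = fscale c f - fscale c g"
  by (auto simp: fun_eq_iff algebra_simps)

lemma linear_map_on_0:
  assumes "linear_map_on V W f" "fscale.subspace V"
  shows "f 0 = 0"
  using linear_map_onD(3)[OF assms(1) fscale.subspace_0[OF assms(2)], of 0] by simp

lemma linear_map_on_diff:
  assumes "linear_map_on V W f" "fscale.subspace V" "x \<in> V" "y \<in> V"
  shows "f (x - y) = f x - f y"
proof -
  have "x - y = x + fscale (- 1) y" by simp
  then show ?thesis
    using assms linear_map_onD(2)[OF assms(1), of x "fscale (- 1) y"] linear_map_onD(3)[OF assms(1), of y "- 1"]
      fscale.subspace_scale[OF assms(2), of y "- 1"]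
    by (metis fscale_simps(2) diff_conv_add_uminus)
qed

lemma linear_map_on_sum:
  assumes "linear_map_on V W f" "fscale.subspace V" "\<And>a. a \<in> A \<Longrightarrow> x a \<in> V"
  shows "f (\<Sum>a\<in>A. x a) = (\<Sum>a\<in>A. f (x a))"
  using assms(3)
proof (induction A rule: infinite_finite_induct)
  case (insert a A)
  have "f (x a + sum x A) = f (x a) + f (sum x A)"
    using insert.prems by (intro linear_map_onD(2)[OF assms(1)] fscale.subspace_sum[OF assms(2)]) auto
  moreover have "f (sum x A) = (\<Sum>a\<in>A. f (x a))"
    using insert.prems by (intro insert.IH) auto
  ultimately show ?case
    using insert.hyps by (simp only: sum.insert not_False_eq_True)
next
  case (infinite A)
  then show ?case by (simp only: sum.infinite linear_map_on_0[OF assms(1,2)] not_False_eq_True)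
next
  case empty
  then show ?case by (simp only: sum.empty linear_map_on_0[OF assms(1,2)])
qed

lemma linear_map_on_comp:
  assumes "linear_map_on V W f" "linear_map_on W Z g"
  shows "linear_map_on V Z (\<lambda>x. g (f x))"
  using assms unfolding linear_map_on_def by simp

lemma linear_map_on_add:
  assumes "linear_map_on V W f" "linear_map_on V W g" "fscale.subspace W"
  shows "linear_map_on V W (\<lambda>x. f x + g x)"
  using assms fscale.subspace_add[OF assms(3)] unfolding linear_map_on_def
  by (auto simp: fscale_add)

lemma linear_map_on_scale:
  assumes "linear_map_on V W f" "fscale.subspace W"
  shows "linear_map_on V W (\<lambda>x. fscale c (f x))"
  using assms fscale.subspace_scale[OF assms(2)] unfolding linear_map_on_def
  by (auto simp: fscale_add mult.commute)

lemma linear_map_on_zero: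
  assumes "fscale.subspace W"
  shows "linear_map_on V W (\<lambda>x. 0)"
  using fscale.subspace_0[OF assms] unfolding linear_map_on_def by simp

lemma linear_map_on_sum_fun:
  assumes "\<And>a. a \<in> A \<Longrightarrow> linear_map_on V W (f a)" "fscale.subspace W"
  shows "linear_map_on V W (\<lambda>x. \<Sum>a\<in>A. f a x)"
  using assms(1)
proof (induction A rule: infinite_finite_induct)
  case (insert a A)
  have "linear_map_on V W (\<lambda>x. f a x + (\<Sum>a\<in>A. f a x))"
    using insert.prems insert.IH by (intro linear_map_on_add assms(2)) auto
  then show ?case using insert.hyps by (simp only: sum.insert not_False_eq_True)
next
  case (infinite A)
  then show ?case using linear_map_on_zero[OF assms(2)] by (simp only: sum.infinite not_False_eq_True)
next
  case empty
  then show ?case using linear_map_on_zero[OF assms(2)] by (simp only: sum.empty)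
qed

context continuous_dg_module
begin

lemma act_mem: "m \<in> mcomp M p q \<Longrightarrow> x \<in> acomp A a b \<Longrightarrow> p' = p + a \<Longrightarrow> q' = q + b \<Longrightarrow>
  mact M p q m x \<in> mcomp M p' q'"
  using linear_map_onD(1)[OF act_linear_left] by blast

lemma act_linear_left': "x \<in> acomp A a b \<Longrightarrow> p' = p + a \<Longrightarrow> q' = q + b \<Longrightarrow>
  linear_map_on (mcomp M p q) (mcomp M p' q') (\<lambda>m. mact M p q m x)"
  using act_linear_left by blast

lemma act_linear_right': "m \<in> mcomp M p q \<Longrightarrow> p' = p + a \<Longrightarrow> q' = q + b \<Longrightarrow>
  linear_map_on (acomp A a b) (mcomp M p' q') (mact M p q m)"
  using act_linear_right by blast

lemma act_mult': "m \<in> mcomp M p q \<Longrightarrow> x \<in> acomp A a b \<Longrightarrow> y \<in> acomp A a' b' \<Longrightarrow>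
  p' = p + a \<Longrightarrow> q' = q + b \<Longrightarrow>
  mact M p q m (amult A x y) = mact M p' q' (mact M p q m x) y"
  using act_mult by blast

lemma leibniz': "m \<in> mcomp M p q \<Longrightarrow> x \<in> acomp A a b \<Longrightarrow> p' = p + a \<Longrightarrow> q' = q + b \<Longrightarrow> p'' = p + 1 \<Longrightarrow>
  mdiff M p' q' (mact M p q m x) =
    mact M p'' q (mdiff M p q m) x + fscale (parity_sign p) (mact M p q m (adiff A x))"
  using leibniz by blast

lemma diff_mem: "m \<in> mcomp M p q \<Longrightarrow> p' = p + 1 \<Longrightarrow> mdiff M p q m \<in> mcomp M p' q"
  using linear_map_onD(1)[OF diff_linear] by blast

lemma diff_linear': "p' = p + 1 \<Longrightarrow> linear_map_on (mcomp M p q) (mcomp M p' q) (mdiff M p q)"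
  using diff_linear by blast

lemma diff_diff': "m \<in> mcomp M p q \<Longrightarrow> p' = p + 1 \<Longrightarrow> mdiff M p' q (mdiff M p q m) = 0"
  using diff_diff by blast

end

lemma graded_homD:
  assumes "graded_hom A k M N f"
  shows "p' = p + k \<Longrightarrow> linear_map_on (mcomp M p q) (mcomp N p' q) (f p q)"
    and "m \<in> mcomp M p q \<Longrightarrow> x \<in> acomp A a b \<Longrightarrow> p'' = p + a \<Longrightarrow> q'' = q + b \<Longrightarrow> p' = p + k \<Longrightarrow>
      f p'' q'' (mact M p q m x) = mact N p' q (f p q m) x"
    and "V \<in> mbase N \<Longrightarrow> \<exists>U \<in> mbase M. \<forall>m \<in> U p q. f p q m \<in> V (p + k) q"
    and "m \<in> mcomp M p q \<Longrightarrow> p' = p + k \<Longrightarrow> f p q m \<in> mcomp N p' q"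
  using assms unfolding graded_hom_def linear_map_on_def by auto

lemma graded_hom_zero:
  assumes "continuous_dg_module A M" "continuous_dg_module A N"
  shows "graded_hom A k M N (\<lambda>p q m. 0)"
proof -
  interpret M: continuous_dg_module A M by fact
  interpret N: continuous_dg_module A N by fact
  have "mact N p q 0 x = 0" if "x \<in> acomp A a b" for p q x a b
    using linear_map_on_0[OF N.act_linear_left[OF that] N.comp_subspace] .
  moreover have "\<exists>U\<in>mbase M. \<forall>m\<in>U p q. 0 \<in> V (p + k) q" if "V \<in> mbase N" for V p q
    using M.base_nonempty fscale.subspace_0 N.base_subspace[OF that] by blast
  ultimately show ?thesis
    unfolding graded_hom_def by (auto intro!: linear_map_on_zero N.comp_subspace)
qed

lemma graded_hom_add:
  assumes "continuous_dg_module A M" "continuous_dg_module A N"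
    and f: "graded_hom A k M N f" and g: "graded_hom A k M N g"
  shows "graded_hom A k M N (\<lambda>p q m. f p q m + g p q m)"
  unfolding graded_hom_def
proof (intro conjI allI ballI)
  interpret M: continuous_dg_module A M by fact
  interpret N: continuous_dg_module A N by fact
  show "linear_map_on (mcomp M p q) (mcomp N (p + k) q) (\<lambda>m. f p q m + g p q m)" for p q
    by (intro linear_map_on_add N.comp_subspace graded_homD(1)[OF f] graded_homD(1)[OF g] refl)
  fix p q
  show "f (p + a) (q + b) (mact M p q m x) + g (p + a) (q + b) (mact M p q m x) =
      mact N (p + k) q (f p q m + g p q m) x" if "m \<in> mcomp M p q" "x \<in> acomp A a b" for a b m x
    using graded_homD(2)[OF f that refl refl refl] graded_homD(2)[OF g that refl refl refl]
      linear_map_onD(2)[OF N.act_linear_left[OF that(2)] graded_homD(4)[OF f that(1) refl] graded_homD(4)[OF g that(1) refl]]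
    by simp
  fix V assume V: "V \<in> mbase N"
  from graded_homD(3)[OF f V] obtain U1 where U1: "U1 \<in> mbase M" "\<forall>m\<in>U1 p q. f p q m \<in> V (p + k) q" by blast
  from graded_homD(3)[OF g V] obtain U2 where U2: "U2 \<in> mbase M" "\<forall>m\<in>U2 p q. g p q m \<in> V (p + k) q" by blast
  from M.base_directed[OF U1(1) U2(1)] obtain T where T: "T \<in> mbase M" "\<forall>p q. T p q \<subseteq> U1 p q \<inter> U2 p q" by blast
  then show "\<exists>U\<in>mbase M. \<forall>m\<in>U p q. f p q m + g p q m \<in> V (p + k) q"
    using U1 U2 N.base_subspace[OF V] by (intro bexI[OF _ T(1)]) (blast intro: fscale.subspace_add)
qed

lemma graded_hom_scale:
  assumes "continuous_dg_module A N" and f: "graded_hom A k M N f"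
  shows "graded_hom A k M N (\<lambda>p q m. fscale c (f p q m))"
  unfolding graded_hom_def
proof (intro conjI allI ballI)
  interpret N: continuous_dg_module A N by fact
  show "linear_map_on (mcomp M p q) (mcomp N (p + k) q) (\<lambda>m. fscale c (f p q m))" for p q
    by (intro linear_map_on_scale N.comp_subspace graded_homD(1)[OF f] refl)
  fix p q
  show "fscale c (f (p + a) (q + b) (mact M p q m x)) = mact N (p + k) q (fscale c (f p q m)) x"
    if "m \<in> mcomp M p q" "x \<in> acomp A a b" for a b m x
    using graded_homD(2)[OF f that refl refl refl]
      linear_map_onD(3)[OF N.act_linear_left[OF that(2)] graded_homD(4)[OF f that(1) refl]] by simp
  fix V assume V: "V \<in> mbase N"
  from graded_homD(3)[OF f V] show "\<exists>U\<in>mbase M. \<forall>m\<in>U p q. fscale c (f p q m) \<in> V (p + k) q"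
    using N.base_subspace[OF V] by (blast intro: fscale.subspace_scale)
qed

lemma graded_hom_diff:
  assumes "continuous_dg_module A M" "continuous_dg_module A N"
    and "graded_hom A k M N f" and g: "graded_hom A k M N g"
  shows "graded_hom A k M N (\<lambda>p q m. f p q m - g p q m)"
  using graded_hom_add[OF assms(1-3) graded_hom_scale[OF assms(2) g, of "- 1"]] by simp

lemma graded_hom_compose:
  assumes f: "graded_hom A k M N f" and g: "graded_hom A l N L g"
  shows "graded_hom A (k + l) M L (\<lambda>p q m. g (p + k) q (f p q m))"
  unfolding graded_hom_def
proof (intro conjI allI ballI)
  show "linear_map_on (mcomp M p q) (mcomp L (p + (k + l)) q) (\<lambda>m. g (p + k) q (f p q m))" for p q
    by (rule linear_map_on_comp[OF graded_homD(1)[OF f refl] graded_homD(1)[OF g]]) simp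
  fix p q
  show "g (p + a + k) (q + b) (f (p + a) (q + b) (mact M p q m x)) =
      mact L (p + (k + l)) q (g (p + k) q (f p q m)) x"
    if "m \<in> mcomp M p q" "x \<in> acomp A a b" for a b m x
    using graded_homD(2)[OF f that refl refl refl]
      graded_homD(2)[OF g graded_homD(4)[OF f that(1) refl] that(2), of "p + a + k" "q + b" "p + (k + l)"] by simp
  fix V assume V: "V \<in> mbase L"
  from graded_homD(3)[OF g V] obtain U' where U': "U' \<in> mbase N" "\<forall>n\<in>U' (p + k) q. g (p + k) q n \<in> V (p + k + l) q"
    by blast
  from graded_homD(3)[OF f U'(1)] obtain U where "U \<in> mbase M" "\<forall>m\<in>U p q. f p q m \<in> U' (p + k) q" by blast
  then show "\<exists>U\<in>mbase M. \<forall>m\<in>U p q. g (p + k) q (f p q m) \<in> V (p + (k + l)) q"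
    using U'(2) by (auto simp: add.assoc)
qed

text \<open>The differential of the Hom complex in degree \<open>k\<close>. Its cocycles of degree 0
  are the dg maps, and its values on maps of degree -1 are the differences of homotopic
  maps.\<close>

definition hom_diff :: "int \<Rightarrow> ('u, 'x) dg_module \<Rightarrow> ('u, 'x) dg_module \<Rightarrow> 'u graded_map \<Rightarrow> 'u graded_map"
  where "hom_diff k M N f = (\<lambda>p q m. mdiff N (p + k) q (f p q m) -
    fscale (parity_sign k) (f (p + 1) q (mdiff M p q m)))"

text \<open>By the Leibniz rules both terms produce an action by \<open>adiff A x\<close>, one with
  the sign of \<open>p + k\<close>, the other with the product of the signs of \<open>k\<close> and
  \<open>p\<close>. These cancel, which is what makes the result linear over the algebra.\<close>

lemma graded_hom_hom_diff:
  assumes "continuous_dg_module A M" "continuous_dg_module A N"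
    and adiff_mem: "\<And>a b x. x \<in> acomp A a b \<Longrightarrow> adiff A x \<in> acomp A (a + 1) b"
    and f: "graded_hom A k M N f"
  shows "graded_hom A (k + 1) M N (hom_diff k M N f)"
  unfolding graded_hom_def hom_diff_def
proof (intro conjI allI ballI)
  interpret M: continuous_dg_module A M by fact
  interpret N: continuous_dg_module A N by fact
  have lin: "linear_map_on (mcomp M p q) (mcomp N (p + (k + 1)) q)
      (\<lambda>m. mdiff N (p + k) q (f p q m) + fscale (- parity_sign k) (f (p + 1) q (mdiff M p q m)))" for p q
    by (intro linear_map_on_add linear_map_on_scale N.comp_subspace
        linear_map_on_comp[OF graded_homD(1)[OF f refl] N.diff_linear']
        linear_map_on_comp[OF M.diff_linear' graded_homD(1)[OF f]]) simp_all
  then show "linear_map_on (mcomp M p q) (mcomp N (p + (k + 1)) q)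
      (\<lambda>m. mdiff N (p + k) q (f p q m) - fscale (parity_sign k) (f (p + 1) q (mdiff M p q m)))" for p q
    by simp
  fix p q
  show "mdiff N (p + a + k) (q + b) (f (p + a) (q + b) (mact M p q m x)) -
        fscale (parity_sign k) (f (p + a + 1) (q + b) (mdiff M (p + a) (q + b) (mact M p q m x))) =
      mact N (p + (k + 1)) q
        (mdiff N (p + k) q (f p q m) - fscale (parity_sign k) (f (p + 1) q (mdiff M p q m))) x"
    if m: "m \<in> mcomp M p q" and x: "x \<in> acomp A a b" for a b m x
  proof -
    note dx = adiff_mem[OF x]
    have fm: "f p q m \<in> mcomp N (p + k) q" by (rule graded_homD(4)[OF f m refl])
    have dm: "mdiff M p q m \<in> mcomp M (p + 1) q" by (rule M.diff_mem[OF m refl])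
    have fdm: "f (p + 1) q (mdiff M p q m) \<in> mcomp N (p + (k + 1)) q"
      by (rule graded_homD(4)[OF f dm]) simp
    have dfm: "mdiff N (p + k) q (f p q m) \<in> mcomp N (p + (k + 1)) q"
      by (rule N.diff_mem[OF fm]) simp
    have 1: "mdiff N (p + a + k) (q + b) (f (p + a) (q + b) (mact M p q m x)) =
        mact N (p + (k + 1)) q (mdiff N (p + k) q (f p q m)) x +
        fscale (parity_sign (p + k)) (mact N (p + k) q (f p q m) (adiff A x))"
      unfolding graded_homD(2)[OF f m x refl refl refl]
      by (rule N.leibniz'[OF fm x]) simp_all
    have "f (p + a + 1) (q + b) (mdiff M (p + a) (q + b) (mact M p q m x)) =
        f (p + a + 1) (q + b) (mact M (p + 1) q (mdiff M p q m) x) +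
        f (p + a + 1) (q + b) (fscale (parity_sign p) (mact M p q m (adiff A x)))"
      unfolding M.leibniz[OF m x]
      by (intro linear_map_onD(2)[OF graded_homD(1)[OF f refl]]
          fscale.subspace_scale[OF M.comp_subspace] M.act_mem[OF dm x] M.act_mem[OF m dx]) simp_all
    also have "f (p + a + 1) (q + b) (mact M (p + 1) q (mdiff M p q m) x) =
        mact N (p + (k + 1)) q (f (p + 1) q (mdiff M p q m)) x"
      by (rule graded_homD(2)[OF f dm x]) simp_all
    also have "f (p + a + 1) (q + b) (fscale (parity_sign p) (mact M p q m (adiff A x))) =
        fscale (parity_sign p) (f (p + a + 1) (q + b) (mact M p q m (adiff A x)))"
      by (intro linear_map_onD(3)[OF graded_homD(1)[OF f refl]] M.act_mem[OF m dx]) simp_all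
    also have "f (p + a + 1) (q + b) (mact M p q m (adiff A x)) = mact N (p + k) q (f p q m) (adiff A x)"
      by (rule graded_homD(2)[OF f m dx]) simp_all
    finally have 2: "f (p + a + 1) (q + b) (mdiff M (p + a) (q + b) (mact M p q m x)) =
        mact N (p + (k + 1)) q (f (p + 1) q (mdiff M p q m)) x +
        fscale (parity_sign p) (mact N (p + k) q (f p q m) (adiff A x))" .
    have 3: "mact N (p + (k + 1)) q
        (mdiff N (p + k) q (f p q m) - fscale (parity_sign k) (f (p + 1) q (mdiff M p q m))) x =
        mact N (p + (k + 1)) q (mdiff N (p + k) q (f p q m)) x -
        fscale (parity_sign k) (mact N (p + (k + 1)) q (f (p + 1) q (mdiff M p q m)) x)"
      using linear_map_on_diff[OF N.act_linear_left[OF x] N.comp_subspace dfm fscale.subspace_scale[OF N.comp_subspace fdm]]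
        linear_map_onD(3)[OF N.act_linear_left[OF x] fdm] by metis
    show ?thesis
      unfolding 1 2 3 by (simp add: fscale_add parity_sign_add mult.commute)
  qed
  fix V assume V: "V \<in> mbase N"
  from graded_homD(3)[OF f V] obtain U1 where U1: "U1 \<in> mbase M" "\<forall>m\<in>U1 p q. f p q m \<in> V (p + k) q" by blast
  from graded_homD(3)[OF f V] obtain U2 where U2: "U2 \<in> mbase M" "\<forall>m\<in>U2 (p + 1) q. f (p + 1) q m \<in> V (p + 1 + k) q" by blast
  from M.base_directed[OF U1(1) U2(1)] obtain T where T: "T \<in> mbase M" "\<forall>p q. T p q \<subseteq> U1 p q \<inter> U2 p q" by blast
  have "mdiff N (p + k) q (f p q m) - fscale (parity_sign k) (f (p + 1) q (mdiff M p q m)) \<in> V (p + (k + 1)) q"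
    if m: "m \<in> T p q" for m
  proof (intro fscale.subspace_diff fscale.subspace_scale)
    show "fscale.subspace (V (p + (k + 1)) q)" using N.base_subspace[OF V] by blast
    then show "fscale.subspace (V (p + (k + 1)) q)" .
    have "f p q m \<in> V (p + k) q" using m T U1 by blast
    from N.base_diff[OF V this] show "mdiff N (p + k) q (f p q m) \<in> V (p + (k + 1)) q" by (simp add: add.assoc)
    have "mdiff M p q m \<in> U2 (p + 1) q" using M.base_diff[OF T(1) m] T by blast
    then have "f (p + 1) q (mdiff M p q m) \<in> V (p + 1 + k) q" using U2 by blast
    then show "f (p + 1) q (mdiff M p q m) \<in> V (p + (k + 1)) q" by (simp add: algebra_simps)
  qed
  then show "\<exists>U\<in>mbase M. \<forall>m\<in>U p q. mdiff N (p + k) q (f p q m) -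
      fscale (parity_sign k) (f (p + 1) q (mdiff M p q m)) \<in> V (p + (k + 1)) q"
    using T(1) by blast
qed

lemma dg_hom_iff_hom_diff:
  "dg_hom A M N f \<longleftrightarrow> graded_hom A 0 M N f \<and> (\<forall>p q. \<forall>m \<in> mcomp M p q. hom_diff 0 M N f p q m = 0)"
proof -
  have "f (p + 1) q (mdiff M p q m) = mdiff N p q (f p q m) \<longleftrightarrow> hom_diff 0 M N f p q m = 0" for p q m
    unfolding hom_diff_def by (simp only: parity_sign_simps fscale_simps add_0_right right_minus_eq) metis
  then show ?thesis unfolding dg_hom_def by blast
qed

lemma homotopic_iff_hom_diff:
  "homotopic A M N f g \<longleftrightarrow> (\<exists>h. graded_hom A (- 1) M N h \<and>
    (\<forall>p q. \<forall>m \<in> mcomp M p q. f p q m - g p q m = hom_diff (- 1) M N h p q m))"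
  unfolding homotopic_def hom_diff_def by simp

lemma dg_hom_compose:
  assumes f: "dg_hom A M N f" and g: "dg_hom A N L g"
  shows "dg_hom A M L (graded_comp g f)"
proof -
  have "graded_hom A 0 M L (graded_comp g f)"
    using graded_hom_compose[of A 0 M N f 0 L g] f g unfolding dg_hom_def graded_comp_def by (simp add: o_def)
  moreover have "graded_hom A 0 M N f" using f unfolding dg_hom_def by blast
  note graded_homD(4)[OF this]
  ultimately show ?thesis
    using f g unfolding dg_hom_def by (auto simp: graded_comp_def)
qed

lemma dg_hom_add:
  assumes "continuous_dg_module A M" "continuous_dg_module A N"
    and f: "dg_hom A M N f" and g: "dg_hom A M N g"
  shows "dg_hom A M N (\<lambda>p q m. f p q m + g p q m)"
proof -
  interpret N: continuous_dg_module A N by fact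
  have *: "graded_hom A 0 M N f" "graded_hom A 0 M N g" using f g unfolding dg_hom_def by auto
  have "mdiff N p q (f p q m + g p q m) = mdiff N p q (f p q m) + mdiff N p q (g p q m)"
    if "m \<in> mcomp M p q" for p q m
    using graded_homD(4)[OF *(1) that, of p] graded_homD(4)[OF *(2) that, of p]
    by (intro linear_map_onD(2)[OF N.diff_linear]) auto
  then show ?thesis
    using f g graded_hom_add[OF assms(1,2) *] unfolding dg_hom_def by auto
qed

lemma dg_hom_scale:
  assumes "continuous_dg_module A N" and f: "dg_hom A M N f"
  shows "dg_hom A M N (\<lambda>p q m. fscale c (f p q m))"
proof -
  interpret N: continuous_dg_module A N by fact
  have *: "graded_hom A 0 M N f" using f unfolding dg_hom_def by auto
  have "mdiff N p q (fscale c (f p q m)) = fscale c (mdiff N p q (f p q m))"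
    if "m \<in> mcomp M p q" for p q m
    using graded_homD(4)[OF * that, of p] by (intro linear_map_onD(3)[OF N.diff_linear]) auto
  then show ?thesis
    using f graded_hom_scale[OF assms(1) *] unfolding dg_hom_def by auto
qed

lemma dg_hom_zero:
  assumes "continuous_dg_module A M" "continuous_dg_module A N"
  shows "dg_hom A M N (\<lambda>p q m. 0)"
proof -
  interpret N: continuous_dg_module A N by fact
  show ?thesis
    using graded_hom_zero[OF assms] linear_map_on_0[OF N.diff_linear N.comp_subspace]
    unfolding dg_hom_def by auto
qed

lemma dg_hom_id: "dg_hom A M M (\<lambda>p q. id)"
  unfolding dg_hom_def graded_hom_def linear_map_on_def by auto

text \<open>Graded maps are total functions whose values off the components carry no meaning; hence
  agreement on the components is what is asked, instead of equality.\<close>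

lemma homotopic_refl:
  assumes "continuous_dg_module A M" "continuous_dg_module A N"
    and "\<And>p q m. m \<in> mcomp M p q \<Longrightarrow> f p q m = g p q m"
  shows "homotopic A M N f g"
proof -
  interpret N: continuous_dg_module A N by fact
  have "mdiff N (p - 1) q 0 = 0" for p q
    by (rule linear_map_on_0[OF N.diff_linear N.comp_subspace])
  then show ?thesis
    unfolding homotopic_def using assms(3)
    by (intro exI[of _ "\<lambda>p q m. 0"]) (simp add: graded_hom_zero assms(1,2))
qed

lemma homotopic_trans:
  assumes "continuous_dg_module A M" "continuous_dg_module A N"
    and "homotopic A M N f g" "homotopic A M N g g'"
  shows "homotopic A M N f g'"
proof -
  interpret N: continuous_dg_module A N by fact
  from assms(3) obtain h where h: "graded_hom A (- 1) M N h" and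
    e: "\<And>p q m. m \<in> mcomp M p q \<Longrightarrow> f p q m - g p q m = mdiff N (p - 1) q (h p q m) + h (p + 1) q (mdiff M p q m)"
    unfolding homotopic_def by blast
  from assms(4) obtain h' where h': "graded_hom A (- 1) M N h'" and
    e': "\<And>p q m. m \<in> mcomp M p q \<Longrightarrow> g p q m - g' p q m = mdiff N (p - 1) q (h' p q m) + h' (p + 1) q (mdiff M p q m)"
    unfolding homotopic_def by blast
  have "f p q m - g' p q m = mdiff N (p - 1) q (h p q m + h' p q m) + (h (p + 1) q (mdiff M p q m) + h' (p + 1) q (mdiff M p q m))"
    if m: "m \<in> mcomp M p q" for p q m
  proof -
    have "f p q m - g' p q m = (f p q m - g p q m) + (g p q m - g' p q m)" by simp
    moreover have "mdiff N (p - 1) q (h p q m + h' p q m) = mdiff N (p - 1) q (h p q m) + mdiff N (p - 1) q (h' p q m)"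
      using graded_homD(4)[OF h m, of "p - 1"] graded_homD(4)[OF h' m, of "p - 1"]
      by (intro linear_map_onD(2)[OF N.diff_linear]) auto
    ultimately show ?thesis
      unfolding e[OF m] e'[OF m] by (simp only: add_ac)
  qed
  then show ?thesis
    unfolding homotopic_def using graded_hom_add[OF assms(1,2) h h'] by blast
qed

lemma homotopic_comp_left:
  assumes "homotopic A M N f g" and s: "dg_hom A N L s"
    and f: "graded_hom A 0 M N f" and g: "graded_hom A 0 M N g" and "continuous_dg_module A M" "continuous_dg_module A N"
  shows "homotopic A M L (graded_comp s f) (graded_comp s g)"
proof -
  interpret M: continuous_dg_module A M by fact
  interpret N: continuous_dg_module A N by fact
  have s0: "graded_hom A 0 N L s" using s unfolding dg_hom_def by blast
  from assms(1) obtain h where h: "graded_hom A (- 1) M N h" and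
    e: "\<And>p q m. m \<in> mcomp M p q \<Longrightarrow> f p q m - g p q m = mdiff N (p - 1) q (h p q m) + h (p + 1) q (mdiff M p q m)"
    unfolding homotopic_def by blast
  have "graded_hom A (- 1) M L (\<lambda>p q m. s (p - 1) q (h p q m))"
    using graded_hom_compose[OF h s0] by simp
  moreover have "s p q (f p q m) - s p q (g p q m) = mdiff L (p - 1) q (s (p - 1) q (h p q m)) +
      s (p + 1 - 1) q (h (p + 1) q (mdiff M p q m))" if m: "m \<in> mcomp M p q" for p q m
  proof -
    have hm: "h p q m \<in> mcomp N (p - 1) q" "h (p + 1) q (mdiff M p q m) \<in> mcomp N p q"
      using graded_homD(4)[OF h m, of "p - 1"] graded_homD(4)[OF h M.diff_mem[OF m refl], of p] by auto
    have "s p q (f p q m) - s p q (g p q m) = s p q (f p q m - g p q m)"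
      using graded_homD(4)[OF f m, of p] graded_homD(4)[OF g m, of p]
      by (intro linear_map_on_diff[OF graded_homD(1)[OF s0 refl], symmetric] N.comp_subspace) auto
    also have "\<dots> = s p q (mdiff N (p - 1) q (h p q m)) + s p q (h (p + 1) q (mdiff M p q m))"
      unfolding e[OF m] using hm(2) N.diff_mem[OF hm(1), of p]
      by (intro linear_map_onD(2)[OF graded_homD(1)[OF s0 refl]]) auto
    also have "s p q (mdiff N (p - 1) q (h p q m)) = mdiff L (p - 1) q (s (p - 1) q (h p q m))"
      using s hm(1) unfolding dg_hom_def by (metis diff_add_cancel)
    finally show ?thesis by (simp only: add_diff_cancel_right')
  qed
  ultimately show ?thesis
    unfolding homotopic_def graded_comp_def o_def by blast
qed

lemma homotopic_comp_right:
  assumes "homotopic A M N f g" and v: "dg_hom A L M v"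
  shows "homotopic A L N (graded_comp f v) (graded_comp g v)"
proof -
  have v0: "graded_hom A 0 L M v" using v unfolding dg_hom_def by blast
  from assms(1) obtain h where h: "graded_hom A (- 1) M N h" and
    e: "\<And>p q m. m \<in> mcomp M p q \<Longrightarrow> f p q m - g p q m = mdiff N (p - 1) q (h p q m) + h (p + 1) q (mdiff M p q m)"
    unfolding homotopic_def by blast
  have "graded_hom A (- 1) L N (\<lambda>p q m. h p q (v p q m))"
    using graded_hom_compose[OF v0 h] by simp
  moreover have "f p q (v p q m) - g p q (v p q m) = mdiff N (p - 1) q (h p q (v p q m)) +
      h (p + 1) q (v (p + 1) q (mdiff L p q m))" if m: "m \<in> mcomp L p q" for p q m
    using e[OF graded_homD(4)[OF v0 m, of p]] v m unfolding dg_hom_def by simp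
  ultimately show ?thesis
    unfolding homotopic_def graded_comp_def o_def by blast
qed

lemma graded_comp_assoc: "graded_comp (graded_comp h g) f = graded_comp h (graded_comp g f)"
  by (simp add: graded_comp_def o_assoc)


section \<open>Shifts and simple modules\<close>

lemma shift_simps [simp]:
  "mcomp (shift k r N) p q = mcomp N (p + k) (q + r)"
  "mdiff (shift k r N) p q m = fscale (parity_sign k) (mdiff N (p + k) (q + r) m)"
  "mact (shift k r N) p q = mact N (p + k) (q + r)"
  "mbase (shift k r N) = (\<lambda>U p q. U (p + k) (q + r)) ` mbase N"
  by (simp_all add: shift_def)

lemma continuous_dg_module_shift:
  assumes "continuous_dg_module A N"
  shows "continuous_dg_module A (shift k r N)"
proof -
  interpret N: continuous_dg_module A N by fact
  show ?thesis
  proof (intro continuous_dg_module.intro, unfold shift_simps, goal_cases)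
    case (1 p q) show ?case by (rule N.comp_subspace)
  next
    case (2 p q) show ?case
      unfolding shift_simps(2)[abs_def] by (intro linear_map_on_scale N.comp_subspace N.diff_linear') simp
  next
    case (3 m p q)
    have "mdiff N (p + 1 + k) (q + r) (mdiff N (p + k) (q + r) m) = 0"
      by (rule N.diff_diff'[OF 3]) simp
    moreover have "mdiff N (p + 1 + k) (q + r) (fscale (parity_sign k) (mdiff N (p + k) (q + r) m)) =
        fscale (parity_sign k) (mdiff N (p + 1 + k) (q + r) (mdiff N (p + k) (q + r) m))"
      by (intro linear_map_onD(3)[OF N.diff_linear] N.diff_mem[OF 3]) simp
    ultimately show ?case by (simp only: fscale_simps)
  next
    case (4 x a b p q) then show ?case by (rule N.act_linear_left') simp_all
  next
    case (5 m p q a b) then show ?case by (rule N.act_linear_right') simp_all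
  next
    case (6 m p q) then show ?case by (rule N.act_one)
  next
    case (7 m p q x a b y a' b') then show ?case by (rule N.act_mult') simp_all
  next
    case (8 m p q x a b)
    have dm: "mdiff N (p + k) (q + r) m \<in> mcomp N (p + 1 + k) (q + r)"
      by (rule N.diff_mem[OF 8(1)]) simp
    have "mdiff N (p + a + k) (q + b + r) (mact N (p + k) (q + r) m x) =
        mact N (p + 1 + k) (q + r) (mdiff N (p + k) (q + r) m) x +
        fscale (parity_sign (p + k)) (mact N (p + k) (q + r) m (adiff A x))"
      by (rule N.leibniz'[OF 8]) simp_all
    moreover have "mact N (p + 1 + k) (q + r) (fscale (parity_sign k) (mdiff N (p + k) (q + r) m)) x =
        fscale (parity_sign k) (mact N (p + 1 + k) (q + r) (mdiff N (p + k) (q + r) m) x)"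
      by (rule linear_map_onD(3)[OF N.act_linear_left[OF 8(2)] dm])
    \<comment> \<open>The factor from the shifted differential and the shifted degree of
      \<open>m\<close> combine to the Leibniz sign in the new degree.\<close>
    moreover have "parity_sign k * parity_sign (p + k) = (parity_sign p :: complex)"
      by (simp add: parity_sign_add mult.left_commute)
    ultimately show ?case by (simp only: fscale_add fscale_simps)
  next
    case 9 show ?case using N.base_nonempty by simp
  next
    case (10 U V)
    then obtain U' V' where "U' \<in> mbase N" "V' \<in> mbase N" "U = (\<lambda>p q. U' (p + k) (q + r))"
      "V = (\<lambda>p q. V' (p + k) (q + r))" by auto
    moreover from this N.base_directed[of U' V'] obtain T where "T \<in> mbase N" "\<forall>p q. T p q \<subseteq> U' p q \<inter> V' p q"
      by blast
    ultimately show ?case by (intro bexI[of _ "\<lambda>p q. T (p + k) (q + r)"]) auto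
  next
    case (11 U p q) then show ?case using N.base_subspace by blast
  next
    case (12 U m p q)
    then obtain U' where U': "U' \<in> mbase N" "U = (\<lambda>p q. U' (p + k) (q + r))" by auto
    have "mdiff N (p + k) (q + r) m \<in> U' (p + k + 1) (q + r)"
      using N.base_diff[OF U'(1)] 12 U' by simp
    then have "fscale (parity_sign k) (mdiff N (p + k) (q + r) m) \<in> U' (p + k + 1) (q + r)"
      using N.base_subspace[OF U'(1)] by (intro fscale.subspace_scale) blast+
    moreover have "p + k + 1 = p + 1 + k" by simp
    ultimately show ?case using U' by metis
  next
    case (13 U m p q x a b)
    then obtain U' where U': "U' \<in> mbase N" "U = (\<lambda>p q. U' (p + k) (q + r))" by auto
    have "mact N (p + k) (q + r) m x \<in> U' (p + k + a) (q + r + b)"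
      using N.base_act[OF U'(1) _ 13(3)] 13 U' by simp
    moreover have "p + k + a = p + a + k" "q + r + b = q + b + r" by simp_all
    ultimately show ?case using U' by metis
  next
    case (14 U m p q a b)
    then obtain U' where U': "U' \<in> mbase N" "U = (\<lambda>p q. U' (p + k) (q + r))" by auto
    have "p + k + a = p + a + k" "q + r + b = q + b + r" by simp_all
    then show ?case using N.act_continuous[OF U'(1) 14(2), of a b] U' by metis
  next
    case (15 p q) show ?case using N.separated by simp
  next
    case (16 c p q)
    have "\<exists>m\<in>mcomp N (p + k) (q + r). \<forall>U\<in>mbase N. m - c (\<lambda>p q. U (p + k) (q + r)) \<in> U (p + k) (q + r)"
    proof (rule N.complete)
      fix U assume "U \<in> mbase N"
      then show "c (\<lambda>p q. U (p + k) (q + r)) \<in> mcomp N (p + k) (q + r)"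
        by (intro 16(1)) auto
    next
      fix U V assume "U \<in> mbase N" "V \<in> mbase N" "V (p + k) (q + r) \<subseteq> U (p + k) (q + r)"
      then show "c (\<lambda>p q. V (p + k) (q + r)) - c (\<lambda>p q. U (p + k) (q + r)) \<in> U (p + k) (q + r)"
        using 16(2)[of "\<lambda>p q. U (p + k) (q + r)" "\<lambda>p q. V (p + k) (q + r)"] by auto
    qed
    then show ?case by auto
  qed
qed

text \<open>A copy of \<open>simple_module\<close> over an arbitrary arrow type: the type of the
  original is tied to the Ginzburg quiver, while the resolution is built for any
  \<open>path_dga\<close>.\<close>

definition line_module :: "'v \<Rightarrow> ('u, ('v, 'e) path) dg_module"
  where "line_module i = \<lparr>
    mcomp = (\<lambda>p q. if p = 0 \<and> q = 0 then {m. \<forall>t. t \<noteq> undefined \<longrightarrow> m t = 0} else {0}),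
    mdiff = (\<lambda>p q m. 0),
    mact = (\<lambda>p q m x. fscale (x (i, [], i)) m),
    mbase = {\<lambda>p q. {0}}\<rparr>"

lemma line_module_simps [simp]:
  "mcomp (line_module i) p q = (if p = 0 \<and> q = 0 then {m. \<forall>t. t \<noteq> undefined \<longrightarrow> m t = 0} else {0})"
  "mdiff (line_module i) p q m = 0"
  "mact (line_module i) p q m x = fscale (x (i, [], i)) m"
  "mbase (line_module i) = {\<lambda>p q. {0}}"
  by (simp_all add: line_module_def)

context path_dga
begin

definition alg :: "('v, 'e) path dg_algebra"
  where "alg = \<lparr>
    acomp = part,
    amult = series_mult G,
    aone = (\<Sum>i\<in>verts G. idempotent i),
    adiff = diff,
    abase = {(\<lambda>p q. part p q \<inter> arrow_ideal_power G n) | n. True}\<rparr>"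

lemma alg_simps [simp]:
  "acomp alg = part" "amult alg = series_mult G" "aone alg = (\<Sum>i\<in>verts G. idempotent i)"
  "adiff alg = diff" "abase alg = {(\<lambda>p q. part p q \<inter> arrow_ideal_power G n) | n. True}"
  by (simp_all add: alg_def)

lemma part_trivial_coeff:
  assumes "x \<in> part a b" "a \<noteq> 0 \<or> b \<noteq> 0"
  shows "x (i, [], i) = 0"
  using bidegree_partD(2,3)[OF assms(1), of "(i, [], i)"] assms(2) by auto

lemma diff_trivial_coeff: "diff x (i, [], i) = 0"
  using arrow_ideal_powerD[OF diff_in_ideal, of x "(i, [], i)"] by auto

text \<open>The coefficient at the trivial path at \<open>i\<close> is multiplicative and vanishes
  in nonzero bidegree, on differentials and on the arrow ideal; the axioms for the action, including
  its continuity, reduce to these facts.\<close>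

lemma continuous_dg_module_line_module:
  assumes i: "i \<in> verts G"
  shows "continuous_dg_module alg (line_module i :: ('u, ('v, 'e) path) dg_module)"
proof (intro continuous_dg_module.intro, unfold line_module_simps alg_simps, goal_cases)
  case (1 p q) show ?case by (simp add: fscale.subspace_def)
next
  case (2 p q) show ?case by (rule linear_map_onI) simp_all
next
  case (3 m p q) show ?case by (rule refl)
next
  case (4 x a b p q) then show ?case
    using part_trivial_coeff[OF 4, of i] by (intro linear_map_onI) (auto simp: fscale_add mult.commute split: if_splits)
next
  case (5 m p q a b)
  then show ?case
    using part_trivial_coeff[of _ a b i] by (intro linear_map_onI) (auto simp: fun_eq_iff algebra_simps split: if_splits)
next
  case (6 m p q)
  have "(\<Sum>j\<in>verts G. idempotent j) (i, [], i) = (\<Sum>j\<in>verts G. if j = i then 1 else (0 :: complex))"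
    by (auto simp: sum_fun_apply idempotent_def single_path_def intro!: sum.cong)
  also have "\<dots> = 1" using i by (simp add: sum.delta)
  finally have e: "(\<Sum>j\<in>verts G. idempotent j) (i, [], i) = (1 :: complex)" .
  show ?case unfolding e by (rule fscale_simps)
next
  case (7 m p q x a b y a' b')
  show ?case using i by (simp add: series_mult_trivial_coeff mult.commute)
next
  case (8 m p q x a b)
  show ?case by (simp only: diff_trivial_coeff fscale_simps add_0_right)
next
  case 9 show ?case by simp
next
  case (10 U V) then show ?case by auto
next
  case (11 U p q) then show ?case by (auto simp: fscale.subspace_def)
next
  case (12 U m p q) then show ?case by auto
next
  case (13 U m p q x a b) then show ?case by auto
next
  case (14 U m p q a b)
  have "fscale (x (i, [], i)) m = 0" if "x \<in> part a b \<inter> arrow_ideal_power G 1" for x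
  proof -
    have "x (i, [], i) = 0" using arrow_ideal_powerD[of x G 1 "(i, [], i)"] that by auto
    then show ?thesis by simp
  qed
  then show ?case using 14 by (intro bexI[of _ "\<lambda>p q. part p q \<inter> arrow_ideal_power G 1"]) auto
next
  case (15 p q) show ?case by simp
next
  case (16 c p q)
  then show ?case by (intro bexI[of _ "c (\<lambda>p q. {0})"]) auto
qed

end


section \<open>The resolution of a simple module\<close>

text \<open>
  The map \<open>enc\<close> places two disjoint copies of the countable set of paths into the universe.
\<close>

locale cone_resolution = path_dga G cd idg D
  for G :: "('v, 'e) pre_digraph" and cd idg :: "'e \<Rightarrow> int" and D :: "'e \<Rightarrow> ('v, 'e) series" +
  fixes i :: 'v and enc :: "bool \<times> ('v, 'e) path \<Rightarrow> 'u"
  assumes i_vert: "i \<in> verts G" and inj_enc: "inj_on enc (UNIV \<times> paths G)"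
begin

text \<open>A pair of series is stored in one function on the universe, the Boolean selecting the
  entry. The restriction to \<open>paths G\<close> is there because \<open>enc\<close> is injective
  only on paths.\<close>

definition decode :: "bool \<Rightarrow> ('u \<Rightarrow> complex) \<Rightarrow> ('v, 'e) series"
  where "decode b m = (\<lambda>z. if z \<in> paths G then m (enc (b, z)) else 0)"

definition encode :: "('v, 'e) series \<Rightarrow> ('v, 'e) series \<Rightarrow> 'u \<Rightarrow> complex"
  where "encode x y = (\<lambda>u. if u \<in> enc ` (UNIV \<times> paths G)
    then case inv_into (UNIV \<times> paths G) enc u of (b, z) \<Rightarrow> if b then y z else x z else 0)"

lemma decode_encode [simp]:
  "x \<in> path_series G \<Longrightarrow> decode False (encode x y) = x"
  "y \<in> path_series G \<Longrightarrow> decode True (encode x y) = y"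
  using inv_into_f_f[OF inj_enc]
  by (auto simp: fun_eq_iff decode_def encode_def path_seriesD)

lemma encode_linear:
  "encode (x + x') (y + y') = encode x y + encode x' y'"
  "encode (x - x') (y - y') = encode x y - encode x' y'"
  "encode (fscale c x) (fscale c y) = fscale c (encode x y)"
  "encode 0 0 = 0"
  by (auto simp: fun_eq_iff encode_def split: prod.splits)

lemma decode_linear:
  "decode b (m + m') = decode b m + decode b m'"
  "decode b (m - m') = decode b m - decode b m'"
  "decode b (fscale c m) = fscale c (decode b m)"
  "decode b 0 = 0"
  by (auto simp: fun_eq_iff decode_def)

text \<open>A bidegree component of the right ideal \<open>e_i \<Gamma>\<close> of series all of
  whose paths end at \<open>i\<close>. Membership in the arrow ideal, which cuts out
  \<open>e_i J\<close>, is imposed separately.\<close>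

definition ideal_part :: "int \<Rightarrow> int \<Rightarrow> ('v, 'e) series set"
  where "ideal_part p q = {x \<in> part p q. \<forall>z. x z \<noteq> 0 \<longrightarrow> ptgt z = i}"

lemma ideal_part_subspace: "fscale.subspace (ideal_part p q)"
proof -
  have "ideal_part p q = part p q \<inter> {x. \<forall>z. ptgt z \<noteq> i \<longrightarrow> x z = 0}"
    unfolding ideal_part_def by blast
  moreover have "fscale.subspace {x :: ('v, 'e) series. \<forall>z. ptgt z \<noteq> i \<longrightarrow> x z = 0}"
    by (simp add: fscale.subspace_def)
  ultimately show ?thesis
    by (simp only: fscale.subspace_inter bidegree_part_subspace)
qed

lemma ideal_partD:
  assumes "x \<in> ideal_part p q"
  shows "x \<in> part p q" "x \<in> path_series G" "x z \<noteq> 0 \<Longrightarrow> ptgt z = i"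
  using assms bidegree_part_series unfolding ideal_part_def by blast+

lemma ideal_part_mult:
  assumes "x \<in> ideal_part p q" "a \<in> part p' q'" "p'' = p + p'" "q'' = q + q'"
  shows "series_mult G x a \<in> ideal_part p'' q''"
  using series_mult_bidegree_part[OF ideal_partD(1)[OF assms(1)] assms(2)] assms(3,4) ideal_partD(3)[OF assms(1)]
  unfolding ideal_part_def by (auto elim!: series_mult_nonzero)

lemma ideal_part_diff:
  assumes "x \<in> ideal_part p q" "p' = p + 1"
  shows "diff x \<in> ideal_part p' q"
  using diff_part[OF ideal_partD(1)[OF assms(1)]] assms(2) ideal_partD(3)[OF assms(1)]
  unfolding ideal_part_def by (auto elim!: diff_support)

text \<open>The filtration of the cone by powers of the arrow ideal. Level 0 is the whole component,
  so that components and neighbourhoods share their closure lemmas; the shift in the cone puts the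
  second entry one degree higher.\<close>

definition nbhd :: "nat \<Rightarrow> int \<Rightarrow> int \<Rightarrow> ('u \<Rightarrow> complex) set"
  where "nbhd n = (\<lambda>p q. {encode x y | x y. x \<in> ideal_part p q \<inter> arrow_ideal_power G n \<and>
    y \<in> ideal_part (p + 1) q \<inter> arrow_ideal_power G 1 \<inter> arrow_ideal_power G n})"

lemma encode_in_nbhd:
  "x \<in> ideal_part p q \<Longrightarrow> x \<in> arrow_ideal_power G n \<Longrightarrow> y \<in> ideal_part (p + 1) q \<Longrightarrow>
    y \<in> arrow_ideal_power G 1 \<Longrightarrow> y \<in> arrow_ideal_power G n \<Longrightarrow> encode x y \<in> nbhd n p q"
  unfolding nbhd_def by blast

text \<open>
  The cone over the inclusion of \<open>e\<^sub>i J\<close> into \<open>e\<^sub>i \<Gamma>\<close>, where \<open>\<Gamma>\<close> is the algebra and \<open>J\<close> its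
  arrow ideal; \<open>encode x y\<close> stands for the pair of \<open>x\<close> in \<open>e\<^sub>i \<Gamma>\<close> and \<open>y\<close> in the shift of \<open>e\<^sub>i J\<close>.
\<close>

definition cone :: "('u, ('v, 'e) path) dg_module"
  where "cone = \<lparr>
    mcomp = nbhd 0,
    mdiff = (\<lambda>p q m. encode (diff (decode False m) + decode True m) (- diff (decode True m))),
    mact = (\<lambda>p q m a. encode (series_mult G (decode False m) a) (series_mult G (decode True m) a)),
    mbase = range nbhd\<rparr>"

lemma arrow_ideal_power_0: "arrow_ideal_power G 0 = path_series G"
  by (simp add: arrow_ideal_power_def)

lemma mcomp_cone: "mcomp cone p q = {encode x y | x y. x \<in> ideal_part p q \<and>
    y \<in> ideal_part (p + 1) q \<inter> arrow_ideal_power G 1}"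
  unfolding cone_def nbhd_def arrow_ideal_power_0 using ideal_partD(2) by fastforce

lemma mcomp_coneE:
  assumes "m \<in> mcomp cone p q"
  obtains x y where "m = encode x y" "x \<in> ideal_part p q" "y \<in> ideal_part (p + 1) q"
    "y \<in> arrow_ideal_power G 1"
  using assms unfolding mcomp_cone by blast

lemma encode_in_cone:
  "x \<in> ideal_part p q \<Longrightarrow> y \<in> ideal_part p' q \<Longrightarrow> y \<in> arrow_ideal_power G 1 \<Longrightarrow> p' = p + 1 \<Longrightarrow>
    encode x y \<in> mcomp cone p q"
  unfolding mcomp_cone by blast

lemma mdiff_cone:
  "x \<in> path_series G \<Longrightarrow> y \<in> path_series G \<Longrightarrow>
    mdiff cone p q (encode x y) = encode (diff x + y) (- diff y)"
  by (simp add: cone_def)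

lemma mact_cone:
  "x \<in> path_series G \<Longrightarrow> y \<in> path_series G \<Longrightarrow>
    mact cone p q (encode x y) a = encode (series_mult G x a) (series_mult G y a)"
  by (simp add: cone_def)

lemma mbase_cone: "mbase cone = range nbhd"
  by (simp add: cone_def)

lemma nbhd_mono: "m \<le> n \<Longrightarrow> nbhd n p q \<subseteq> nbhd m p q"
  unfolding nbhd_def using arrow_ideal_power_mono[of m n G] by blast

lemma nbhd_subspace: "fscale.subspace (nbhd n p q)"
proof -
  have A: "fscale.subspace (ideal_part p q \<inter> arrow_ideal_power G n)"
    by (intro fscale.subspace_inter ideal_part_subspace arrow_ideal_power_subspace)
  have B: "fscale.subspace (ideal_part (p + 1) q \<inter> arrow_ideal_power G 1 \<inter> arrow_ideal_power G n)"
    by (intro fscale.subspace_inter ideal_part_subspace arrow_ideal_power_subspace)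
  show ?thesis
    unfolding fscale.subspace_def
  proof (intro conjI ballI allI)
    show "0 \<in> nbhd n p q"
      unfolding nbhd_def using fscale.subspace_0[OF A] fscale.subspace_0[OF B] encode_linear(4)[symmetric] by blast
    fix m assume "m \<in> nbhd n p q"
    then obtain x y where m: "m = encode x y" "x \<in> ideal_part p q \<inter> arrow_ideal_power G n"
      "y \<in> ideal_part (p + 1) q \<inter> arrow_ideal_power G 1 \<inter> arrow_ideal_power G n"
      unfolding nbhd_def by blast
    show "fscale c m \<in> nbhd n p q" for c
      unfolding nbhd_def m(1) encode_linear(3)[symmetric]
      using fscale.subspace_scale[OF A m(2), of c] fscale.subspace_scale[OF B m(3), of c] by blast
    fix m' assume "m' \<in> nbhd n p q"
    then obtain x' y' where m': "m' = encode x' y'" "x' \<in> ideal_part p q \<inter> arrow_ideal_power G n"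
      "y' \<in> ideal_part (p + 1) q \<inter> arrow_ideal_power G 1 \<inter> arrow_ideal_power G n"
      unfolding nbhd_def by blast
    show "m + m' \<in> nbhd n p q"
      unfolding nbhd_def m(1) m'(1) encode_linear(1)[symmetric]
      using fscale.subspace_add[OF A m(2) m'(2)] fscale.subspace_add[OF B m(3) m'(3)] by blast
  qed
qed

lemma nbhd_diff:
  assumes "m \<in> nbhd n p q"
  shows "mdiff cone p q m \<in> nbhd n (p + 1) q"
proof -
  from assms obtain x y where m: "m = encode x y" "x \<in> ideal_part p q" "x \<in> arrow_ideal_power G n"
    "y \<in> ideal_part (p + 1) q" "y \<in> arrow_ideal_power G 1" "y \<in> arrow_ideal_power G n"
    unfolding nbhd_def by blast
  have "diff x + y \<in> ideal_part (p + 1) q" "- diff y \<in> ideal_part (p + 1 + 1) q"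
    using m by (auto intro!: fscale.subspace_add[OF ideal_part_subspace] fscale.subspace_neg[OF ideal_part_subspace]
        ideal_part_diff)
  moreover have "diff x + y \<in> arrow_ideal_power G n" "- diff y \<in> arrow_ideal_power G n" "- diff y \<in> arrow_ideal_power G 1"
    using m by (auto intro!: fscale.subspace_add[OF arrow_ideal_power_subspace]
        fscale.subspace_neg[OF arrow_ideal_power_subspace] diff_arrow_ideal)
  ultimately show ?thesis
    unfolding m(1) mdiff_cone[OF ideal_partD(2)[OF m(2)] ideal_partD(2)[OF m(4)]] nbhd_def by blast
qed

lemma nbhd_act:
  assumes "m \<in> mcomp cone p q" "a \<in> part p' q'" "m \<in> nbhd n p q \<or> a \<in> arrow_ideal_power G n"
  shows "mact cone p q m a \<in> nbhd n (p + p') (q + q')"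
proof -
  have "\<exists>x y. m = encode x y \<and> x \<in> ideal_part p q \<and> y \<in> ideal_part (p + 1) q \<and> y \<in> arrow_ideal_power G 1 \<and>
      (x \<in> arrow_ideal_power G n \<and> y \<in> arrow_ideal_power G n \<or> a \<in> arrow_ideal_power G n)"
    using assms(1,3) unfolding mcomp_cone nbhd_def by blast
  then obtain x y where m: "m = encode x y" "x \<in> ideal_part p q"
    "y \<in> ideal_part (p + 1) q" "y \<in> arrow_ideal_power G 1"
    "x \<in> arrow_ideal_power G n \<and> y \<in> arrow_ideal_power G n \<or> a \<in> arrow_ideal_power G n" by blast
  have "series_mult G x a \<in> ideal_part (p + p') (q + q')" "series_mult G y a \<in> ideal_part (p + p' + 1) (q + q')"
    by (rule ideal_part_mult[OF m(2) assms(2)]; simp) (rule ideal_part_mult[OF m(3) assms(2)]; simp)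
  moreover have "series_mult G x a \<in> arrow_ideal_power G n" "series_mult G y a \<in> arrow_ideal_power G n"
    "series_mult G y a \<in> arrow_ideal_power G 1"
    using m(4,5) series_mult_arrow_ideal by blast+
  ultimately show ?thesis
    unfolding m(1) mact_cone[OF ideal_partD(2)[OF m(2)] ideal_partD(2)[OF m(3)]] nbhd_def by blast
qed

lemma continuous_dg_module_cone: "continuous_dg_module alg cone"
proof (intro continuous_dg_module.intro, unfold alg_simps mbase_cone, goal_cases)
  case (1 p q) show ?case using nbhd_subspace[of 0] by (simp add: cone_def)
next
  case (2 p q)
  show ?case
  proof (rule linear_map_onI)
    fix m assume "m \<in> mcomp cone p q"
    then have "m \<in> nbhd 0 p q" by (simp add: cone_def)
    then have "mdiff cone p q m \<in> nbhd 0 (p + 1) q" by (rule nbhd_diff)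
    then show "mdiff cone p q m \<in> mcomp cone (p + 1) q" by (simp add: cone_def)
  qed (simp_all add: cone_def decode_linear path_diff_linear encode_linear[symmetric] fscale_add algebra_simps)
next
  case (3 m p q)
  then obtain x y where "m = encode x y" "x \<in> ideal_part p q" "y \<in> ideal_part (p + 1) q"
    by (rule mcomp_coneE)
  moreover from this have s: "x \<in> path_series G" "y \<in> path_series G" by (auto dest: ideal_partD)
  moreover have "diff x + y \<in> path_series G" "- diff y \<in> path_series G"
    using s by (auto intro: fscale.subspace_add[OF path_series_subspace] fscale.subspace_neg[OF path_series_subspace])
  ultimately show ?case
    by (simp add: mdiff_cone path_diff_linear encode_linear)
next
  case (4 a p' q' p q)
  show ?case
  proof (rule linear_map_onI)
    fix m assume "m \<in> mcomp cone p q"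
    then show "mact cone p q m a \<in> mcomp cone (p + p') (q + q')"
      using nbhd_act[of m p q a p' q' 0] 4 by (simp add: cone_def)
  qed (simp_all add: cone_def decode_linear encode_linear[symmetric])
next
  case (5 m p q p' q')
  show ?case
  proof (rule linear_map_onI)
    fix a assume "a \<in> part p' q'"
    then show "mact cone p q m a \<in> mcomp cone (p + p') (q + q')"
      using nbhd_act[of m p q a p' q' 0] 5 by (simp add: cone_def)
  qed (simp_all add: cone_def decode_linear encode_linear[symmetric])
next
  case (6 m p q)
  then obtain x y where "m = encode x y" "x \<in> ideal_part p q" "y \<in> ideal_part (p + 1) q"
    by (rule mcomp_coneE)
  moreover from this have "x \<in> path_series G" "y \<in> path_series G" by (auto dest: ideal_partD)
  ultimately show ?case by (simp add: mact_cone one_mult)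
next
  case (7 m p q a p' q' b p'' q'')
  from 7(1) obtain x y where "m = encode x y" "x \<in> ideal_part p q" "y \<in> ideal_part (p + 1) q"
    by (rule mcomp_coneE)
  moreover from this have "x \<in> path_series G" "y \<in> path_series G" by (auto dest: ideal_partD)
  ultimately show ?case by (simp add: mact_cone series_mult_assoc)
next
  case (8 m p q a p' q')
  from 8(1) obtain x y where m: "m = encode x y" "x \<in> ideal_part p q" "y \<in> ideal_part (p + 1) q"
    by (rule mcomp_coneE)
  then have s: "x \<in> path_series G" "y \<in> path_series G" by (auto dest: ideal_partD)
  have s': "diff x + y \<in> path_series G" "- diff y \<in> path_series G"
    using s by (auto intro: fscale.subspace_add[OF path_series_subspace] fscale.subspace_neg[OF path_series_subspace])
  have 1: "diff (series_mult G x a) = series_mult G (diff x) a + fscale (parity_sign p) (series_mult G x (diff a))"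
    using ideal_partD(1)[OF m(2)] by (rule leibniz)
  \<comment> \<open>The entry \<open>y\<close> has degree \<open>p + 1\<close>; the additional sign
    is compensated by the minus in the cone differential.\<close>
  have 2: "diff (series_mult G y a) = series_mult G (diff y) a + fscale (parity_sign (p + 1)) (series_mult G y (diff a))"
    using ideal_partD(1)[OF m(3)] by (rule leibniz)
  show ?case
    unfolding m(1) mact_cone[OF s] mdiff_cone[OF s] mact_cone[OF s'] mdiff_cone[OF series_mult_in_path_series series_mult_in_path_series]
      1 2 encode_linear(1,3)[symmetric] series_mult_linear parity_sign_simps fscale_simps
    by (simp only: minus_add_distrib minus_minus add_ac)
next
  case 9 show ?case by simp
next
  case (10 U V)
  then obtain n n' where "U = nbhd n" "V = nbhd n'" by auto
  then show ?case using nbhd_mono[of n "max n n'"] nbhd_mono[of n' "max n n'"]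
    by (intro bexI[of _ "nbhd (max n n')"]) auto
next
  case (11 U p q)
  then obtain n where "U = nbhd n" by auto
  then show ?case using nbhd_subspace[of n p q] nbhd_mono[of 0 n p q] by (simp add: cone_def)
next
  case (12 U m p q) then show ?case using nbhd_diff by auto
next
  case (13 U m p q a p' q')
  then obtain n where n: "U = nbhd n" by auto
  then have "m \<in> mcomp cone p q" using 13(2) nbhd_mono[of 0 n p q] by (auto simp: cone_def)
  then show ?case using nbhd_act 13 n by blast
next
  case (14 U m p q p' q')
  then obtain n where n: "U = nbhd n" by auto
  then show ?case
    using nbhd_act[OF 14(2)] by (intro bexI[of _ "\<lambda>p q. part p q \<inter> arrow_ideal_power G n"]) auto
next
  case (15 p q)
  have "m = 0" if m: "\<forall>n. m \<in> nbhd n p q" for m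
  proof -
    from m obtain x y where xy: "m = encode x y" "x \<in> ideal_part p q" "y \<in> ideal_part (p + 1) q"
      unfolding nbhd_def by blast
    then have s: "x \<in> path_series G" "y \<in> path_series G" by (auto dest: ideal_partD)
    have "x z = 0 \<and> y z = 0" for z
    proof -
      from m obtain x' y' where xy': "m = encode x' y'" "x' \<in> arrow_ideal_power G (Suc (length (parcs z)))"
        "y' \<in> arrow_ideal_power G (Suc (length (parcs z)))"
        unfolding nbhd_def by blast
      then have "x' = x" "y' = y"
        using decode_encode s xy(1) arrow_ideal_power_series by metis+
      then show ?thesis using arrow_ideal_powerD[OF xy'(2), of z] arrow_ideal_powerD[OF xy'(3), of z] by auto
    qed
    then have "x = 0" "y = 0" by (auto simp: fun_eq_iff)
    then show ?thesis by (simp add: xy(1) encode_linear)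
  qed
  moreover have "0 \<in> nbhd n p q" for n by (rule fscale.subspace_0[OF nbhd_subspace])
  ultimately show ?case by auto
next
  case (16 c p q)
  define X where "X b n = decode b (c (nbhd n))" for b n
  have c: "c (nbhd n) = encode (X False n) (X True n)" "X False n \<in> ideal_part p q"
    "X True n \<in> ideal_part (p + 1) q" "X True n \<in> arrow_ideal_power G 1" for n
  proof -
    have "c (nbhd n) \<in> mcomp cone p q" by (rule 16(1)) simp
    then obtain x y where xy: "c (nbhd n) = encode x y" "x \<in> ideal_part p q" "y \<in> ideal_part (p + 1) q"
      "y \<in> arrow_ideal_power G 1" by (rule mcomp_coneE)
    then have "X False n = x" "X True n = y" unfolding X_def by (auto dest: ideal_partD)
    then show "c (nbhd n) = encode (X False n) (X True n)" "X False n \<in> ideal_part p q"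
      "X True n \<in> ideal_part (p + 1) q" "X True n \<in> arrow_ideal_power G 1" using xy by auto
  qed
  \<comment> \<open>The coefficient of the limit at \<open>z\<close> is taken at level
    \<open>Suc (length (parcs z))\<close>, the first modulus that still determines the coefficient
    at \<open>z\<close>; from there on the family is constant at \<open>z\<close>.\<close>
  define L where "L b = (\<lambda>z. X b (Suc (length (parcs z))) z)" for b
  have agree: "X b n z = X b (Suc (length (parcs z))) z" if z: "length (parcs z) < n" for b n z
  proof -
    let ?k = "Suc (length (parcs z))"
    have "c (nbhd n) - c (nbhd ?k) \<in> nbhd ?k p q"
      using z by (intro 16(2) nbhd_mono) auto
    then obtain x y where xy: "c (nbhd n) - c (nbhd ?k) = encode x y"
      "x \<in> arrow_ideal_power G ?k" "y \<in> arrow_ideal_power G ?k"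
      unfolding nbhd_def by blast
    have "X b n - X b ?k = decode b (c (nbhd n) - c (nbhd ?k))"
      unfolding X_def by (rule decode_linear(2)[symmetric])
    also have "\<dots> = (if b then y else x)"
      unfolding xy(1) using arrow_ideal_power_series[OF xy(2)] arrow_ideal_power_series[OF xy(3)]
      by (cases b) simp_all
    finally have "X b n - X b ?k \<in> arrow_ideal_power G ?k" using xy(2,3) by (cases b) auto
    from arrow_ideal_powerD[OF this, of z] show ?thesis by auto
  qed
  have LF: "L False \<in> ideal_part p q"
    unfolding ideal_part_def using ideal_partD[OF c(2)] bidegree_partD[OF ideal_partD(1)[OF c(2)]]
    by (intro CollectI conjI allI impI bidegree_partI) (simp_all add: L_def)
  have LT: "L True \<in> ideal_part (p + 1) q"
    unfolding ideal_part_def using ideal_partD[OF c(3)] bidegree_partD[OF ideal_partD(1)[OF c(3)]]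
    by (intro CollectI conjI allI impI bidegree_partI) (simp_all add: L_def)
  have LT1: "L True \<in> arrow_ideal_power G 1"
    using arrow_ideal_powerD[OF c(4)] by (intro arrow_ideal_powerI ideal_partD(2)[OF LT]) (simp add: L_def)
  have close: "L b - X b n \<in> arrow_ideal_power G n" for b n
  proof (rule arrow_ideal_powerI)
    show "L b - X b n \<in> path_series G"
      using ideal_partD(2)[OF LF] ideal_partD(2)[OF LT] ideal_partD(2)[OF c(2)] ideal_partD(2)[OF c(3)]
      by (cases b) (auto intro: fscale.subspace_diff[OF path_series_subspace])
    show "n \<le> length (parcs z)" if "(L b - X b n) z \<noteq> 0" for z
      using that agree[of z n b] by (auto simp: L_def not_less[symmetric])
  qed
  have "encode (L False) (L True) - c (nbhd n) \<in> nbhd n p q" for n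
    unfolding c(1)[of n] encode_linear(2)[symmetric]
    using close[of False n] close[of True n] fscale.subspace_diff[OF ideal_part_subspace LF c(2)[of n]]
      fscale.subspace_diff[OF ideal_part_subspace LT c(3)[of n]]
      fscale.subspace_diff[OF arrow_ideal_power_subspace LT1 c(4)[of n]] by (intro encode_in_nbhd)
  then show ?case
    using encode_in_cone[OF LF LT LT1 refl] by (intro bexI[of _ "encode (L False) (L True)"]) auto
qed

definition aug :: "'u graded_map"
  where "aug p q m = (\<lambda>t. if t = undefined then decode False m (i, [], i) else 0)"

lemma aug_encode: "x \<in> path_series G \<Longrightarrow> aug p q (encode x y) = (\<lambda>t. if t = undefined then x (i, [], i) else 0)"
  by (auto simp: aug_def fun_eq_iff)

text \<open>A cocycle \<open>(x, y)\<close> has \<open>y = - dx\<close>. If the augmentation kills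
  \<open>x\<close>, then \<open>x\<close> lies in the arrow ideal and \<open>(x, y)\<close> is the
  differential of \<open>(0, x)\<close>. Surjectivity is witnessed by multiples of the
  idempotent.\<close>

lemma aug_quasi_iso: "quasi_iso alg cone (line_module i) aug"
  unfolding quasi_iso_def dg_hom_def graded_hom_def
proof (intro conjI allI ballI impI)
  show "linear_map_on (mcomp cone p q) (mcomp (line_module i) (p + 0) q) (aug p q)" for p q
  proof (rule linear_map_onI)
    fix m assume "m \<in> mcomp cone p q"
    then obtain x y where m: "m = encode x y" "x \<in> ideal_part p q" by (rule mcomp_coneE)
    show "aug p q m \<in> mcomp (line_module i) (p + 0) q"
      using part_trivial_coeff[OF ideal_partD(1)[OF m(2)], of i] ideal_partD(2)[OF m(2)]
      by (auto simp: m(1) aug_encode fun_eq_iff)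
  qed (auto simp: aug_def decode_linear fun_eq_iff)
  fix p q
  show "aug (p + a) (q + b) (mact cone p q m x) = mact (line_module i) (p + 0) q (aug p q m) x"
    if "m \<in> mcomp cone p q" "x \<in> acomp alg a b" for a b m x
  proof -
    from that(1) obtain x' y' where m: "m = encode x' y'" "x' \<in> ideal_part p q" "y' \<in> ideal_part (p + 1) q"
      by (rule mcomp_coneE)
    note s = ideal_partD(2)[OF m(2)] ideal_partD(2)[OF m(3)]
    show ?thesis
      by (auto simp: m(1) mact_cone[OF s] aug_encode s series_mult_trivial_coeff i_vert fun_eq_iff)
  qed
  show "\<exists>U\<in>mbase cone. \<forall>m\<in>U p q. aug p q m \<in> V (p + 0) q" if "V \<in> mbase (line_module i :: ('u, ('v, 'e) path) dg_module)" for V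
  proof (intro bexI ballI)
    fix m assume "m \<in> nbhd 1 p q"
    then obtain x y where m: "m = encode x y" "x \<in> arrow_ideal_power G 1" unfolding nbhd_def by blast
    then have "x (i, [], i) = 0" using arrow_ideal_powerD[OF m(2), of "(i, [], i)"] by auto
    then have "aug p q m = 0"
      unfolding m(1) aug_encode[OF arrow_ideal_power_series[OF m(2)]] by auto
    then show "aug p q m \<in> V (p + 0) q"
      using that by auto
  qed (simp add: mbase_cone)
  show "aug (p + 1) q (mdiff cone p q m) = mdiff (line_module i) p q (aug p q m)" if "m \<in> mcomp cone p q" for m
  proof -
    from that(1) obtain x y where m: "m = encode x y" "x \<in> ideal_part p q" "y \<in> ideal_part (p + 1) q" "y \<in> arrow_ideal_power G 1"
      by (rule mcomp_coneE)
    note s = ideal_partD(2)[OF m(2)] ideal_partD(2)[OF m(3)]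
    have "y (i, [], i) = 0" using arrow_ideal_powerD[OF m(4), of "(i, [], i)"] by auto
    moreover have "diff x + y \<in> path_series G"
      using s by (intro fscale.subspace_add[OF path_series_subspace]) auto
    ultimately show ?thesis
      by (auto simp: m(1) mdiff_cone[OF s] aug_encode diff_trivial_coeff fun_eq_iff)
  qed
  show "m \<in> coboundaries cone p q"
    if "m \<in> cocycles cone p q" "aug p q m \<in> coboundaries (line_module i :: ('u, ('v, 'e) path) dg_module) p q" for m
  proof -
    from that(1) have m0: "m \<in> mcomp cone p q" "mdiff cone p q m = 0" unfolding cocycles_def by auto
    from m0(1) obtain x y where m: "m = encode x y" "x \<in> ideal_part p q" "y \<in> ideal_part (p + 1) q" "y \<in> arrow_ideal_power G 1"
      by (rule mcomp_coneE)
    note s = ideal_partD(2)[OF m(2)] ideal_partD(2)[OF m(3)]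
    have "diff x + y \<in> path_series G"
      using s by (intro fscale.subspace_add[OF path_series_subspace]) auto
    then have "diff x + y = decode False (mdiff cone p q m)"
      by (simp add: m(1) mdiff_cone[OF s])
    then have y: "y = - diff x"
      using m0(2) by (simp add: decode_linear eq_neg_iff_add_eq_0 add.commute)
    have "aug p q m = 0" using that(2) unfolding coboundaries_def by auto
    then have "aug p q m undefined = 0" by simp
    then have x0: "x (i, [], i) = 0" by (simp add: m(1) aug_encode s)
    have x1: "x \<in> arrow_ideal_power G 1"
    proof (rule arrow_ideal_powerI[OF s(1)])
      fix z assume z: "x z \<noteq> 0"
      have "parcs z \<noteq> []"
      proof
        assume "parcs z = []"
        moreover have "z \<in> paths G" "ptgt z = i"
          using z bidegree_partD(1)[OF ideal_partD(1)[OF m(2)]] ideal_partD(3)[OF m(2)] by auto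
        ultimately have "z = (i, [], i)" using trivial_path_eq[of z] by (metis ptgt_simps(1))
        with x0 z show False by simp
      qed
      then show "1 \<le> length (parcs z)" by (cases "parcs z") auto
    qed
    have zero: "0 \<in> ideal_part (p - 1) q" "0 \<in> path_series G"
      by (rule fscale.subspace_0[OF ideal_part_subspace], rule fscale.subspace_0[OF path_series_subspace])
    have "encode 0 x \<in> mcomp cone (p - 1) q"
      using x1 m(2) zero by (intro encode_in_cone) auto
    moreover have "mdiff cone (p - 1) q (encode 0 x) = m"
      unfolding m(1) y by (simp add: mdiff_cone[OF zero(2) s(1)])
    ultimately show ?thesis unfolding coboundaries_def by blast
  qed
  show "\<exists>m\<in>cocycles cone p q. n - aug p q m \<in> coboundaries (line_module i :: ('u, ('v, 'e) path) dg_module) p q"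
    if "n \<in> cocycles (line_module i :: ('u, ('v, 'e) path) dg_module) p q" for n
  proof -
    have zero: "0 \<in> ideal_part p q" "0 \<in> path_series G" "0 \<in> arrow_ideal_power G 1" for p q
      by (rule fscale.subspace_0[OF ideal_part_subspace], rule fscale.subspace_0[OF path_series_subspace],
          rule fscale.subspace_0[OF arrow_ideal_power_subspace])
    show ?thesis
    proof (cases "p = 0 \<and> q = 0")
      case True
      let ?x = "fscale (n undefined) (idempotent i)"
      have "idempotent i \<in> ideal_part 0 0"
        using idempotent_part[OF i_vert] unfolding ideal_part_def
        by (auto simp: idempotent_def single_path_def split: if_splits)
      then have x: "?x \<in> ideal_part p q"
        using True by (auto intro: fscale.subspace_scale[OF ideal_part_subspace])
      note s = ideal_partD(2)[OF x]
      have "encode ?x 0 \<in> cocycles cone p q"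
        using encode_in_cone[OF x zero(1,3) refl]
        by (simp add: cocycles_def mdiff_cone[OF s zero(2)] path_diff_linear encode_linear)
      moreover have "n = aug p q (encode ?x 0)"
        using that True unfolding aug_encode[OF s]
        by (auto simp: cocycles_def idempotent_def single_path_def fun_eq_iff)
      moreover have "0 \<in> coboundaries (line_module i :: ('u, ('v, 'e) path) dg_module) p q"
        unfolding coboundaries_def by auto
      ultimately show ?thesis by (intro bexI[of _ "encode ?x 0"]) simp_all
    next
      case False
      then have "n = 0" using that by (auto simp: cocycles_def)
      moreover have "0 \<in> coboundaries (line_module i :: ('u, ('v, 'e) path) dg_module) p q"
        unfolding coboundaries_def by auto
      moreover have "encode 0 0 \<in> cocycles cone p q"
        using encode_in_cone[OF zero(1) zero(1) zero(3) refl]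
        by (simp add: cocycles_def mdiff_cone[OF zero(2) zero(2), unfolded encode_linear] encode_linear)
      moreover have "aug p q (encode 0 0) = 0" by (simp add: aug_encode zero fun_eq_iff)
      ultimately show ?thesis by (intro bexI[of _ "encode 0 0"]) simp_all
    qed
  qed
qed

end


section \<open>Lifting along quasi-isomorphisms\<close>

lemma hom_diff_hom_diff:
  assumes "continuous_dg_module A M" "continuous_dg_module A N"
    and f: "graded_hom A k M N f" and m: "m \<in> mcomp M p q"
  shows "hom_diff (k + 1) M N (hom_diff k M N f) p q m = 0"
proof -
  interpret M: continuous_dg_module A M by fact
  interpret N: continuous_dg_module A N by fact
  have dm: "mdiff M p q m \<in> mcomp M (p + 1) q" by (rule M.diff_mem[OF m refl])
  have fm: "f p q m \<in> mcomp N (p + k) q" by (rule graded_homD(4)[OF f m refl])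
  have fdm: "f (p + 1) q (mdiff M p q m) \<in> mcomp N (p + (k + 1)) q"
    by (rule graded_homD(4)[OF f dm]) simp
  have dfm: "mdiff N (p + k) q (f p q m) \<in> mcomp N (p + (k + 1)) q"
    by (rule N.diff_mem[OF fm]) simp
  have "mdiff N (p + (k + 1)) q (mdiff N (p + k) q (f p q m) - fscale (parity_sign k) (f (p + 1) q (mdiff M p q m))) =
      mdiff N (p + (k + 1)) q (mdiff N (p + k) q (f p q m)) -
      mdiff N (p + (k + 1)) q (fscale (parity_sign k) (f (p + 1) q (mdiff M p q m)))"
    by (intro linear_map_on_diff[OF N.diff_linear] N.comp_subspace fscale.subspace_scale[OF N.comp_subspace] dfm fdm)
  also have "mdiff N (p + (k + 1)) q (mdiff N (p + k) q (f p q m)) = 0"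
    by (rule N.diff_diff'[OF fm]) simp
  also have "mdiff N (p + (k + 1)) q (fscale (parity_sign k) (f (p + 1) q (mdiff M p q m))) =
      fscale (parity_sign k) (mdiff N (p + (k + 1)) q (f (p + 1) q (mdiff M p q m)))"
    by (rule linear_map_onD(3)[OF N.diff_linear fdm])
  also have "0 - fscale (parity_sign k) (mdiff N (p + (k + 1)) q (f (p + 1) q (mdiff M p q m))) =
      - fscale (parity_sign k) (mdiff N (p + (k + 1)) q (f (p + 1) q (mdiff M p q m)))"
    by (rule diff_0)
  finally have 1: "mdiff N (p + (k + 1)) q (hom_diff k M N f p q m) =
      - fscale (parity_sign k) (mdiff N (p + (k + 1)) q (f (p + 1) q (mdiff M p q m)))"
    unfolding hom_diff_def .
  have "f (p + 1 + 1) q (mdiff M (p + 1) q (mdiff M p q m)) = 0"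
    unfolding M.diff_diff[OF m] by (rule linear_map_on_0[OF graded_homD(1)[OF f refl] M.comp_subspace])
  then have 2: "hom_diff k M N f (p + 1) q (mdiff M p q m) = mdiff N (p + (k + 1)) q (f (p + 1) q (mdiff M p q m))"
    by (simp add: hom_diff_def algebra_simps)
  show ?thesis
    unfolding hom_diff_def[of "k + 1"] 1 2 parity_sign_simps by simp
qed

lemma hom_diff_add:
  assumes "continuous_dg_module A N" and f: "graded_hom A k M N f" and g: "graded_hom A k M N g"
    and m: "m \<in> mcomp M p q"
  shows "hom_diff k M N (\<lambda>p q m. f p q m + g p q m) p q m = hom_diff k M N f p q m + hom_diff k M N g p q m"
proof -
  interpret N: continuous_dg_module A N by fact
  have "mdiff N (p + k) q (f p q m + g p q m) = mdiff N (p + k) q (f p q m) + mdiff N (p + k) q (g p q m)"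
    by (intro linear_map_onD(2)[OF N.diff_linear] graded_homD(4)[OF f m refl] graded_homD(4)[OF g m refl])
  then show ?thesis by (simp add: hom_diff_def fscale_add)
qed

lemma hom_diff_scale:
  assumes "continuous_dg_module A N" and f: "graded_hom A k M N f" and m: "m \<in> mcomp M p q"
  shows "hom_diff k M N (\<lambda>p q m. fscale c (f p q m)) p q m = fscale c (hom_diff k M N f p q m)"
proof -
  interpret N: continuous_dg_module A N by fact
  have "mdiff N (p + k) q (fscale c (f p q m)) = fscale c (mdiff N (p + k) q (f p q m))"
    by (intro linear_map_onD(3)[OF N.diff_linear] graded_homD(4)[OF f m refl])
  then show ?thesis by (simp add: hom_diff_def fscale_diff mult.commute)
qed

lemma hom_diff_diff:
  assumes N: "continuous_dg_module A N" and f: "graded_hom A k M N f" and g: "graded_hom A k M N g"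
    and m: "m \<in> mcomp M p q"
  shows "hom_diff k M N (\<lambda>p q m. f p q m - g p q m) p q m = hom_diff k M N f p q m - hom_diff k M N g p q m"
  using hom_diff_add[OF N f graded_hom_scale[OF N g, of "- 1"] m] hom_diff_scale[OF N g m, of "- 1"] by simp

lemma quasi_iso_cong:
  assumes "quasi_iso A M N f" "dg_hom A M N g" "\<And>p q m. m \<in> mcomp M p q \<Longrightarrow> g p q m = f p q m"
  shows "quasi_iso A M N g"
proof -
  have c: "g p q m = f p q m" if "m \<in> cocycles M p q" for p q m
    using assms(3) that by (auto simp: cocycles_def)
  show ?thesis
    using assms(1,2) unfolding quasi_iso_def by (simp add: c cong: conj_cong bex_cong ball_cong)
qed

lemma quasi_iso_id:
  assumes "continuous_dg_module A M"
  shows "quasi_iso A M M (\<lambda>p q. id)"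
proof -
  interpret M: continuous_dg_module A M by fact
  have "0 \<in> coboundaries M p q" for p q
    unfolding coboundaries_def
    using fscale.subspace_0[OF M.comp_subspace] linear_map_on_0[OF M.diff_linear M.comp_subspace] by (metis imageI)
  moreover from this have "\<exists>m\<in>cocycles M p q. n - id m \<in> coboundaries M p q" if "n \<in> cocycles M p q" for n p q
    by (intro bexI[OF _ that]) simp
  ultimately show ?thesis
    unfolding quasi_iso_def by (auto intro!: dg_hom_id)
qed

lemma (in path_dga) path_cd_nonpos: "z \<in> paths G \<Longrightarrow> path_degree cd z \<le> 0"
proof -
  assume "z \<in> paths G"
  then have "set (parcs z) \<subseteq> arcs G" by (auto simp: path_iff_awalk)
  then have "sum_list (map cd l) \<le> 0" if "set l \<subseteq> arcs G" for l
    using that by (induction l) (use cd_nonpos in \<open>auto intro: add_nonpos_nonpos\<close>)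
  then show ?thesis using \<open>set (parcs z) \<subseteq> arcs G\<close> by (simp add: path_degree_def)
qed

lemma line_coboundaries: "coboundaries (line_module i) p q = {0}"
  unfolding coboundaries_def by (auto simp: image_iff split: if_splits)

section \<open>The cone as a free graded module on finitely many generators\<close>

context cone_resolution
begin

definition incoming :: "'e set"
  where "incoming = {g \<in> arcs G. head G g = i}"

lemma finite_incoming [simp]: "finite incoming"
  by (simp add: incoming_def)

definition gen0 :: "'u \<Rightarrow> complex" where "gen0 = encode (idempotent i) 0"
definition gen :: "'e \<Rightarrow> 'u \<Rightarrow> complex" where "gen g = encode 0 (single_path (arc_path G g))"

lemma zero_mem: "0 \<in> ideal_part p q" "0 \<in> path_series G" "0 \<in> arrow_ideal_power G n"
  by (rule fscale.subspace_0[OF ideal_part_subspace], rule fscale.subspace_0[OF path_series_subspace],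
      rule fscale.subspace_0[OF arrow_ideal_power_subspace])

lemma idempotent_i: "idempotent i \<in> ideal_part 0 0" "idempotent i \<in> part 0 0" "idempotent i \<in> path_series G"
  using idempotent_part[OF i_vert] unfolding ideal_part_def
  by (auto simp: idempotent_def single_path_def dest: bidegree_part_series split: if_splits)

lemma single_arc:
  assumes "g \<in> incoming"
  shows "single_path (arc_path G g) \<in> ideal_part (cd g) (idg g)"
    "single_path (arc_path G g) \<in> part (cd g) (idg g)"
    "single_path (arc_path G g) \<in> path_series G"
    "single_path (arc_path G g) \<in> arrow_ideal_power G 1"
proof -
  have g: "g \<in> arcs G" "head G g = i" using assms by (auto simp: incoming_def)
  show p: "single_path (arc_path G g) \<in> part (cd g) (idg g)"
    using single_path_part[of "arc_path G g" cd idg] g by simp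
  then show "single_path (arc_path G g) \<in> ideal_part (cd g) (idg g)"
    unfolding ideal_part_def using g by (auto simp: single_path_def split: if_splits)
  show s: "single_path (arc_path G g) \<in> path_series G" using p by (rule bidegree_part_series)
  show "single_path (arc_path G g) \<in> arrow_ideal_power G 1"
    by (rule arrow_ideal_powerI[OF s]) (auto simp: single_path_def split: if_splits)
qed

lemma tail_idempotent:
  assumes "g \<in> incoming"
  shows "idempotent (tail G g) \<in> part 0 0"
  using assms by (intro idempotent_part) (auto simp: incoming_def)

lemma gen0_mem: "gen0 \<in> mcomp cone 0 0"
  unfolding gen0_def using idempotent_i zero_mem by (intro encode_in_cone) auto

lemma gen_mem: "g \<in> incoming \<Longrightarrow> gen g \<in> mcomp cone (cd g - 1) (idg g)"
  unfolding gen_def using single_arc zero_mem by (intro encode_in_cone) auto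

lemma gen0_idem: "mact cone p q gen0 (idempotent i) = gen0"
proof -
  have "series_mult G (idempotent i) (idempotent i) = idempotent i"
    unfolding idempotent_def using i_vert by (subst single_path_mult) (auto simp: awalk_Nil_iff)
  then show ?thesis
    unfolding gen0_def mact_cone[OF idempotent_i(3) zero_mem(2)] by simp
qed

lemma gen_idem:
  assumes g: "g \<in> incoming"
  shows "mact cone p q (gen g) (idempotent (tail G g)) = gen g"
proof -
  have "series_mult G (single_path (arc_path G g)) (idempotent (tail G g)) = single_path (arc_path G g)"
    using g unfolding idempotent_def
    by (subst single_path_mult) (auto simp: incoming_def awalk_Nil_iff)
  then show ?thesis
    unfolding gen_def mact_cone[OF zero_mem(2) single_arc(3)[OF g]] by simp
qed

lemma mdiff_gen0: "mdiff cone p q gen0 = 0"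
  unfolding gen0_def mdiff_cone[OF idempotent_i(3) zero_mem(2)] by (simp add: encode_linear)

lemma mdiff_gen:
  assumes g: "g \<in> incoming"
  shows "mdiff cone p q (gen g) = encode (single_path (arc_path G g)) (- D g)"
proof -
  have "g \<in> arcs G" using g by (simp add: incoming_def)
  then show ?thesis
    unfolding gen_def mdiff_cone[OF zero_mem(2) single_arc(3)[OF g]] by (simp add: diff_single_arc)
qed

lemma D_ideal_part:
  assumes g: "g \<in> incoming"
  shows "- D g \<in> ideal_part (cd g - 1 + 1 + 1) (idg g)" "- D g \<in> arrow_ideal_power G 1"
proof -
  have g': "g \<in> arcs G" "head G g = i" using g by (auto simp: incoming_def)
  then have "D g \<in> ideal_part (cd g + 1) (idg g)"
    unfolding ideal_part_def using D_part[OF g'(1)] D_parallel[OF g'(1)] by auto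
  then show "- D g \<in> ideal_part (cd g - 1 + 1 + 1) (idg g)"
    by (simp add: fscale.subspace_neg[OF ideal_part_subspace])
  show "- D g \<in> arrow_ideal_power G 1"
    by (rule fscale.subspace_neg[OF arrow_ideal_power_subspace D_ideal[OF g'(1)]])
qed

text \<open>The first entry is \<open>e_i x\<close>, the second is recovered from its left divisions
  by the arrows ending at \<open>i\<close>: these are the coordinates in the generators.\<close>

lemma encode_decomp:
  assumes x: "x \<in> ideal_part p q" and y: "y \<in> ideal_part (p + 1) q" and y1: "y \<in> arrow_ideal_power G 1"
  shows "encode x y = mact cone 0 0 gen0 x +
    (\<Sum>g\<in>incoming. mact cone (cd g - 1) (idg g) (gen g) (left_div G g y))"
proof -
  have sx: "x \<in> path_series G" using ideal_partD(2)[OF x] .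
  have "series_mult G (idempotent i) x = x"
    using idempotent_mult_left[OF i_vert sx] ideal_partD(3)[OF x] by (auto simp: fun_eq_iff)
  then have 1: "mact cone 0 0 gen0 x = encode x 0"
    unfolding gen0_def mact_cone[OF idempotent_i(3) zero_mem(2)] by simp
  have 2: "mact cone (cd g - 1) (idg g) (gen g) (left_div G g y) =
      encode 0 (series_mult G (single_path (arc_path G g)) (left_div G g y))" if "g \<in> incoming" for g
    unfolding gen_def mact_cone[OF zero_mem(2) single_arc(3)[OF that]] by simp
  have add: "encode 0 y + encode 0 y' = encode 0 (y + y')" for y y'
    by (simp add: encode_linear(1)[symmetric])
  have sum: "(\<Sum>g\<in>B. encode 0 (z g)) = encode 0 (\<Sum>g\<in>B. z g)" for B and z :: "'e \<Rightarrow> ('v, 'e) series"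
    by (induction B rule: infinite_finite_induct)
      (simp_all only: sum.infinite sum.empty sum.insert encode_linear(4) add not_False_eq_True)
  have "(\<Sum>g\<in>incoming. series_mult G (single_path (arc_path G g)) (left_div G g y)) = y"
    unfolding incoming_def using left_div_decomp[OF y1, of i] ideal_partD(3)[OF y] by blast
  then have "encode x y = encode x 0 + encode 0 (\<Sum>g\<in>incoming. series_mult G (single_path (arc_path G g)) (left_div G g y))"
    using encode_linear(1)[of x 0 0 y] by simp
  then show ?thesis
    by (simp only: 1 2 sum[symmetric] cong: sum.cong)
qed

text \<open>The expansion in generators is a finite sum with coefficients in the completed algebra,
  so linearity over the algebra is enough and no passage to the limit occurs.\<close>

lemma hom_expand:
  assumes X: "continuous_dg_module alg X" and F: "graded_hom alg k cone X F"
    and x: "x \<in> ideal_part p q" and y: "y \<in> ideal_part (p + 1) q" and y1: "y \<in> arrow_ideal_power G 1"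
  shows "F p q (encode x y) = mact X k 0 (F 0 0 gen0) x +
    (\<Sum>g\<in>incoming. mact X (cd g - 1 + k) (idg g) (F (cd g - 1) (idg g) (gen g)) (left_div G g y))"
proof -
  interpret C: continuous_dg_module alg cone by (rule continuous_dg_module_cone)
  have x': "x \<in> acomp alg p q" using ideal_partD(1)[OF x] by simp
  have y': "left_div G g y \<in> acomp alg (p + 1 - cd g) (q - idg g)" for g
    using left_div_part[OF ideal_partD(1)[OF y]] by simp
  have m0: "mact cone 0 0 gen0 x \<in> mcomp cone p q"
    by (rule C.act_mem[OF gen0_mem x']) simp_all
  have m1: "mact cone (cd g - 1) (idg g) (gen g) (left_div G g y) \<in> mcomp cone p q" if "g \<in> incoming" for g
    by (rule C.act_mem[OF gen_mem[OF that] y']) simp_all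
  have lin: "linear_map_on (mcomp cone p q) (mcomp X (p + k) q) (F p q)"
    by (rule graded_homD(1)[OF F refl])
  have "F p q (encode x y) = F p q (mact cone 0 0 gen0 x) +
      F p q (\<Sum>g\<in>incoming. mact cone (cd g - 1) (idg g) (gen g) (left_div G g y))"
    unfolding encode_decomp[OF x y y1]
    by (intro linear_map_onD(2)[OF lin] m0 fscale.subspace_sum[OF C.comp_subspace] m1)
  also have "F p q (\<Sum>g\<in>incoming. mact cone (cd g - 1) (idg g) (gen g) (left_div G g y)) =
      (\<Sum>g\<in>incoming. F p q (mact cone (cd g - 1) (idg g) (gen g) (left_div G g y)))"
    by (rule linear_map_on_sum[OF lin C.comp_subspace m1])
  also have "F p q (mact cone 0 0 gen0 x) = mact X k 0 (F 0 0 gen0) x"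
    by (rule graded_homD(2)[OF F gen0_mem x']) simp_all
  also have "(\<Sum>g\<in>incoming. F p q (mact cone (cd g - 1) (idg g) (gen g) (left_div G g y))) =
      (\<Sum>g\<in>incoming. mact X (cd g - 1 + k) (idg g) (F (cd g - 1) (idg g) (gen g)) (left_div G g y))"
  proof (rule sum.cong[OF refl])
    fix g assume g: "g \<in> incoming"
    show "F p q (mact cone (cd g - 1) (idg g) (gen g) (left_div G g y)) =
        mact X (cd g - 1 + k) (idg g) (F (cd g - 1) (idg g) (gen g)) (left_div G g y)"
      by (rule graded_homD(2)[OF F gen_mem[OF g] y']) simp_all
  qed
  finally show ?thesis .
qed

lemma hom_eqI:
  assumes X: "continuous_dg_module alg X" and F: "graded_hom alg k cone X F" and F': "graded_hom alg k cone X F'"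
    and "F 0 0 gen0 = F' 0 0 gen0"
    and "\<And>g. g \<in> incoming \<Longrightarrow> F (cd g - 1) (idg g) (gen g) = F' (cd g - 1) (idg g) (gen g)"
    and m: "m \<in> mcomp cone p q"
  shows "F p q m = F' p q m"
proof -
  from m obtain x y where m: "m = encode x y" and xy: "x \<in> ideal_part p q" "y \<in> ideal_part (p + 1) q" "y \<in> arrow_ideal_power G 1"
    by (rule mcomp_coneE)
  show ?thesis
    unfolding m hom_expand[OF X F xy] hom_expand[OF X F' xy] using assms(4,5) by simp
qed

text \<open>The map with prescribed values on the generators. A prescribed value is cut down by the
  idempotent at the vertex of its generator, as \<open>extend_gen0\<close> and
  \<open>extend_gen\<close> record.\<close>

definition extend :: "('u, ('v, 'e) path) dg_module \<Rightarrow> int \<Rightarrow> ('u \<Rightarrow> complex) \<Rightarrow> ('e \<Rightarrow> 'u \<Rightarrow> complex) \<Rightarrow> 'u graded_map"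
  where "extend X k u0 u = (\<lambda>p q m. mact X k 0 u0 (decode False m) +
    (\<Sum>g\<in>incoming. mact X (cd g - 1 + k) (idg g) (u g) (left_div G g (decode True m))))"

lemma graded_hom_extend:
  assumes X: "continuous_dg_module alg X" and u0: "u0 \<in> mcomp X k 0"
    and u: "\<And>g. g \<in> incoming \<Longrightarrow> u g \<in> mcomp X (cd g - 1 + k) (idg g)"
  shows "graded_hom alg k cone X (extend X k u0 u)"
  unfolding graded_hom_def extend_def
proof (intro conjI allI ballI)
  interpret X: continuous_dg_module alg X by fact
  have dec: "decode False m \<in> part p q" "left_div G g (decode True m) \<in> part (p + 1 - cd g) (q - idg g)"
    if "m \<in> mcomp cone p q" for m p q g
  proof -
    from that obtain x y where "m = encode x y" "x \<in> ideal_part p q" "y \<in> ideal_part (p + 1) q"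
      by (rule mcomp_coneE)
    then show "decode False m \<in> part p q" "left_div G g (decode True m) \<in> part (p + 1 - cd g) (q - idg g)"
      using ideal_partD[of x p q] ideal_partD[of y "p + 1" q] by (simp_all add: left_div_part)
  qed
  have dec0: "linear_map_on (mcomp cone p q) (acomp alg p q) (decode False)" for p q
    by (rule linear_map_onI) (simp_all add: decode_linear dec)
  have dec1: "linear_map_on (mcomp cone p q) (acomp alg (p + 1 - cd g) (q - idg g)) (\<lambda>m. left_div G g (decode True m))" for p q g
    by (rule linear_map_onI) (simp_all add: decode_linear dec)
  show "linear_map_on (mcomp cone p q) (mcomp X (p + k) q)
      (\<lambda>m. mact X k 0 u0 (decode False m) +
        (\<Sum>g\<in>incoming. mact X (cd g - 1 + k) (idg g) (u g) (left_div G g (decode True m))))" for p q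
    by (intro linear_map_on_add linear_map_on_sum_fun X.comp_subspace
        linear_map_on_comp[OF dec0 X.act_linear_right'[OF u0]]
        linear_map_on_comp[OF dec1 X.act_linear_right'[OF u]]) simp_all
  fix p q
  show "mact X k 0 u0 (decode False (mact cone p q m a)) +
        (\<Sum>g\<in>incoming. mact X (cd g - 1 + k) (idg g) (u g) (left_div G g (decode True (mact cone p q m a)))) =
      mact X (p + k) q (mact X k 0 u0 (decode False m) +
        (\<Sum>g\<in>incoming. mact X (cd g - 1 + k) (idg g) (u g) (left_div G g (decode True m)))) a"
    if m: "m \<in> mcomp cone p q" and a: "a \<in> acomp alg p' q'" for p' q' m a
  proof -
    from m obtain x y where m: "m = encode x y" and xy: "x \<in> ideal_part p q" "y \<in> ideal_part (p + 1) q" "y \<in> arrow_ideal_power G 1"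
      by (rule mcomp_coneE)
    note s = ideal_partD(2)[OF xy(1)] ideal_partD(2)[OF xy(2)]
    have x': "x \<in> acomp alg p q" using ideal_partD(1)[OF xy(1)] by simp
    have y': "left_div G g y \<in> acomp alg (p + 1 - cd g) (q - idg g)" for g
      using left_div_part[OF ideal_partD(1)[OF xy(2)]] by simp
    have 0: "mact X k 0 u0 (series_mult G x a) = mact X (p + k) q (mact X k 0 u0 x) a"
      using X.act_mult'[OF u0 x' a, of "p + k" q] by simp
    have 1: "mact X (cd g - 1 + k) (idg g) (u g) (left_div G g (series_mult G y a)) =
        mact X (p + k) q (mact X (cd g - 1 + k) (idg g) (u g) (left_div G g y)) a" if g: "g \<in> incoming" for g
    proof -
      have "left_div G g (series_mult G y a) = series_mult G (left_div G g y) a"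
        using g xy(3) by (intro left_div_mult) (auto simp: incoming_def)
      then show ?thesis using X.act_mult'[OF u[OF g] y'[of g] a, of "p + k" q] by simp
    qed
    have m0: "mact X k 0 u0 x \<in> mcomp X (p + k) q" by (rule X.act_mem[OF u0 x']) simp_all
    have m1: "mact X (cd g - 1 + k) (idg g) (u g) (left_div G g y) \<in> mcomp X (p + k) q" if "g \<in> incoming" for g
      by (rule X.act_mem[OF u[OF that] y']) simp_all
    have lin: "linear_map_on (mcomp X (p + k) q) (mcomp X (p + k + p') (q + q')) (\<lambda>n. mact X (p + k) q n a)"
      by (rule X.act_linear_left[OF a])
    have "mact X (p + k) q (mact X k 0 u0 x + (\<Sum>g\<in>incoming. mact X (cd g - 1 + k) (idg g) (u g) (left_div G g y))) a =
        mact X (p + k) q (mact X k 0 u0 x) a +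
        mact X (p + k) q (\<Sum>g\<in>incoming. mact X (cd g - 1 + k) (idg g) (u g) (left_div G g y)) a"
      by (intro linear_map_onD(2)[OF lin] m0 fscale.subspace_sum[OF X.comp_subspace] m1)
    also have "mact X (p + k) q (\<Sum>g\<in>incoming. mact X (cd g - 1 + k) (idg g) (u g) (left_div G g y)) a =
        (\<Sum>g\<in>incoming. mact X (p + k) q (mact X (cd g - 1 + k) (idg g) (u g) (left_div G g y)) a)"
      by (rule linear_map_on_sum[OF lin X.comp_subspace m1])
    finally show ?thesis
      unfolding m mact_cone[OF s] decode_encode[OF s(1)] decode_encode[OF s(2)]
        decode_encode[OF series_mult_in_path_series] 0 by (simp only: 1 cong: sum.cong)
  qed
  fix V assume V: "V \<in> mbase X"
  obtain I where I: "I \<in> abase alg" "\<forall>x\<in>I p q. mact X k 0 u0 x \<in> V (k + p) (0 + q)"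
    using X.act_continuous[OF V u0, of p q] by blast
  then obtain n0 where n0: "\<And>x. x \<in> part p q \<Longrightarrow> x \<in> arrow_ideal_power G n0 \<Longrightarrow> mact X k 0 u0 x \<in> V (p + k) q"
    by (auto simp: add.commute)
  have "\<exists>n. \<forall>x. x \<in> part (p + 1 - cd g) (q - idg g) \<longrightarrow> x \<in> arrow_ideal_power G n \<longrightarrow>
      mact X (cd g - 1 + k) (idg g) (u g) x \<in> V (p + k) q" if g: "g \<in> incoming" for g
  proof -
    obtain I where I: "I \<in> abase alg" "\<forall>x\<in>I (p + 1 - cd g) (q - idg g).
        mact X (cd g - 1 + k) (idg g) (u g) x \<in> V (cd g - 1 + k + (p + 1 - cd g)) (idg g + (q - idg g))"
      using X.act_continuous[OF V u[OF g], of "p + 1 - cd g" "q - idg g"] by blast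
    moreover have "cd g - 1 + k + (p + 1 - cd g) = p + k" "idg g + (q - idg g) = q" by simp_all
    ultimately show ?thesis by auto
  qed
  then obtain n where n: "\<And>g x. g \<in> incoming \<Longrightarrow> x \<in> part (p + 1 - cd g) (q - idg g) \<Longrightarrow>
      x \<in> arrow_ideal_power G (n g) \<Longrightarrow> mact X (cd g - 1 + k) (idg g) (u g) x \<in> V (p + k) q"
    by metis
  \<comment> \<open>One level that serves \<open>gen0\<close> and the finitely many arrows at once;
    the \<open>Suc\<close> pays for the arrow removed by left division.\<close>
  define k' where "k' = n0 + (\<Sum>g\<in>incoming. Suc (n g))"
  have k': "n0 \<le> k'" "g \<in> incoming \<Longrightarrow> Suc (n g) \<le> k'" for g
    unfolding k'_def using member_le_sum[of g incoming "\<lambda>g. Suc (n g)"] by (auto intro: trans_le_add2)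
  have sV: "fscale.subspace (V (p + k) q)" using X.base_subspace[OF V] by blast
  show "\<exists>U\<in>mbase cone. \<forall>m\<in>U p q. mact X k 0 u0 (decode False m) +
      (\<Sum>g\<in>incoming. mact X (cd g - 1 + k) (idg g) (u g) (left_div G g (decode True m))) \<in> V (p + k) q"
  proof (intro bexI ballI)
    fix m assume "m \<in> nbhd k' p q"
    then obtain x y where m: "m = encode x y" and x: "x \<in> ideal_part p q" "x \<in> arrow_ideal_power G k'"
      and y: "y \<in> ideal_part (p + 1) q" "y \<in> arrow_ideal_power G k'"
      unfolding nbhd_def by blast
    have "mact X k 0 u0 x \<in> V (p + k) q"
      using x k'(1) arrow_ideal_power_mono[of n0 k' G] by (intro n0 ideal_partD(1)) auto
    moreover have "mact X (cd g - 1 + k) (idg g) (u g) (left_div G g y) \<in> V (p + k) q" if g: "g \<in> incoming" for g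
      using y k'(2)[OF g] arrow_ideal_power_mono[of "Suc (n g)" k' G]
      by (intro n[OF g] left_div_part ideal_partD(1) left_div_arrow_ideal) auto
    ultimately show "mact X k 0 u0 (decode False m) +
      (\<Sum>g\<in>incoming. mact X (cd g - 1 + k) (idg g) (u g) (left_div G g (decode True m))) \<in> V (p + k) q"
      unfolding m decode_encode[OF ideal_partD(2)[OF x(1)]] decode_encode[OF ideal_partD(2)[OF y(1)]]
      by (intro fscale.subspace_add[OF sV] fscale.subspace_sum[OF sV])
  qed (simp add: mbase_cone)
qed

lemma extend_gen0:
  assumes X: "continuous_dg_module alg X" and u0: "u0 \<in> mcomp X k 0"
    and u: "\<And>g. g \<in> incoming \<Longrightarrow> u g \<in> mcomp X (cd g - 1 + k) (idg g)"
  shows "extend X k u0 u p q gen0 = mact X k 0 u0 (idempotent i)"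
proof -
  interpret X: continuous_dg_module alg X by fact
  have "mact X (cd g - 1 + k) (idg g) (u g) 0 = 0" if "g \<in> incoming" for g
    using linear_map_on_0[OF X.act_linear_right[OF u[OF that], of 0 0]] bidegree_part_subspace[of G cd idg 0 0] by simp
  then show ?thesis
    unfolding extend_def gen0_def decode_encode[OF idempotent_i(3)] decode_encode[OF zero_mem(2)] by simp
qed

lemma extend_gen:
  assumes X: "continuous_dg_module alg X" and u0: "u0 \<in> mcomp X k 0"
    and u: "\<And>g. g \<in> incoming \<Longrightarrow> u g \<in> mcomp X (cd g - 1 + k) (idg g)" and g: "g \<in> incoming"
  shows "extend X k u0 u p q (gen g) = mact X (cd g - 1 + k) (idg g) (u g) (idempotent (tail G g))"
proof -
  interpret X: continuous_dg_module alg X by fact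
  have z: "mact X (cd g - 1 + k) (idg g) (u g) 0 = 0" if "g \<in> incoming" for g
    using linear_map_on_0[OF X.act_linear_right[OF u[OF that], of 0 0]] bidegree_part_subspace[of G cd idg 0 0] by simp
  have z0: "mact X k 0 u0 0 = 0"
    using linear_map_on_0[OF X.act_linear_right[OF u0, of 0 0]] bidegree_part_subspace[of G cd idg 0 0] by simp
  have "mact X (cd g' - 1 + k) (idg g') (u g') (left_div G g' (single_path (arc_path G g))) =
      (if g' = g then mact X (cd g - 1 + k) (idg g) (u g) (idempotent (tail G g)) else 0)" if "g' \<in> incoming" for g'
    using left_div_single_arc[of g' g] that g z by (simp add: incoming_def)
  then have "(\<Sum>g'\<in>incoming. mact X (cd g' - 1 + k) (idg g') (u g') (left_div G g' (single_path (arc_path G g)))) =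
      (\<Sum>g'\<in>incoming. if g' = g then mact X (cd g - 1 + k) (idg g) (u g) (idempotent (tail G g)) else 0)"
    by (rule sum.cong[OF refl])
  also have "\<dots> = mact X (cd g - 1 + k) (idg g) (u g) (idempotent (tail G g))"
    using g by (simp only: sum.delta finite_incoming if_True)
  finally show ?thesis
    unfolding extend_def gen_def decode_encode[OF single_arc(3)[OF g]] decode_encode[OF zero_mem(2)] z0 by simp
qed

end

section \<open>Existence and uniqueness of lifts from the cone\<close>

context cone_resolution
begin

abbreviation line :: "('u, ('v, 'e) path) dg_module" where "line \<equiv> line_module i"

lemma continuous_dg_module_line: "continuous_dg_module alg line"
  by (rule continuous_dg_module_line_module[OF i_vert])

lemma exact_of_quasi_iso:
  assumes s: "quasi_iso alg X line s" and z: "z \<in> mcomp X p q" "mdiff X p q z = 0" "s p q z = 0"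
  obtains v where "v \<in> mcomp X (p - 1) q" "mdiff X (p - 1) q v = z"
proof -
  have "z \<in> cocycles X p q" using z by (simp add: cocycles_def)
  moreover have "s p q z \<in> coboundaries line p q" by (simp add: z(3) line_coboundaries)
  ultimately have "z \<in> coboundaries X p q" using s unfolding quasi_iso_def by blast
  then show ?thesis using that unfolding coboundaries_def by blast
qed

lemma quasi_isoD:
  assumes "quasi_iso A X Y s"
  shows "dg_hom A X Y s" "graded_hom A 0 X Y s"
    "m \<in> mcomp X p q \<Longrightarrow> s (p + 1) q (mdiff X p q m) = mdiff Y p q (s p q m)"
  using assms unfolding quasi_iso_def dg_hom_def by auto

text \<open>The other generators have degree \<open>cd g - 1 < 0\<close>, and a map of degree at
  most 0 sends them to negative degrees, where the line vanishes. Thus composites with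
  \<open>s\<close> are controlled by their value at \<open>gen0\<close>.\<close>

lemma line_hom_zero:
  assumes F: "graded_hom alg k cone line F" and k: "k \<le> 0" and "F 0 0 gen0 = 0" and m: "m \<in> mcomp cone p q"
  shows "F p q m = 0"
proof (rule hom_eqI[OF continuous_dg_module_line F
      graded_hom_zero[OF continuous_dg_module_cone continuous_dg_module_line] _ _ m])
  fix g assume g: "g \<in> incoming"
  then have "F (cd g - 1) (idg g) (gen g) \<in> mcomp line (cd g - 1 + k) (idg g)"
    by (intro graded_homD(4)[OF F gen_mem]) auto
  moreover have "cd g \<le> 0" using g cd_nonpos by (auto simp: incoming_def)
  ultimately show "F (cd g - 1) (idg g) (gen g) = 0" using k by (auto split: if_splits)
qed fact

text \<open>
  Induction on the negative of the degree: the value at a generator is corrected once its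
  differential, which involves only generators of higher degree, is under control.
\<close>

lemma hom_diff_lift:
  assumes X: "continuous_dg_module alg X" and s: "quasi_iso alg X line s" and k: "k \<le> 0"
    and c: "graded_hom alg (k + 1) cone X c"
    and closed: "\<And>p q m. m \<in> mcomp cone p q \<Longrightarrow> hom_diff (k + 1) cone X c p q m = 0"
    and sc: "\<And>p q m. m \<in> mcomp cone p q \<Longrightarrow> s (p + (k + 1)) q (c p q m) = 0"
    and h0: "h0 \<in> mcomp X k 0" "mdiff X k 0 h0 = c 0 0 gen0" "s k 0 h0 = 0"
  obtains h where "graded_hom alg k cone X h"
    "\<And>p q m. m \<in> mcomp cone p q \<Longrightarrow> hom_diff k cone X h p q m = c p q m"
    "\<And>p q m. m \<in> mcomp cone p q \<Longrightarrow> s (p + k) q (h p q m) = 0"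
proof -
  interpret X: continuous_dg_module alg X by fact
  note C = continuous_dg_module_cone
  interpret C: continuous_dg_module alg cone by (rule C)
  note s0 = quasi_isoD(2)[OF s]
  have adiff: "x \<in> acomp alg a b \<Longrightarrow> adiff alg x \<in> acomp alg (a + 1) b" for x a b
    by (simp add: diff_part)
  have idem: "idempotent j \<in> acomp alg 0 0" if "j \<in> verts G" for j
    using that by (simp add: idempotent_part)
  have tail: "tail G g \<in> verts G" if "g \<in> incoming" for g
    using that by (auto simp: incoming_def)
  have diff_act_idem: "mdiff X p q (mact X p q v (idempotent j)) = mact X (p + 1) q (mdiff X p q v) (idempotent j)"
    if "v \<in> mcomp X p q" "j \<in> verts G" for v p q j
  proof -
    have "mact X p q v 0 = 0"
      using linear_map_on_0[OF X.act_linear_right[OF that(1), of 0 0]] bidegree_part_subspace[of G cd idg 0 0] by simp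
    then show ?thesis
      using X.leibniz'[OF that(1) idem[OF that(2)], of p q "p + 1"] by simp
  qed
  have zero_X: "0 \<in> mcomp X p q" for p q by (rule fscale.subspace_0[OF X.comp_subspace])
  have act_0: "mact X p q 0 (idempotent j) = 0" if "j \<in> verts G" for p q j
    by (rule linear_map_on_0[OF X.act_linear_left[OF idem[OF that]] X.comp_subspace])
  have diff_0: "mdiff X p q 0 = 0" for p q by (rule linear_map_on_0[OF X.diff_linear X.comp_subspace])
  have s_0: "s p q 0 = 0" for p q by (rule linear_map_on_0[OF graded_homD(1)[OF s0 refl] X.comp_subspace])
  \<comment> \<open>The quotient of \<open>D g\<close> by \<open>b\<close> has degree
    \<open>cd g + 1 - cd b\<close>, which is positive here, while no path has positive
    degree.\<close>
  have lower: "left_div G b (- D g) = 0" if "g \<in> incoming" "cd b \<le> cd g" for b g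
  proof (rule ccontr)
    assume "left_div G b (- D g) \<noteq> 0"
    then obtain z where z: "left_div G b (- D g) z \<noteq> 0" by (auto simp: fun_eq_iff)
    have "left_div G b (- D g) \<in> part (cd g - 1 + 1 + 1 - cd b) (idg g - idg b)"
      by (rule left_div_part[OF ideal_partD(1)[OF D_ideal_part(1)[OF that(1)]]])
    from bidegree_partD[OF this z] path_cd_nonpos[of z] that(2) show False by simp
  qed
  \<comment> \<open>By \<open>lower\<close> the differential of \<open>gen g\<close> expands in
    \<open>gen0\<close> and in generators of strictly higher degree; a map vanishing on all of these
    vanishes on it.\<close>
  have at_diff: "F (cd g) (idg g) (mdiff cone (cd g - 1) (idg g) (gen g)) = 0"
    if F: "graded_hom alg l cone X F" and g: "g \<in> incoming" and F0: "F 0 0 gen0 = 0"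
      and low: "\<And>b. b \<in> incoming \<Longrightarrow> cd g < cd b \<Longrightarrow> F (cd b - 1) (idg b) (gen b) = 0" for F l g
  proof -
    have arc: "single_path (arc_path G g) \<in> ideal_part (cd g) (idg g)" by (rule single_arc(1)[OF g])
    have D: "- D g \<in> ideal_part (cd g + 1) (idg g)" using D_ideal_part(1)[OF g] by simp
    have act0: "mact X p q 0 x = 0" if "x \<in> acomp alg a b" for p q x a b
      by (rule linear_map_on_0[OF X.act_linear_left[OF that] X.comp_subspace])
    have "mact X (cd b - 1 + l) (idg b) (F (cd b - 1) (idg b) (gen b)) (left_div G b (- D g)) = 0" if b: "b \<in> incoming" for b
    proof (cases "cd g < cd b")
      case True
      have "left_div G b (- D g) \<in> acomp alg (cd g + 1 - cd b) (idg g - idg b)"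
        using left_div_part[OF ideal_partD(1)[OF D]] by simp
      then show ?thesis using low[OF b True] act0 by simp
    next
      case False
      have "linear_map_on (acomp alg 0 0) (mcomp X (cd b - 1 + l + 0) (idg b + 0))
          (mact X (cd b - 1 + l) (idg b) (F (cd b - 1) (idg b) (gen b)))"
        by (intro X.act_linear_right graded_homD(4)[OF F gen_mem[OF b] refl])
      from linear_map_on_0[OF this] show ?thesis
        using False lower[OF g, of b] bidegree_part_subspace[of G cd idg 0 0] by simp
    qed
    moreover have "mact X l 0 (F 0 0 gen0) (single_path (arc_path G g)) = 0"
      using F0 act0[of "single_path (arc_path G g)" "cd g" "idg g"] ideal_partD(1)[OF arc] by simp
    ultimately show ?thesis
      unfolding mdiff_gen[OF g] hom_expand[OF X F arc D D_ideal_part(2)[OF g]] by simp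
  qed
  \<comment> \<open>The parameter \<open>n\<close> bounds the negated arrow degrees already treated.
    The condition at \<open>gen0\<close> is carried along because, by \<open>line_hom_zero\<close>,
    it gives the vanishing of \<open>s\<close> after \<open>h\<close> on the whole cone.\<close>
  have "\<exists>h. graded_hom alg k cone X h \<and> s k 0 (h 0 0 gen0) = 0 \<and> hom_diff k cone X h 0 0 gen0 = c 0 0 gen0 \<and>
      (\<forall>g\<in>incoming. nat (- cd g) < n \<longrightarrow> hom_diff k cone X h (cd g - 1) (idg g) (gen g) = c (cd g - 1) (idg g) (gen g))" for n
  proof (induction n)
    case 0
    \<comment> \<open>The given \<open>h0\<close> settles the value at \<open>gen0\<close>, which no
      later correction touches.\<close>
    let ?h = "extend X k h0 (\<lambda>_. 0)"
    have h: "graded_hom alg k cone X ?h" by (rule graded_hom_extend[OF X h0(1) zero_X])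
    have val: "?h 0 0 gen0 = mact X k 0 h0 (idempotent i)" by (rule extend_gen0[OF X h0(1) zero_X])
    have "s k 0 (mact X k 0 h0 (idempotent i)) = mact line k 0 (s k 0 h0) (idempotent i)"
      by (rule graded_homD(2)[OF s0 h0(1) idem[OF i_vert]]) simp_all
    then have sh: "s k 0 (?h 0 0 gen0) = 0" by (simp add: val h0(3))
    have "mact X (k + 1) 0 (c 0 0 gen0) (idempotent i) = c 0 0 (mact cone 0 0 gen0 (idempotent i))"
      by (rule graded_homD(2)[OF c gen0_mem idem[OF i_vert], symmetric]) simp_all
    moreover have "?h 1 0 0 = 0"
      by (rule linear_map_on_0[OF graded_homD(1)[OF h refl] C.comp_subspace])
    ultimately have "hom_diff k cone X ?h 0 0 gen0 = c 0 0 gen0"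
      unfolding hom_diff_def val mdiff_gen0
      using diff_act_idem[OF h0(1) i_vert] h0(2) gen0_idem by simp
    with h sh show ?case by blast
  next
    case (Suc n)
    then obtain h where h: "graded_hom alg k cone X h" and sh: "s k 0 (h 0 0 gen0) = 0"
      and he: "hom_diff k cone X h 0 0 gen0 = c 0 0 gen0"
      and hg: "\<And>g. g \<in> incoming \<Longrightarrow> nat (- cd g) < n \<Longrightarrow>
        hom_diff k cone X h (cd g - 1) (idg g) (gen g) = c (cd g - 1) (idg g) (gen g)" by blast
    have dh: "graded_hom alg (k + 1) cone X (hom_diff k cone X h)"
      by (rule graded_hom_hom_diff[OF C X adiff h])
    \<comment> \<open>The remaining error. It is again closed and killed by \<open>s\<close>, and it
      already vanishes on the generators treated so far.\<close>
    define c' where "c' = (\<lambda>p q m. c p q m - hom_diff k cone X h p q m)"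
    have c': "graded_hom alg (k + 1) cone X c'"
      unfolding c'_def by (rule graded_hom_diff[OF C X c dh])
    have c'_closed: "hom_diff (k + 1) cone X c' p q m = 0" if m: "m \<in> mcomp cone p q" for p q m
      unfolding c'_def hom_diff_diff[OF X c dh m] closed[OF m] hom_diff_hom_diff[OF C X h m] by simp
    have sh_all: "s (p + k) q (h p q m) = 0" if "m \<in> mcomp cone p q" for p q m
    proof -
      have "graded_hom alg k cone line (\<lambda>p q m. s (p + k) q (h p q m))"
        using graded_hom_compose[OF h s0] by simp
      then show ?thesis
        by (rule line_hom_zero[OF _ k]) (use sh that in auto)
    qed
    have sdh: "s (p + (k + 1)) q (hom_diff k cone X h p q m) = 0" if m: "m \<in> mcomp cone p q" for p q m
    proof -
      have hm: "h p q m \<in> mcomp X (p + k) q" by (rule graded_homD(4)[OF h m refl])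
      have dm: "mdiff cone p q m \<in> mcomp cone (p + 1) q" by (rule C.diff_mem[OF m refl])
      have hdm: "h (p + 1) q (mdiff cone p q m) \<in> mcomp X (p + (k + 1)) q"
        by (rule graded_homD(4)[OF h dm]) simp
      have dhm: "mdiff X (p + k) q (h p q m) \<in> mcomp X (p + (k + 1)) q"
        by (rule X.diff_mem[OF hm]) simp
      have lin: "linear_map_on (mcomp X (p + (k + 1)) q) (mcomp line (p + (k + 1)) q) (s (p + (k + 1)) q)"
        by (rule graded_homD(1)[OF s0]) simp
      have "s (p + (k + 1)) q (mdiff X (p + k) q (h p q m)) = 0"
        using quasi_isoD(3)[OF s hm] by (simp add: add.assoc)
      moreover have "s (p + (k + 1)) q (h (p + 1) q (mdiff cone p q m)) = 0"
        using sh_all[OF dm] by (simp add: algebra_simps)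
      ultimately show ?thesis
        unfolding hom_diff_def
          linear_map_on_diff[OF lin X.comp_subspace dhm fscale.subspace_scale[OF X.comp_subspace hdm]]
          linear_map_onD(3)[OF lin hdm] by simp
    qed
    have "\<exists>v. v \<in> mcomp X (cd g - 1 + k) (idg g) \<and>
        mdiff X (cd g - 1 + k) (idg g) v = c' (cd g - 1) (idg g) (gen g)" if g: "g \<in> incoming" "nat (- cd g) = n" for g
    proof -
      have o: "c' (cd g - 1) (idg g) (gen g) \<in> mcomp X (cd g - 1 + (k + 1)) (idg g)"
        by (rule graded_homD(4)[OF c' gen_mem[OF g(1)] refl])
      \<comment> \<open>Since \<open>c'\<close> is closed, the differential of its value at
        \<open>gen g\<close> is, up to sign, its value at the differential of \<open>gen g\<close>.
        As the latter is zero, the error at \<open>gen g\<close> is a cocycle killed by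
        \<open>s\<close>, hence exact.\<close>
      have "c' (cd g) (idg g) (mdiff cone (cd g - 1) (idg g) (gen g)) = 0"
      proof (rule at_diff[OF c' g(1)])
        fix b assume "b \<in> incoming" "cd g < cd b"
        moreover from this have "cd b \<le> 0" using cd_nonpos by (auto simp: incoming_def)
        ultimately have "nat (- cd b) < n" using g(2) by auto
        then show "c' (cd b - 1) (idg b) (gen b) = 0" using hg[OF \<open>b \<in> incoming\<close>] by (simp add: c'_def)
      qed (simp add: c'_def he)
      then have "mdiff X (cd g - 1 + (k + 1)) (idg g) (c' (cd g - 1) (idg g) (gen g)) = 0"
        using c'_closed[OF gen_mem[OF g(1)]] unfolding hom_diff_def by simp
      moreover have "s (cd g - 1 + (k + 1)) (idg g) (c' (cd g - 1) (idg g) (gen g)) = 0"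
      proof -
        have lin: "linear_map_on (mcomp X (cd g - 1 + (k + 1)) (idg g)) (mcomp line (cd g - 1 + (k + 1)) (idg g))
            (s (cd g - 1 + (k + 1)) (idg g))"
          by (rule graded_homD(1)[OF s0]) simp
        show ?thesis
          unfolding c'_def linear_map_on_diff[OF lin X.comp_subspace graded_homD(4)[OF c gen_mem[OF g(1)] refl]
              graded_homD(4)[OF dh gen_mem[OF g(1)] refl]] sc[OF gen_mem[OF g(1)]] sdh[OF gen_mem[OF g(1)]] by simp
      qed
      ultimately obtain v where "v \<in> mcomp X (cd g - 1 + (k + 1) - 1) (idg g)"
        "mdiff X (cd g - 1 + (k + 1) - 1) (idg g) v = c' (cd g - 1) (idg g) (gen g)"
        by (rule exact_of_quasi_iso[OF s o])
      moreover have "cd g - 1 + (k + 1) - 1 = cd g - 1 + k" by simp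
      ultimately show ?thesis by metis
    qed
    then obtain v0 where v0: "\<And>g. g \<in> incoming \<Longrightarrow> nat (- cd g) = n \<Longrightarrow> v0 g \<in> mcomp X (cd g - 1 + k) (idg g) \<and>
        mdiff X (cd g - 1 + k) (idg g) (v0 g) = c' (cd g - 1) (idg g) (gen g)" by metis
    define v where "v g = (if nat (- cd g) = n then v0 g else 0)" for g
    have v: "v g \<in> mcomp X (cd g - 1 + k) (idg g)" if "g \<in> incoming" for g
      using v0[OF that] zero_X by (simp add: v_def)
    \<comment> \<open>A correction supported on the generators with \<open>nat (- cd g) = n\<close>,
      so the equations obtained earlier are preserved.\<close>
    define H where "H = extend X k 0 v"
    have H: "graded_hom alg k cone X H" unfolding H_def by (rule graded_hom_extend[OF X zero_X v])
    have H0: "H p q gen0 = 0" for p q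
      unfolding H_def using extend_gen0[OF X zero_X v] act_0[OF i_vert] by simp
    have Hg: "H p q (gen g) = mact X (cd g - 1 + k) (idg g) (v g) (idempotent (tail G g))" if "g \<in> incoming" for g p q
      unfolding H_def by (rule extend_gen[OF X zero_X v that])
    have Hd: "hom_diff k cone X H (cd g - 1) (idg g) (gen g) =
        (if nat (- cd g) = n then c' (cd g - 1) (idg g) (gen g) else 0)" if g: "g \<in> incoming" "nat (- cd g) \<le> n" for g
    proof -
      have "H (cd g) (idg g) (mdiff cone (cd g - 1) (idg g) (gen g)) = 0"
      proof (rule at_diff[OF H g(1)])
        fix b assume b: "b \<in> incoming" "cd g < cd b"
        moreover from this have "cd b \<le> 0" using cd_nonpos by (auto simp: incoming_def)
        ultimately have "nat (- cd b) \<noteq> n" using g(2) by auto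
        then show "H (cd b - 1) (idg b) (gen b) = 0"
          unfolding Hg[OF b(1)] using act_0[OF tail[OF b(1)]] by (simp add: v_def)
      qed (simp add: H0)
      then have "hom_diff k cone X H (cd g - 1) (idg g) (gen g) =
          mact X (cd g - 1 + k + 1) (idg g) (mdiff X (cd g - 1 + k) (idg g) (v g)) (idempotent (tail G g))"
        unfolding hom_diff_def Hg[OF g(1)] diff_act_idem[OF v[OF g(1)] tail[OF g(1)]] by simp
      \<comment> \<open>The idempotent introduced by \<open>extend\<close> is harmless:
        \<open>gen g\<close> is fixed by it, hence so is the value of \<open>c'\<close>
        there.\<close>
      moreover have "mact X (cd g - 1 + k + 1) (idg g) (c' (cd g - 1) (idg g) (gen g)) (idempotent (tail G g)) =
          c' (cd g - 1) (idg g) (mact cone (cd g - 1) (idg g) (gen g) (idempotent (tail G g)))"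
        by (rule graded_homD(2)[OF c' gen_mem[OF g(1)] idem[OF tail[OF g(1)]], symmetric]) simp_all
      ultimately show ?thesis
        using v0[OF g(1)] by (simp add: v_def gen_idem[OF g(1)] diff_0 act_0[OF tail[OF g(1)]])
    qed
    define h' where "h' = (\<lambda>p q m. h p q m + H p q m)"
    have h': "graded_hom alg k cone X h'" unfolding h'_def by (rule graded_hom_add[OF C X h H])
    have "hom_diff k cone X h' 0 0 gen0 = c 0 0 gen0"
    proof -
      have "H (0 + 1) 0 0 = 0" by (rule linear_map_on_0[OF graded_homD(1)[OF H refl] C.comp_subspace])
      then have "hom_diff k cone X H 0 0 gen0 = 0"
        by (simp add: hom_diff_def H0 mdiff_gen0 diff_0)
      then show ?thesis unfolding h'_def hom_diff_add[OF X h H gen0_mem] he by simp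
    qed
    moreover have "s k 0 (h' 0 0 gen0) = 0" unfolding h'_def H0 using sh by simp
    moreover have "hom_diff k cone X h' (cd g - 1) (idg g) (gen g) = c (cd g - 1) (idg g) (gen g)"
      if g: "g \<in> incoming" "nat (- cd g) < Suc n" for g
    proof (cases "nat (- cd g) = n")
      case True
      then show ?thesis
        unfolding h'_def hom_diff_add[OF X h H gen_mem[OF g(1)]] using Hd[OF g(1)] by (simp add: c'_def)
    next
      case False
      then show ?thesis
        unfolding h'_def hom_diff_add[OF X h H gen_mem[OF g(1)]] using Hd[OF g(1)] hg[OF g(1)] g(2) by simp
    qed
    ultimately show ?case using h' by blast
  qed
  \<comment> \<open>The sum of all negated degrees bounds each of them, so at this stage every
    generator has been treated.\<close>
  from this[of "Suc (\<Sum>g\<in>incoming. nat (- cd g))"] obtain h where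
    h: "graded_hom alg k cone X h" and sh: "s k 0 (h 0 0 gen0) = 0" and
    he: "hom_diff k cone X h 0 0 gen0 = c 0 0 gen0" and
    hg: "\<And>g. g \<in> incoming \<Longrightarrow> nat (- cd g) < Suc (\<Sum>g\<in>incoming. nat (- cd g)) \<Longrightarrow>
        hom_diff k cone X h (cd g - 1) (idg g) (gen g) = c (cd g - 1) (idg g) (gen g)" by blast
  show ?thesis
  proof (rule that[OF h])
    have "nat (- cd g) < Suc (\<Sum>g\<in>incoming. nat (- cd g))" if "g \<in> incoming" for g
      using member_le_sum[of g incoming "\<lambda>g. nat (- cd g)"] that by (simp add: less_Suc_eq_le)
    then show "hom_diff k cone X h p q m = c p q m" if "m \<in> mcomp cone p q" for p q m
      using hg he by (intro hom_eqI[OF X graded_hom_hom_diff[OF C X adiff h] c _ _ that]) auto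
    have "graded_hom alg k cone line (\<lambda>p q m. s (p + k) q (h p q m))"
      using graded_hom_compose[OF h s0] by simp
    from line_hom_zero[OF this k] sh show "s (p + k) q (h p q m) = 0" if "m \<in> mcomp cone p q" for p q m
      using that by simp
  qed
qed

lemma aug_gen0: "aug p q gen0 = (\<lambda>t. if t = undefined then 1 else 0)"
  unfolding gen0_def aug_encode[OF idempotent_i(3)] by (auto simp: idempotent_def single_path_def)

lemma aug_gen: "aug p q (gen g) = 0"
  unfolding gen_def aug_encode[OF zero_mem(2)] by auto

text \<open>Send \<open>gen0\<close> to a cocycle of \<open>X\<close> over the unit of the line and
  the other generators to 0. The failure to commute with the differentials is closed, killed by
  \<open>s\<close> and zero at \<open>gen0\<close>; \<open>hom_diff_lift\<close> with
  \<open>k = 0\<close> and initial value 0 writes it as the differential of a map killed by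
  \<open>s\<close>, which is subtracted.\<close>

lemma lift_exists:
  assumes X: "continuous_dg_module alg X" and s: "quasi_iso alg X line s"
  obtains u where "dg_hom alg cone X u" "\<And>p q m. m \<in> mcomp cone p q \<Longrightarrow> s p q (u p q m) = aug p q m"
proof -
  interpret X: continuous_dg_module alg X by fact
  note C = continuous_dg_module_cone
  interpret C: continuous_dg_module alg cone by (rule C)
  note s0 = quasi_isoD(2)[OF s]
  have adiff: "x \<in> acomp alg a b \<Longrightarrow> adiff alg x \<in> acomp alg (a + 1) b" for x a b
    by (simp add: diff_part)
  have idem: "idempotent i \<in> acomp alg 0 0" using i_vert by (simp add: idempotent_part)
  have zero_X: "0 \<in> mcomp X p q" for p q by (rule fscale.subspace_0[OF X.comp_subspace])
  let ?n = "\<lambda>t. if t = undefined then 1 else (0 :: complex)"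
  have "?n \<in> cocycles line 0 0" by (simp add: cocycles_def)
  with s obtain x0 where x0: "x0 \<in> cocycles X 0 0" "?n - s 0 0 x0 \<in> coboundaries line 0 0"
    unfolding quasi_iso_def by blast
  then have x0': "x0 \<in> mcomp X 0 0" "mdiff X 0 0 x0 = 0" "s 0 0 x0 = ?n"
    by (simp_all add: cocycles_def line_coboundaries)
  define u where "u = extend X 0 x0 (\<lambda>_. 0)"
  have u: "graded_hom alg 0 cone X u" unfolding u_def by (rule graded_hom_extend[OF X x0'(1) zero_X])
  have u0: "u p q gen0 = mact X 0 0 x0 (idempotent i)" for p q
    unfolding u_def by (rule extend_gen0[OF X x0'(1) zero_X])
  have ug: "u p q (gen g) = 0" if g: "g \<in> incoming" for p q g
  proof -
    have "idempotent (tail G g) \<in> acomp alg 0 0" using tail_idempotent[OF g] by simp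
    from linear_map_on_0[OF X.act_linear_left[OF this] X.comp_subspace] show ?thesis
      unfolding u_def using extend_gen[OF X x0'(1) zero_X g] by simp
  qed
  have su: "s p q (u p q m) = aug p q m" if m: "m \<in> mcomp cone p q" for p q m
  proof -
    have "graded_hom alg 0 cone line (\<lambda>p q m. s p q (u p q m))"
      using graded_hom_compose[OF u s0] by simp
    moreover have "graded_hom alg 0 cone line aug" by (rule quasi_isoD(2)[OF aug_quasi_iso])
    moreover have "s 0 0 (mact X 0 0 x0 (idempotent i)) = mact line 0 0 (s 0 0 x0) (idempotent i)"
      by (rule graded_homD(2)[OF s0 x0'(1) idem]) simp_all
    then have "s 0 0 (u 0 0 gen0) = aug 0 0 gen0"
      unfolding u0 aug_gen0 x0'(3) by (simp add: idempotent_def single_path_def)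
    moreover have "s (cd g - 1) (idg g) (u (cd g - 1) (idg g) (gen g)) = aug (cd g - 1) (idg g) (gen g)"
      if "g \<in> incoming" for g
      unfolding ug[OF that] aug_gen by (rule linear_map_on_0[OF graded_homD(1)[OF s0 refl] X.comp_subspace])
    ultimately show ?thesis
      using hom_eqI[OF continuous_dg_module_line _ _ _ _ m, of 0 "\<lambda>p q m. s p q (u p q m)" aug] by simp
  qed
  define c where "c = hom_diff 0 cone X u"
  have c: "graded_hom alg (0 + 1) cone X c"
    unfolding c_def by (rule graded_hom_hom_diff[OF C X adiff u])
  have closed: "hom_diff (0 + 1) cone X c p q m = 0" if "m \<in> mcomp cone p q" for p q m
    unfolding c_def by (rule hom_diff_hom_diff[OF C X u that])
  have sc: "s (p + (0 + 1)) q (c p q m) = 0" if m: "m \<in> mcomp cone p q" for p q m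
  proof -
    have um: "u p q m \<in> mcomp X p q" using graded_homD(4)[OF u m, of p] by simp
    have dm: "mdiff cone p q m \<in> mcomp cone (p + 1) q" by (rule C.diff_mem[OF m refl])
    have udm: "u (p + 1) q (mdiff cone p q m) \<in> mcomp X (p + 1) q" using graded_homD(4)[OF u dm, of "p + 1"] by simp
    have lin: "linear_map_on (mcomp X (p + 1) q) (mcomp line (p + 1) q) (s (p + 1) q)"
      by (rule graded_homD(1)[OF s0]) simp
    have "aug (p + 1) q (mdiff cone p q m) = 0"
      using quasi_isoD(3)[OF aug_quasi_iso m] by simp
    then show ?thesis
      using linear_map_on_diff[OF lin X.comp_subspace X.diff_mem[OF um refl] udm] quasi_isoD(3)[OF s um] su[OF dm]
      by (simp add: c_def hom_diff_def)
  qed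
  have c0: "mdiff X 0 0 0 = c 0 0 gen0"
  proof -
    have "mdiff X 0 0 (mact X 0 0 x0 (idempotent i)) =
        mact X 1 0 (mdiff X 0 0 x0) (idempotent i) + fscale (parity_sign 0) (mact X 0 0 x0 (adiff alg (idempotent i)))"
      by (rule X.leibniz'[OF x0'(1) idem]) simp_all
    moreover have "mact X 0 0 x0 0 = 0"
      using linear_map_on_0[OF X.act_linear_right[OF x0'(1), of 0 0]] bidegree_part_subspace[of G cd idg 0 0] by simp
    moreover have "mact X 1 0 0 (idempotent i) = 0"
      by (rule linear_map_on_0[OF X.act_linear_left[OF idem] X.comp_subspace])
    moreover have "u 1 0 0 = 0"
      by (rule linear_map_on_0[OF graded_homD(1)[OF u refl] C.comp_subspace])
    moreover have "mdiff X 0 0 0 = 0"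
      by (rule linear_map_on_0[OF X.diff_linear X.comp_subspace])
    ultimately show ?thesis
      by (simp add: c_def hom_diff_def u0 mdiff_gen0 x0'(2))
  qed
  have s00: "s 0 0 0 = 0"
    by (rule linear_map_on_0[OF graded_homD(1)[OF s0 refl] X.comp_subspace])
  obtain h where h: "graded_hom alg 0 cone X h"
    and hd: "\<And>p q m. m \<in> mcomp cone p q \<Longrightarrow> hom_diff 0 cone X h p q m = c p q m"
    and sh: "\<And>p q m. m \<in> mcomp cone p q \<Longrightarrow> s (p + 0) q (h p q m) = 0"
    using hom_diff_lift[OF X s order_refl c closed sc zero_X c0 s00] by blast
  show ?thesis
  proof (rule that)
    show "dg_hom alg cone X (\<lambda>p q m. u p q m - h p q m)"
      unfolding dg_hom_iff_hom_diff
      using graded_hom_diff[OF C X u h] hom_diff_diff[OF X u h] hd by (simp add: c_def)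
    fix p q m assume m: "m \<in> mcomp cone p q"
    have "s p q (u p q m - h p q m) = s p q (u p q m) - s p q (h p q m)"
      using graded_homD(4)[OF u m, of p] graded_homD(4)[OF h m, of p]
      by (intro linear_map_on_diff[OF graded_homD(1)[OF s0 refl] X.comp_subspace]) simp_all
    then show "s p q (u p q m - h p q m) = aug p q m"
      using su[OF m] sh[OF m] by simp
  qed
qed

text \<open>The difference is closed and killed by \<open>s\<close>, so \<open>hom_diff_lift\<close>
  applies with \<open>k = -1\<close>. Its initial value is a primitive of the difference at
  \<open>gen0\<close>, found by exactness, and \<open>s\<close> kills it because the line is zero in
  degree -1.\<close>

lemma lift_unique:
  assumes X: "continuous_dg_module alg X" and s: "quasi_iso alg X line s"
    and u: "dg_hom alg cone X u" and v: "dg_hom alg cone X v"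
    and eq: "\<And>p q m. m \<in> mcomp cone p q \<Longrightarrow> s p q (u p q m) = s p q (v p q m)"
  shows "homotopic alg cone X u v"
proof -
  interpret X: continuous_dg_module alg X by fact
  note C = continuous_dg_module_cone
  note s0 = quasi_isoD(2)[OF s]
  have u0: "graded_hom alg 0 cone X u" and v0: "graded_hom alg 0 cone X v" using u v unfolding dg_hom_def by auto
  define c where "c = (\<lambda>p q m. u p q m - v p q m)"
  have c: "graded_hom alg 0 cone X c" unfolding c_def by (rule graded_hom_diff[OF C X u0 v0])
  have closed: "hom_diff 0 cone X c p q m = 0" if m: "m \<in> mcomp cone p q" for p q m
    using u v m unfolding c_def hom_diff_diff[OF X u0 v0 m] dg_hom_iff_hom_diff by simp
  have sc: "s p q (c p q m) = 0" if m: "m \<in> mcomp cone p q" for p q m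
  proof -
    have "s p q (u p q m - v p q m) = s p q (u p q m) - s p q (v p q m)"
      using graded_homD(4)[OF u0 m, of p] graded_homD(4)[OF v0 m, of p]
      by (intro linear_map_on_diff[OF graded_homD(1)[OF s0 refl] X.comp_subspace]) simp_all
    then show ?thesis using eq[OF m] by (simp add: c_def)
  qed
  have "c 1 0 0 = 0"
    by (rule linear_map_on_0[OF graded_homD(1)[OF c refl] continuous_dg_module.comp_subspace[OF C]])
  then have "mdiff X 0 0 (c 0 0 gen0) = 0"
    using closed[OF gen0_mem] by (simp add: hom_diff_def mdiff_gen0)
  then obtain h0 where h0: "h0 \<in> mcomp X (0 - 1) 0" "mdiff X (0 - 1) 0 h0 = c 0 0 gen0"
    using graded_homD(4)[OF c gen0_mem, of 0] sc[OF gen0_mem]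
    by (elim exact_of_quasi_iso[OF s, rotated -1]) auto
  have "s (- 1) 0 h0 \<in> mcomp line (- 1) 0"
    using h0(1) by (intro graded_homD(4)[OF s0]) auto
  then have s_h0: "s (- 1) 0 h0 = 0" by simp
  obtain h where "graded_hom alg (- 1) cone X h"
    "\<And>p q m. m \<in> mcomp cone p q \<Longrightarrow> hom_diff (- 1) cone X h p q m = c p q m"
  proof (rule hom_diff_lift[OF X s, of "- 1" c h0])
    show "graded_hom alg (- 1 + 1) cone X c" using c by simp
    show "hom_diff (- 1 + 1) cone X c p q m = 0" if "m \<in> mcomp cone p q" for p q m using closed[OF that] by simp
    show "s (p + (- 1 + 1)) q (c p q m) = 0" if "m \<in> mcomp cone p q" for p q m using sc[OF that] by simp
  qed (use h0 s_h0 in simp_all)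
  then show ?thesis unfolding homotopic_iff_hom_diff c_def by auto
qed

text \<open>A homotopy into the line has degree -1 and vanishes by
  \<open>line_hom_zero\<close>.\<close>

lemma homotopic_line_eq:
  assumes "homotopic alg cone line f g" and m: "m \<in> mcomp cone p q"
  shows "f p q m = g p q m"
proof -
  interpret C: continuous_dg_module alg cone by (rule continuous_dg_module_cone)
  from assms(1) obtain h where h: "graded_hom alg (- 1) cone line h" and
    e: "\<And>p q m. m \<in> mcomp cone p q \<Longrightarrow> f p q m - g p q m = mdiff line (p - 1) q (h p q m) + h (p + 1) q (mdiff cone p q m)"
    unfolding homotopic_def by blast
  have "h 0 0 gen0 \<in> mcomp line (- 1) 0" by (rule graded_homD(4)[OF h gen0_mem]) simp
  then have "h 0 0 gen0 = 0" by simp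
  from line_hom_zero[OF h _ this C.diff_mem[OF m refl]] e[OF m] show ?thesis by simp
qed

text \<open>From right to left the cone itself serves as the dominating roof. Conversely, lifting
  \<open>aug\<close> through a dominating \<open>Y\<close> gives maps from the cone to
  \<open>X\<close> and \<open>X'\<close>, and uniqueness of lifts compares them with
  \<open>u\<close> and \<open>u'\<close>.\<close>

lemma roof_rel_iff:
  assumes N: "continuous_dg_module alg N"
    and r: "(X, s, f) \<in> roofs alg line N" and r': "(X', s', f') \<in> roofs alg line N"
    and u: "dg_hom alg cone X u" "\<And>p q m. m \<in> mcomp cone p q \<Longrightarrow> s p q (u p q m) = aug p q m"
    and u': "dg_hom alg cone X' u'" "\<And>p q m. m \<in> mcomp cone p q \<Longrightarrow> s' p q (u' p q m) = aug p q m"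
  shows "((X, s, f), (X', s', f')) \<in> roof_rel alg line N \<longleftrightarrow>
    homotopic alg cone N (graded_comp f u) (graded_comp f' u')"
proof
  note C = continuous_dg_module_cone
  have X: "continuous_dg_module alg X" "quasi_iso alg X line s" "dg_hom alg X N f"
    and X': "continuous_dg_module alg X'" "quasi_iso alg X' line s'" "dg_hom alg X' N f'"
    using r r' by (auto simp: roofs_def)
  {
    assume h: "homotopic alg cone N (graded_comp f u) (graded_comp f' u')"
    have "quasi_iso alg cone line (graded_comp s u)"
      by (rule quasi_iso_cong[OF aug_quasi_iso dg_hom_compose[OF u(1) quasi_isoD(1)[OF X(2)]]])
        (simp add: graded_comp_def u(2))
    moreover have "homotopic alg cone line (graded_comp s u) (graded_comp s' u')"
      by (rule homotopic_refl[OF C continuous_dg_module_line]) (simp add: graded_comp_def u(2) u'(2))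
    ultimately show "((X, s, f), (X', s', f')) \<in> roof_rel alg line N"
      unfolding roof_rel_def using r r' C u(1) u'(1) h by blast
  }
  assume "((X, s, f), (X', s', f')) \<in> roof_rel alg line N"
  then obtain Y w w' where Y: "continuous_dg_module alg Y" "dg_hom alg Y X w" "dg_hom alg Y X' w'"
    "quasi_iso alg Y line (graded_comp s w)"
    "homotopic alg Y line (graded_comp s w) (graded_comp s' w')"
    "homotopic alg Y N (graded_comp f w) (graded_comp f' w')"
    unfolding roof_rel_def by blast
  from lift_exists[OF Y(1) Y(4)] obtain v where v: "dg_hom alg cone Y v"
    "\<And>p q m. m \<in> mcomp cone p q \<Longrightarrow> graded_comp s w p q (v p q m) = aug p q m" by blast
  have wv: "dg_hom alg cone X (graded_comp w v)" and wv': "dg_hom alg cone X' (graded_comp w' v)"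
    by (rule dg_hom_compose[OF v(1) Y(2)], rule dg_hom_compose[OF v(1) Y(3)])
  have gh: "graded_hom alg 0 cone M k" if "dg_hom alg cone M k" for M k
    using that unfolding dg_hom_def by blast
  have "homotopic alg cone X u (graded_comp w v)"
    using v(2) u(2) by (intro lift_unique[OF X(1,2) u(1) wv]) (simp add: graded_comp_def)
  then have 1: "homotopic alg cone N (graded_comp f u) (graded_comp f (graded_comp w v))"
    by (rule homotopic_comp_left[OF _ X(3) gh[OF u(1)] gh[OF wv] C X(1)])
  \<comment> \<open>The two left legs agree on \<open>Y\<close> only up to homotopy; restricted to
    the cone they agree strictly, which is what uniqueness of lifts to \<open>X'\<close> asks
    for.\<close>
  have "homotopic alg cone line (graded_comp (graded_comp s w) v) (graded_comp (graded_comp s' w') v)"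
    by (rule homotopic_comp_right[OF Y(5) v(1)])
  from homotopic_line_eq[OF this] v(2)
  have "s' p q (graded_comp w' v p q m) = aug p q m" if "m \<in> mcomp cone p q" for p q m
    using that by (simp add: graded_comp_def)
  then have "homotopic alg cone X' (graded_comp w' v) u'"
    using u'(2) by (intro lift_unique[OF X'(1,2) wv' u'(1)]) simp
  then have 2: "homotopic alg cone N (graded_comp f' (graded_comp w' v)) (graded_comp f' u')"
    by (rule homotopic_comp_left[OF _ X'(3) gh[OF wv'] gh[OF u'(1)] C X'(1)])
  have "homotopic alg cone N (graded_comp (graded_comp f w) v) (graded_comp (graded_comp f' w') v)"
    by (rule homotopic_comp_right[OF Y(6) v(1)])
  then have "homotopic alg cone N (graded_comp f (graded_comp w v)) (graded_comp f' (graded_comp w' v))"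
    by (simp only: graded_comp_assoc)
  from homotopic_trans[OF C N homotopic_trans[OF C N 1 this] 2]
  show "homotopic alg cone N (graded_comp f u) (graded_comp f' u')" .
qed

end


section \<open>Dimensions of spaces of cochains\<close>

text \<open>A bridge from concrete subspaces with scaling \<open>fscale\<close> to the record-based
  vector spaces in which the dimension of a derived Hom space is measured.\<close>

definition subspace_module :: "('x \<Rightarrow> complex) set \<Rightarrow> (complex, 'x \<Rightarrow> complex) module"
  where "subspace_module S = \<lparr>carrier = S, mult = undefined, one = undefined, zero = 0, add = (+), smult = fscale\<rparr>"

lemma subspace_module_simps [simp]:
  "carrier (subspace_module S) = S" "zero (subspace_module S) = 0"
  "add (subspace_module S) = (+)" "smult (subspace_module S) = fscale"
  "subspace_module S\<lparr>carrier := T\<rparr> = subspace_module T"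
  by (simp_all add: subspace_module_def)

lemma vectorspace_subspace_module:
  assumes "fscale.subspace S"
  shows "vectorspace class_ring (subspace_module S)"
proof (rule vs_criteria)
  show "field (class_ring :: complex ring)" by (rule class_field)
  have "v + - v = 0" "- v \<in> S" if "v \<in> S" for v
    using that assms by (simp_all add: fscale.subspace_neg)
  then show "\<forall>v\<in>carrier (subspace_module S). \<exists>w\<in>carrier (subspace_module S).
      v \<oplus>\<^bsub>subspace_module S\<^esub> w = \<zero>\<^bsub>subspace_module S\<^esub>"
    by (simp only: subspace_module_simps) blast
qed (use assms in \<open>auto simp: fscale.subspace_0 fscale.subspace_add fscale.subspace_scale fscale_add
    add_ac fun_eq_iff algebra_simps\<close>)

lemma subspace_module_basis:
  assumes B: "finite B" "fscale.independent B" and S: "fscale.span B = S"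
  shows "vectorspace.fin_dim class_ring (subspace_module S)"
    and "vectorspace.dim class_ring (subspace_module S) = card B"
proof -
  have sub: "fscale.subspace S" using S fscale.subspace_span by blast
  interpret V: vectorspace class_ring "subspace_module S" by (rule vectorspace_subspace_module[OF sub])
  have BS: "B \<subseteq> S" using S fscale.span_superset by blast
  have finsum: "finsum (subspace_module S) f A = sum f A" if "finite A" "f \<in> A \<rightarrow> S" for f and A :: "('a \<Rightarrow> complex) set"
    using that
  proof (induction A rule: finite_induct)
    case empty
    show ?case by (simp only: V.finsum_empty subspace_module_simps sum.empty)
  next
    case (insert a A)
    then have "finsum (subspace_module S) f A = sum f A" by auto
    moreover have "finsum (subspace_module S) f (insert a A) =
        f a \<oplus>\<^bsub>subspace_module S\<^esub> finsum (subspace_module S) f A"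
      using insert by (intro V.finsum_insert) auto
    ultimately show ?case using insert by (simp only: subspace_module_simps sum.insert not_False_eq_True)
  qed
  have lincomb: "V.lincomb a A = (\<Sum>v\<in>A. fscale (a v) v)" if "finite A" "A \<subseteq> S" for a A
    unfolding V.lincomb_def subspace_module_simps
    using that sub by (intro finsum) (auto intro: fscale.subspace_scale)
  have "V.gen_set B"
  proof -
    have "v \<in> V.span B" if v: "v \<in> S" for v
    proof -
      from v S B(1) obtain a where "v = (\<Sum>w\<in>B. fscale (a w) w)"
        by (auto simp: fscale.span_finite)
      then have "v = V.lincomb a B" using lincomb[OF B(1) BS] by simp
      then show ?thesis unfolding V.span_def using B(1) by auto
    qed
    moreover have "V.span B \<subseteq> S" using V.span_is_subset2[of B] BS by simp
    ultimately show ?thesis by auto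
  qed
  moreover have "V.lin_indpt B"
  proof
    assume "V.lin_dep B"
    then obtain A a v where A: "finite A" "A \<subseteq> B" "V.lincomb a A = 0" "v \<in> A" "a v \<noteq> (0 :: complex)"
      unfolding V.lin_dep_def by auto
    then have "(\<Sum>v\<in>A. fscale (a v) v) = 0" using lincomb[OF A(1)] BS by auto
    then have "fscale.dependent A" using A by (auto simp: fscale.dependent_finite)
    then show False using B(2) A(2) fscale.dependent_mono by blast
  qed
  ultimately have "V.basis B" unfolding V.basis_def using BS by simp
  then show "V.dim = card B" using B(1) by (rule V.dim_basis[rotated])
  show "V.fin_dim" unfolding V.fin_dim_def using \<open>V.gen_set B\<close> BS B(1) by auto
qed

definition unit_fun :: "'x \<Rightarrow> 'x \<Rightarrow> complex" where "unit_fun x = (\<lambda>y. if y = x then 1 else 0)"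

lemma supported_functions_basis:
  assumes F: "finite F"
  shows "fscale.span (unit_fun ` F) = {f. \<forall>x. x \<notin> F \<longrightarrow> f x = 0}"
    and "fscale.independent (unit_fun ` F)" and "card (unit_fun ` F) = card F"
proof -
  have inj: "inj_on unit_fun F" by (auto simp: inj_on_def unit_fun_def fun_eq_iff split: if_splits)
  then show "card (unit_fun ` F) = card F" by (rule card_image)
  have sum: "(\<Sum>v\<in>unit_fun ` F. fscale (u v) v) = (\<lambda>x. if x \<in> F then u (unit_fun x) else 0)" for u
  proof
    fix x
    have "(\<Sum>v\<in>unit_fun ` F. fscale (u v) v) x = (\<Sum>y\<in>F. u (unit_fun y) * unit_fun y x)"
      by (simp add: sum_fun_apply sum.reindex[OF inj])
    also have "\<dots> = (\<Sum>y\<in>F. if y = x then u (unit_fun x) else 0)"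
      by (rule sum.cong) (auto simp: unit_fun_def)
    also have "\<dots> = (if x \<in> F then u (unit_fun x) else 0)"
      using F by (simp add: sum.delta)
    finally show "(\<Sum>v\<in>unit_fun ` F. fscale (u v) v) x = (if x \<in> F then u (unit_fun x) else 0)" .
  qed
  show "fscale.span (unit_fun ` F) = {f. \<forall>x. x \<notin> F \<longrightarrow> f x = 0}"
  proof (intro equalityI subsetI)
    fix f :: "'a \<Rightarrow> complex" assume f: "f \<in> {f. \<forall>x. x \<notin> F \<longrightarrow> f x = 0}"
    have "f = (\<Sum>v\<in>unit_fun ` F. fscale (f (inv_into F unit_fun v)) v)"
      unfolding sum using f by (auto simp: fun_eq_iff inv_into_f_f[OF inj])
    then show "f \<in> fscale.span (unit_fun ` F)"
      using F by (auto simp: fscale.span_finite)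
  next
    fix f :: "'a \<Rightarrow> complex" assume "f \<in> fscale.span (unit_fun ` F)"
    then show "f \<in> {f. \<forall>x. x \<notin> F \<longrightarrow> f x = 0}"
      using F by (auto simp: fscale.span_finite sum)
  qed
  show "fscale.independent (unit_fun ` F)"
  proof
    assume "fscale.dependent (unit_fun ` F)"
    then obtain u x where "x \<in> F" "u (unit_fun x) \<noteq> 0" "(\<Sum>v\<in>unit_fun ` F. fscale (u v) v) = 0"
      using F by (auto simp: fscale.dependent_finite)
    then show False unfolding sum by (auto dest!: fun_cong[of _ _ x])
  qed
qed

lemma subspace_module_fin_dim:
  assumes S: "fscale.subspace S" and F: "finite F" "S \<subseteq> {f. \<forall>x. x \<notin> F \<longrightarrow> f x = 0}"
  shows "vectorspace.fin_dim class_ring (subspace_module S)"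
proof -
  obtain B where B: "B \<subseteq> S" "fscale.independent B" "S \<subseteq> fscale.span B"
    using fscale.maximal_independent_subset by metis
  have "finite B"
    using fscale.independent_span_bound[of "unit_fun ` F" B] F B supported_functions_basis(1)[OF F(1)] by auto
  moreover have "fscale.span B = S"
    using B fscale.span_minimal[OF B(1) S] by blast
  ultimately show ?thesis using subspace_module_basis(1) B(2) by blast
qed

text \<open>The target stays abstract because the lemma serves twice: for a map between spaces of
  coordinates and for a map onto classes of roofs.\<close>

lemma subspace_module_rank_nullity:
  assumes S: "fscale.subspace S" and T: "vectorspace class_ring T" and fin: "vectorspace.fin_dim class_ring (subspace_module S)"
    and f: "f \<in> S \<rightarrow> carrier T" "\<And>x y. x \<in> S \<Longrightarrow> y \<in> S \<Longrightarrow> f (x + y) = f x \<oplus>\<^bsub>T\<^esub> f y"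
      "\<And>c x. x \<in> S \<Longrightarrow> f (fscale c x) = c \<odot>\<^bsub>T\<^esub> f x"
  shows "vectorspace.dim class_ring (T\<lparr>carrier := f ` S\<rparr>) +
      vectorspace.dim class_ring (subspace_module {x \<in> S. f x = \<zero>\<^bsub>T\<^esub>}) =
      vectorspace.dim class_ring (subspace_module S)"
    and "f ` S = carrier T \<Longrightarrow> vectorspace.fin_dim class_ring T"
proof -
  interpret V: vectorspace class_ring "subspace_module S" by (rule vectorspace_subspace_module[OF S])
  interpret W: vectorspace class_ring T by (rule T)
  have "f \<in> module_hom class_ring (subspace_module S) T"
    unfolding module_hom_def using f by auto
  then interpret L: linear_map class_ring "subspace_module S" T f
    by unfold_locales
  show "vectorspace.dim class_ring (T\<lparr>carrier := f ` S\<rparr>) +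
      vectorspace.dim class_ring (subspace_module {x \<in> S. f x = \<zero>\<^bsub>T\<^esub>}) =
      vectorspace.dim class_ring (subspace_module S)"
    using L.rank_nullity[OF fin] unfolding L.im_def L.ker_def by simp
  show "vectorspace.fin_dim class_ring T" if "f ` S = carrier T"
    using L.rank_nullity_main(2)[OF fin] that by simp
qed

section \<open>The complex of maps from the cone to a shifted simple module\<close>

locale line_pair = cone_resolution G cd idg D i enc
  for G :: "('v, 'e) pre_digraph" and cd idg :: "'e \<Rightarrow> int" and D :: "'e \<Rightarrow> ('v, 'e) series"
    and i :: 'v and enc :: "bool \<times> ('v, 'e) path \<Rightarrow> 'u" +
  fixes j :: 'v and r :: int
  assumes j_vert: "j \<in> verts G"
begin

definition target :: "int \<Rightarrow> ('u, ('v, 'e) path) dg_module"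
  where "target p = shift p (- r) (line_module j)"

lemma continuous_dg_module_target: "continuous_dg_module alg (target p)"
  unfolding target_def by (rule continuous_dg_module_shift[OF continuous_dg_module_line_module[OF j_vert]])

lemma target_simps [simp]:
  "mcomp (target p) a b = (if a = - p \<and> b = r then {m. \<forall>t. t \<noteq> undefined \<longrightarrow> m t = 0} else {0})"
  "mdiff (target p) a b m = 0"
  "mact (target p) a b m x = fscale (x (j, [], j)) m"
  by (auto simp: target_def)

text \<open>\<open>None\<close> stands for \<open>gen0\<close> and \<open>Some g\<close> for
  \<open>gen g\<close>, so that the coordinates of a map form one function on a single index
  type.\<close>

definition gens :: "'e option set" where "gens = insert None (Some ` incoming)"
definition deg1 :: "'e option \<Rightarrow> int" where "deg1 c = (case c of None \<Rightarrow> 0 | Some g \<Rightarrow> cd g - 1)"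
definition deg2 :: "'e option \<Rightarrow> int" where "deg2 c = (case c of None \<Rightarrow> 0 | Some g \<Rightarrow> idg g)"
definition vtx :: "'e option \<Rightarrow> 'v" where "vtx c = (case c of None \<Rightarrow> i | Some g \<Rightarrow> tail G g)"
definition elt :: "'e option \<Rightarrow> 'u \<Rightarrow> complex" where "elt c = (case c of None \<Rightarrow> gen0 | Some g \<Rightarrow> gen g)"

lemma gens_simps [simp]:
  "deg1 None = 0" "deg2 None = 0" "vtx None = i" "elt None = gen0"
  "deg1 (Some g) = cd g - 1" "deg2 (Some g) = idg g" "vtx (Some g) = tail G g" "elt (Some g) = gen g"
  "None \<in> gens" "Some g \<in> gens \<longleftrightarrow> g \<in> incoming"
  by (auto simp: deg1_def deg2_def vtx_def elt_def gens_def)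

lemma finite_gens: "finite gens"
  by (simp add: gens_def)

lemma vtx_vert: "c \<in> gens \<Longrightarrow> vtx c \<in> verts G"
  using i_vert by (cases c) (auto simp: incoming_def)

lemma elt_mem: "c \<in> gens \<Longrightarrow> elt c \<in> mcomp cone (deg1 c) (deg2 c)"
  using gen0_mem gen_mem by (cases c) auto

lemma elt_idem: "c \<in> gens \<Longrightarrow> mact cone p q (elt c) (idempotent (vtx c)) = elt c"
  using gen0_idem gen_idem by (cases c) auto

text \<open>The target \<open>S_j[p]\<langle>-r\<rangle>\<close> sits in bidegree
  \<open>(-p, r)\<close>, whence the sign. Differentials preserve the internal degree, so
  \<open>r\<close> is fixed and \<open>p\<close> is the degree of the complex.\<close>

definition gens_at :: "int \<Rightarrow> 'e option set"
  where "gens_at p = {c \<in> gens. vtx c = j \<and> deg1 c = - p \<and> deg2 c = r}"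

lemma finite_gens_at: "finite (gens_at p)"
  using finite_gens by (simp add: gens_at_def)

definition cochains :: "int \<Rightarrow> ('e option \<Rightarrow> complex) set"
  where "cochains p = {v. \<forall>c. c \<notin> gens_at p \<longrightarrow> v c = 0}"

lemma cochains_subspace: "fscale.subspace (cochains p)"
  by (simp add: cochains_def fscale.subspace_def)

text \<open>
  A graded homomorphism from the cone is determined by its values on the generators. Its value at
  a generator can be nonzero only if the generator sits at \<open>j\<close> and has the right bidegree.
\<close>

definition coords :: "'u graded_map \<Rightarrow> 'e option \<Rightarrow> complex"
  where "coords f = (\<lambda>c. if c \<in> gens then f (deg1 c) (deg2 c) (elt c) undefined else 0)"

lemma idempotent_coeff: "idempotent k (j, [], j) = (if k = j then 1 else 0)"
  by (simp add: idempotent_def single_path_def)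

lemma coords_value:
  assumes f: "graded_hom alg k cone (target p) f" and c: "c \<in> gens"
  shows "f (deg1 c) (deg2 c) (elt c) = (\<lambda>t. if t = undefined then coords f c else 0)"
  using graded_homD(4)[OF f elt_mem[OF c] refl] c by (auto simp: coords_def fun_eq_iff split: if_splits)

lemma coords_mem:
  assumes f: "graded_hom alg k cone (target p) f"
  shows "coords f \<in> cochains (p + k)"
proof -
  have "coords f c = 0" if "c \<in> gens" "c \<notin> gens_at (p + k)" for c
  proof (cases "vtx c = j")
    case True
    then have "deg1 c + k \<noteq> - p \<or> deg2 c \<noteq> r" using that by (auto simp: gens_at_def)
    then have "f (deg1 c) (deg2 c) (elt c) = 0"
      using graded_homD(4)[OF f elt_mem[OF that(1)] refl] by (auto split: if_splits)
    then show ?thesis by (simp add: coords_def)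
  next
    case False
    have "idempotent (vtx c) \<in> acomp alg 0 0" using vtx_vert[OF that(1)] by (simp add: idempotent_part)
    then have act: "f (deg1 c) (deg2 c) (mact cone (deg1 c) (deg2 c) (elt c) (idempotent (vtx c))) =
        mact (target p) (deg1 c + k) (deg2 c) (f (deg1 c) (deg2 c) (elt c)) (idempotent (vtx c))"
      by (rule graded_homD(2)[OF f elt_mem[OF that(1)]]) simp_all
    note act[unfolded elt_idem[OF that(1)] target_simps]
    also have "idempotent (vtx c) (j, [], j) = 0"
      using False by (simp add: idempotent_coeff)
    finally have "f (deg1 c) (deg2 c) (elt c) = 0" by (simp only: fscale_simps)
    then show ?thesis by (simp add: coords_def)
  qed
  moreover have "coords f c = 0" if "c \<notin> gens" for c using that by (simp add: coords_def)
  ultimately show ?thesis unfolding cochains_def by blast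
qed

lemma coords_inj:
  assumes f: "graded_hom alg k cone (target p) f" and f': "graded_hom alg k cone (target p) f'"
    and eq: "coords f = coords f'" and m: "m \<in> mcomp cone a b"
  shows "f a b m = f' a b m"
proof (rule hom_eqI[OF continuous_dg_module_target f f' _ _ m])
  show "f 0 0 gen0 = f' 0 0 gen0"
    using coords_value[OF f, of None] coords_value[OF f', of None] unfolding eq by simp
  show "f (cd g - 1) (idg g) (gen g) = f' (cd g - 1) (idg g) (gen g)" if "g \<in> incoming" for g
    using coords_value[OF f, of "Some g"] coords_value[OF f', of "Some g"] that unfolding eq by simp
qed

lemma coords_surj:
  assumes v: "v \<in> cochains (p + k)"
  obtains f where "graded_hom alg k cone (target p) f" "coords f = v"
proof -
  let ?w = "\<lambda>c t. if t = undefined then v c else 0"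
  have mem: "?w c \<in> mcomp (target p) (deg1 c + k) (deg2 c)" for c
    using v by (auto simp: cochains_def gens_at_def fun_eq_iff)
  have m0: "?w None \<in> mcomp (target p) k 0" using mem[of None] by simp
  have m1: "?w (Some g) \<in> mcomp (target p) (cd g - 1 + k) (idg g)" for g using mem[of "Some g"] by simp
  let ?f = "extend (target p) k (?w None) (\<lambda>g. ?w (Some g))"
  note T = continuous_dg_module_target
  have zero: "v c = 0" if "vtx c \<noteq> j \<or> c \<notin> gens" for c
    using v that by (auto simp: cochains_def gens_at_def)
  have f: "graded_hom alg k cone (target p) ?f" by (rule graded_hom_extend[OF T m0 m1])
  have "coords ?f c = v c" for c
  proof (cases c)
    case None
    then have "coords ?f c = (idempotent i :: ('v, 'e) series) (j, [], j) * v None"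
      using extend_gen0[OF T m0 m1, of 0 0] by (simp add: coords_def)
    also have "\<dots> = v None"
      using zero[of None] by (cases "i = j") (simp_all add: idempotent_coeff)
    finally show ?thesis using None by simp
  next
    case (Some g)
    show ?thesis
    proof (cases "g \<in> incoming")
      case True
      then have "coords ?f c = (idempotent (tail G g) :: ('v, 'e) series) (j, [], j) * v (Some g)"
        using extend_gen[OF T m0 m1, of g "cd g - 1" "idg g"] Some by (simp add: coords_def)
      also have "\<dots> = v (Some g)"
        using zero[of "Some g"] by (cases "tail G g = j") (simp_all add: idempotent_coeff)
      finally show ?thesis using Some by simp
    next
      case False
      then show ?thesis using zero[of "Some g"] Some by (simp add: coords_def)
    qed
  qed
  then show ?thesis using that[OF f] by blast
qed

text \<open>The dual of the linear part of \<open>D\<close>: the factor is the coefficient in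
  \<open>D g\<close> of the arrow \<open>b\<close>, if \<open>b\<close> starts at \<open>j\<close>.
  The value at \<open>None\<close> never enters the sum, since the first entry of
  \<open>mdiff_gen\<close> is an arrow, with zero coefficient at trivial paths.\<close>

definition cobd :: "('e option \<Rightarrow> complex) \<Rightarrow> 'e option \<Rightarrow> complex"
  where "cobd v = (\<lambda>c. case c of None \<Rightarrow> 0 | Some g \<Rightarrow>
    if g \<in> incoming then \<Sum>b\<in>incoming. left_div G b (D g) (j, [], j) * v (Some b) else 0)"

lemma cobd_linear: "cobd (v + w) = cobd v + cobd w" "cobd (fscale c v) = fscale c (cobd v)"
  by (auto simp: fun_eq_iff cobd_def distrib_left sum.distrib sum_distrib_left mult.left_commute split: option.splits)

lemma cobd_0: "cobd 0 = 0"
  by (auto simp: fun_eq_iff cobd_def split: option.splits)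

text \<open>The target has zero differential, so only composition with the differential of the cone
  remains; its sign in \<open>hom_diff\<close> cancels the one in front of \<open>D g\<close> in
  \<open>mdiff_gen\<close>.\<close>

lemma coords_hom_diff:
  assumes f: "graded_hom alg k cone (target p) f"
  shows "coords (hom_diff k cone (target p) f) = fscale (parity_sign k) (cobd (coords f))"
proof
  fix c
  show "coords (hom_diff k cone (target p) f) c = fscale (parity_sign k) (cobd (coords f)) c"
  proof (cases c)
    case None
    have "f (0 + 1) 0 0 = 0"
      by (rule linear_map_on_0[OF graded_homD(1)[OF f refl] continuous_dg_module.comp_subspace[OF continuous_dg_module_cone]])
    then show ?thesis using None by (simp add: coords_def hom_diff_def mdiff_gen0 cobd_def)
  next
    case (Some g)
    show ?thesis
    proof (cases "g \<in> incoming")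
      case True
      have arc: "single_path (arc_path G g) \<in> ideal_part (cd g) (idg g)" by (rule single_arc(1)[OF True])
      have D: "- D g \<in> ideal_part (cd g + 1) (idg g)" using D_ideal_part(1)[OF True] by simp
      have "f (cd g) (idg g) (mdiff cone (cd g - 1) (idg g) (gen g)) undefined =
          (\<Sum>b\<in>incoming. left_div G b (- D g) (j, [], j) * f (cd b - 1) (idg b) (gen b) undefined)"
        unfolding mdiff_gen[OF True]
          hom_expand[OF continuous_dg_module_target f arc D D_ideal_part(2)[OF True]]
        by (simp add: sum_fun_apply single_path_def arc_path_def)
      also have "\<dots> = (\<Sum>b\<in>incoming. - (left_div G b (D g) (j, [], j) * coords f (Some b)))"
        by (rule sum.cong) (simp_all add: coords_def)
      finally show ?thesis
        using True Some by (simp add: coords_def hom_diff_def cobd_def sum_negf)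
    next
      case False
      then show ?thesis using Some by (simp add: coords_def cobd_def)
    qed
  qed
qed

lemma adiff_mem: "x \<in> acomp alg a b \<Longrightarrow> adiff alg x \<in> acomp alg (a + 1) b"
  by (simp add: diff_part)

lemma cobd_mem: "v \<in> cochains p \<Longrightarrow> cobd v \<in> cochains (p + 1)"
proof -
  assume "v \<in> cochains p"
  then obtain f where f: "graded_hom alg 0 cone (target p) f" "coords f = v"
    using coords_surj[of v p 0] by auto
  have "graded_hom alg (0 + 1) cone (target p) (hom_diff 0 cone (target p) f)"
    by (rule graded_hom_hom_diff[OF continuous_dg_module_cone continuous_dg_module_target adiff_mem f(1)])
  from coords_mem[OF this] show ?thesis by (simp add: coords_hom_diff[OF f(1)] f(2))
qed

text \<open>Transported from the Hom complex: a cochain is the coordinate vector of some graded map,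
  and the differential of that complex squares to zero.\<close>

lemma cobd_cobd: "v \<in> cochains p \<Longrightarrow> cobd (cobd v) = 0"
proof -
  assume "v \<in> cochains p"
  then obtain f where f: "graded_hom alg 0 cone (target p) f" "coords f = v"
    using coords_surj[of v p 0] by auto
  have h: "graded_hom alg (0 + 1) cone (target p) (hom_diff 0 cone (target p) f)"
    by (rule graded_hom_hom_diff[OF continuous_dg_module_cone continuous_dg_module_target adiff_mem f(1)])
  have "coords (hom_diff (0 + 1) cone (target p) (hom_diff 0 cone (target p) f)) c = 0" for c
    using hom_diff_hom_diff[OF continuous_dg_module_cone continuous_dg_module_target f(1) elt_mem]
    by (simp add: coords_def)
  then have "fscale (- 1) (cobd (cobd v)) = 0"
    using coords_hom_diff[OF h] coords_hom_diff[OF f(1)] f(2) by (simp add: fun_eq_iff parity_sign_def)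
  then show ?thesis by simp
qed

definition ext_cocycles :: "int \<Rightarrow> ('e option \<Rightarrow> complex) set"
  where "ext_cocycles p = {v \<in> cochains p. cobd v = 0}"

definition ext_coboundaries :: "int \<Rightarrow> ('e option \<Rightarrow> complex) set"
  where "ext_coboundaries p = cobd ` cochains (p - 1)"

lemma ext_subspaces: "fscale.subspace (ext_cocycles p)" "fscale.subspace (ext_coboundaries p)"
proof -
  show "fscale.subspace (ext_cocycles p)"
    using cochains_subspace[of p] by (simp add: ext_cocycles_def fscale.subspace_def cobd_linear cobd_0)
  note sub = cochains_subspace[of "p - 1"]
  show "fscale.subspace (ext_coboundaries p)"
    unfolding fscale.subspace_def ext_coboundaries_def
  proof (intro conjI ballI allI)
    show "0 \<in> cobd ` cochains (p - 1)"
      using fscale.subspace_0[OF sub] by (intro image_eqI[of _ _ 0]) (simp_all only: cobd_0)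
  next
    fix x y assume "x \<in> cobd ` cochains (p - 1)" "y \<in> cobd ` cochains (p - 1)"
    then obtain v w where "v \<in> cochains (p - 1)" "w \<in> cochains (p - 1)" "x = cobd v" "y = cobd w" by blast
    then show "x + y \<in> cobd ` cochains (p - 1)"
      using fscale.subspace_add[OF sub] by (intro image_eqI[of _ _ "v + w"]) (simp_all only: cobd_linear)
  next
    fix x c assume "x \<in> cobd ` cochains (p - 1)"
    then obtain v where "v \<in> cochains (p - 1)" "x = cobd v" by blast
    then show "fscale c x \<in> cobd ` cochains (p - 1)"
      using fscale.subspace_scale[OF sub] by (intro image_eqI[of _ _ "fscale c v"]) (simp_all only: cobd_linear)
  qed
qed

lemma ext_coboundaries_subset: "ext_coboundaries p \<subseteq> ext_cocycles p"
  unfolding ext_coboundaries_def ext_cocycles_def using cobd_mem[of _ "p - 1"] cobd_cobd by auto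

lemma dg_hom_iff_coords:
  assumes f: "graded_hom alg 0 cone (target p) f"
  shows "dg_hom alg cone (target p) f \<longleftrightarrow> coords f \<in> ext_cocycles p"
proof -
  note C = continuous_dg_module_cone and T = continuous_dg_module_target
  have h: "graded_hom alg (0 + 1) cone (target p) (hom_diff 0 cone (target p) f)"
    by (rule graded_hom_hom_diff[OF C T adiff_mem f])
  have "(\<forall>a b. \<forall>m\<in>mcomp cone a b. hom_diff 0 cone (target p) f a b m = 0) \<longleftrightarrow> cobd (coords f) = 0"
  proof
    assume "\<forall>a b. \<forall>m\<in>mcomp cone a b. hom_diff 0 cone (target p) f a b m = 0"
    then have "coords (hom_diff 0 cone (target p) f) = 0"
      using elt_mem by (auto simp: coords_def fun_eq_iff)
    then show "cobd (coords f) = 0" by (simp add: coords_hom_diff[OF f])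
  next
    assume "cobd (coords f) = 0"
    moreover have "coords (\<lambda>_ _ _. 0) = 0" by (simp add: coords_def fun_eq_iff)
    ultimately have "coords (hom_diff 0 cone (target p) f) = coords (\<lambda>_ _ _. 0)"
      by (simp only: coords_hom_diff[OF f] fscale_simps)
    from coords_inj[OF h graded_hom_zero[OF C T] this]
    show "\<forall>a b. \<forall>m\<in>mcomp cone a b. hom_diff 0 cone (target p) f a b m = 0" by blast
  qed
  then show ?thesis
    using f coords_mem[OF f] by (simp add: dg_hom_iff_hom_diff ext_cocycles_def)
qed

lemma coords_linear:
  "coords (\<lambda>a b m. f a b m + g a b m) = coords f + coords g"
  "coords (\<lambda>a b m. f a b m - g a b m) = coords f - coords g"
  "coords (\<lambda>a b m. fscale c (f a b m)) = fscale c (coords f)"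
  by (auto simp: coords_def fun_eq_iff)

lemma homotopic_iff_coords:
  assumes f: "graded_hom alg 0 cone (target p) f" and g: "graded_hom alg 0 cone (target p) g"
  shows "homotopic alg cone (target p) f g \<longleftrightarrow> coords f - coords g \<in> ext_coboundaries p"
proof
  note C = continuous_dg_module_cone and T = continuous_dg_module_target
  note fg = graded_hom_diff[OF C T f g]
  {
    assume "homotopic alg cone (target p) f g"
    then obtain h where h: "graded_hom alg (- 1) cone (target p) h" and
      e: "\<And>a b m. m \<in> mcomp cone a b \<Longrightarrow> f a b m - g a b m = hom_diff (- 1) cone (target p) h a b m"
      unfolding homotopic_iff_hom_diff by blast
    have "coords (\<lambda>a b m. f a b m - g a b m) = coords (hom_diff (- 1) cone (target p) h)"
      using e[OF elt_mem] by (simp add: coords_def cong: if_cong)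
    then have "coords f - coords g = cobd (fscale (- 1) (coords h))"
      unfolding coords_linear coords_hom_diff[OF h] cobd_linear by simp
    moreover have "fscale (- 1) (coords h) \<in> cochains (p - 1)"
      using coords_mem[OF h] by (intro fscale.subspace_scale[OF cochains_subspace]) simp
    ultimately show "coords f - coords g \<in> ext_coboundaries p"
      unfolding ext_coboundaries_def by blast
  }
  assume "coords f - coords g \<in> ext_coboundaries p"
  then obtain w where w: "w \<in> cochains (p - 1)" "coords f - coords g = cobd w"
    unfolding ext_coboundaries_def by blast
  \<comment> \<open>The sign offsets \<open>parity_sign (- 1)\<close>, which
    \<open>coords_hom_diff\<close> attaches to maps of degree -1.\<close>
  have "fscale (- 1) w \<in> cochains (p + - 1)"
    using w(1) fscale.subspace_scale[OF cochains_subspace, of w "p - 1" "- 1"] by simp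
  then obtain h where h: "graded_hom alg (- 1) cone (target p) h" "coords h = fscale (- 1) w"
    by (rule coords_surj)
  have hd: "graded_hom alg 0 cone (target p) (hom_diff (- 1) cone (target p) h)"
    using graded_hom_hom_diff[OF C T adiff_mem h(1)] by simp
  have "coords (\<lambda>a b m. f a b m - g a b m) = coords (hom_diff (- 1) cone (target p) h)"
    unfolding coords_linear coords_hom_diff[OF h(1)] h(2) w(2) cobd_linear by simp
  from coords_inj[OF fg hd this] h(1) show "homotopic alg cone (target p) f g"
    unfolding homotopic_iff_hom_diff by blast
qed

end


section \<open>Morphisms in the derived category\<close>

context line_pair
begin

text \<open>A relation instead of a function, since the lift of \<open>aug\<close> is unique only up
  to homotopy: a roof may have several coordinate vectors, which differ by coboundaries.\<close>

definition lifts_to :: "int \<Rightarrow> ('u, ('v, 'e) path) roof \<Rightarrow> ('e option \<Rightarrow> complex) \<Rightarrow> bool"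
  where "lifts_to p x v \<longleftrightarrow> (case x of (X, s, f) \<Rightarrow> x \<in> roofs alg line (target p) \<and>
    (\<exists>u. dg_hom alg cone X u \<and> (\<forall>a b. \<forall>m \<in> mcomp cone a b. s a b (u a b m) = aug a b m) \<and>
      coords (graded_comp f u) = v))"

lemma lifts_to_cocycle:
  assumes "lifts_to p x v"
  shows "v \<in> ext_cocycles p"
proof -
  obtain X s f where x: "x = (X, s, f)" by (rule prod_cases3)
  with assms obtain u where u: "dg_hom alg cone X u" "coords (graded_comp f u) = v" and f: "dg_hom alg X (target p) f"
    by (auto simp: lifts_to_def roofs_def)
  from dg_hom_compose[OF u(1) f] show ?thesis
    using dg_hom_iff_coords[of p "graded_comp f u"] u(2) by (simp add: dg_hom_def)
qed

text \<open>The order of the quantifiers matters: one lift \<open>u\<close> serves all right legs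
  over the same left leg, which makes coordinates additive and homogeneous.\<close>

lemma lifts_to_exists:
  assumes "(X, s, f) \<in> roofs alg line (target p)"
  shows "\<exists>u. \<forall>f'. (X, s, f') \<in> roofs alg line (target p) \<longrightarrow>
    lifts_to p (X, s, f') (coords (graded_comp f' u))"
proof -
  have X: "continuous_dg_module alg X" "quasi_iso alg X line s"
    using assms by (auto simp: roofs_def)
  from lift_exists[OF X] obtain u where "dg_hom alg cone X u"
    "\<And>a b m. m \<in> mcomp cone a b \<Longrightarrow> s a b (u a b m) = aug a b m" by blast
  then show ?thesis by (intro exI[of _ u]) (auto simp: lifts_to_def)
qed

lemma roof_rel_iff_coords:
  assumes "lifts_to p x v" "lifts_to p y w"
  shows "(x, y) \<in> roof_rel alg line (target p) \<longleftrightarrow> v - w \<in> ext_coboundaries p"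
proof -
  obtain X s f where x: "x = (X, s, f)" by (rule prod_cases3)
  obtain X' s' f' where y: "y = (X', s', f')" by (rule prod_cases3)
  from assms(1) x obtain u where u: "(X, s, f) \<in> roofs alg line (target p)" "dg_hom alg cone X u"
    "\<And>a b m. m \<in> mcomp cone a b \<Longrightarrow> s a b (u a b m) = aug a b m" "coords (graded_comp f u) = v"
    unfolding lifts_to_def by auto
  from assms(2) y obtain u' where u': "(X', s', f') \<in> roofs alg line (target p)" "dg_hom alg cone X' u'"
    "\<And>a b m. m \<in> mcomp cone a b \<Longrightarrow> s' a b (u' a b m) = aug a b m" "coords (graded_comp f' u') = w"
    unfolding lifts_to_def by auto
  have "dg_hom alg X (target p) f" "dg_hom alg X' (target p) f'"
    using u(1) u'(1) by (auto simp: roofs_def)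
  from dg_hom_compose[OF u(2) this(1)] dg_hom_compose[OF u'(2) this(2)]
  have "graded_hom alg 0 cone (target p) (graded_comp f u)" "graded_hom alg 0 cone (target p) (graded_comp f' u')"
    by (simp_all add: dg_hom_def)
  from homotopic_iff_coords[OF this]
  have "homotopic alg cone (target p) (graded_comp f u) (graded_comp f' u') \<longleftrightarrow> v - w \<in> ext_coboundaries p"
    by (simp only: u(4) u'(4))
  moreover have "((X, s, f), (X', s', f')) \<in> roof_rel alg line (target p) \<longleftrightarrow>
      homotopic alg cone (target p) (graded_comp f u) (graded_comp f' u')"
    by (rule roof_rel_iff[OF continuous_dg_module_target u(1) u'(1) u(2) u(3) u'(2) u'(3)])
  ultimately show ?thesis unfolding x y by simp
qed

text \<open>The class of roofs described by coordinates modulo coboundaries;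
  \<open>roof_rel_class\<close> identifies it with a class of \<open>roof_rel\<close>.\<close>

definition ext_class :: "int \<Rightarrow> ('e option \<Rightarrow> complex) \<Rightarrow> ('u, ('v, 'e) path) roof set"
  where "ext_class p v = {x. \<exists>w. lifts_to p x w \<and> w - v \<in> ext_coboundaries p}"

lemma ext_coboundaries_diff_trans:
  "u - v \<in> ext_coboundaries p \<Longrightarrow> v - w \<in> ext_coboundaries p \<Longrightarrow> u - w \<in> ext_coboundaries p"
  using fscale.subspace_add[OF ext_subspaces(2), of "u - v" p "v - w"] by simp

lemma ext_coboundaries_diff_sym: "u - v \<in> ext_coboundaries p \<Longrightarrow> v - u \<in> ext_coboundaries p"
  using fscale.subspace_neg[OF ext_subspaces(2), of "u - v" p] by simp

lemma ext_coboundaries_refl: "v - v \<in> ext_coboundaries p"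
  using fscale.subspace_0[OF ext_subspaces(2)] by simp

lemma lifts_to_roof: "lifts_to p x v \<Longrightarrow> x \<in> roofs alg line (target p)"
  by (auto simp: lifts_to_def)

lemma roof_lifts_to:
  assumes "x \<in> roofs alg line (target p)"
  obtains v where "lifts_to p x v"
proof -
  obtain X s f where x: "x = (X, s, f)" by (rule prod_cases3)
  from lifts_to_exists[OF assms[unfolded x]] assms[unfolded x] have "\<exists>v. lifts_to p x v"
    unfolding x by fast
  then show ?thesis using that by fast
qed

lemma roof_rel_class:
  assumes "lifts_to p x v"
  shows "roof_rel alg line (target p) `` {x} = ext_class p v"
proof (intro equalityI subsetI)
  fix y assume y: "y \<in> roof_rel alg line (target p) `` {x}"
  then have "y \<in> roofs alg line (target p)" by (auto simp: roof_rel_def)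
  then obtain w where w: "lifts_to p y w" by (rule roof_lifts_to)
  with y roof_rel_iff_coords[OF assms w] have "v - w \<in> ext_coboundaries p" by simp
  with w show "y \<in> ext_class p v" unfolding ext_class_def using ext_coboundaries_diff_sym[of v w p] by blast
next
  fix y assume "y \<in> ext_class p v"
  then obtain w where w: "lifts_to p y w" "w - v \<in> ext_coboundaries p" unfolding ext_class_def by blast
  then show "y \<in> roof_rel alg line (target p) `` {x}"
    using roof_rel_iff_coords[OF assms w(1)] ext_coboundaries_diff_sym[of w v p] by blast
qed

lemma cocycle_roof:
  assumes v: "v \<in> ext_cocycles p"
  obtains f where "lifts_to p (cone, aug, f) v" "dg_hom alg cone (target p) f" "coords f = v"
proof -
  have "v \<in> cochains (p + 0)" using v by (simp add: ext_cocycles_def)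
  then obtain f where f: "graded_hom alg 0 cone (target p) f" "coords f = v" by (rule coords_surj)
  then have d: "dg_hom alg cone (target p) f" using dg_hom_iff_coords[OF f(1)] v by simp
  then have "(cone, aug, f) \<in> roofs alg line (target p)"
    using continuous_dg_module_cone aug_quasi_iso by (simp add: roofs_def)
  moreover have "graded_comp f (\<lambda>a b. id) = f" by (simp add: graded_comp_def)
  ultimately have "lifts_to p (cone, aug, f) v"
    unfolding lifts_to_def using dg_hom_id[of alg cone] f(2) by (auto intro!: exI[of _ "\<lambda>a b. id"])
  then show ?thesis using that d f(2) by blast
qed

lemma ext_classI: "lifts_to p x v \<Longrightarrow> x \<in> ext_class p v"
  unfolding ext_class_def using ext_coboundaries_refl[of v p] by (intro CollectI exI[of _ v] conjI)

lemma ext_classE: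
  assumes "x \<in> ext_class p v"
  obtains w where "lifts_to p x w" "w - v \<in> ext_coboundaries p"
  using assms that by (auto simp: ext_class_def)

text \<open>A cocycle is realised by a roof with apex \<open>cone\<close>, so
  \<open>ext_class p v\<close> has a member with coordinates \<open>v\<close>, through which two
  equal classes are compared.\<close>

lemma ext_class_eq_iff:
  assumes v: "v \<in> ext_cocycles p"
  shows "ext_class p v = ext_class p w \<longleftrightarrow> v - w \<in> ext_coboundaries p"
proof
  assume e: "ext_class p v = ext_class p w"
  obtain f where f: "lifts_to p (cone, aug, f) v" using v by (rule cocycle_roof)
  have "(cone, aug, f) \<in> ext_class p w" using ext_classI[OF f] by (simp only: e)
  then obtain w' where w': "lifts_to p (cone, aug, f) w'" "w' - w \<in> ext_coboundaries p"
    by (rule ext_classE)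
  have "((cone, aug, f), (cone, aug, f)) \<in> roof_rel alg line (target p)"
    unfolding roof_rel_iff_coords[OF f f] by (rule ext_coboundaries_refl)
  then have "v - w' \<in> ext_coboundaries p" unfolding roof_rel_iff_coords[OF f w'(1)] .
  then show "v - w \<in> ext_coboundaries p" using w'(2) by (rule ext_coboundaries_diff_trans)
next
  assume "v - w \<in> ext_coboundaries p"
  then have "u - v \<in> ext_coboundaries p \<longleftrightarrow> u - w \<in> ext_coboundaries p" for u
    using ext_coboundaries_diff_trans[of u v p w] ext_coboundaries_diff_trans[of u w p v]
      ext_coboundaries_diff_sym[of v w p] by blast
  then show "ext_class p v = ext_class p w" by (simp only: ext_class_def)
qed

abbreviation ext_space :: "int \<Rightarrow> (complex, ('u, ('v, 'e) path) roof set) module"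
  where "ext_space p \<equiv> derived_hom alg line (target p)"

lemma ext_space_carrier: "carrier (ext_space p) = ext_class p ` ext_cocycles p"
proof -
  have "carrier (ext_space p) = (\<lambda>x. roof_rel alg line (target p) `` {x}) ` roofs alg line (target p)"
    unfolding derived_hom_def quotient_def by auto
  also have "\<dots> = ext_class p ` ext_cocycles p"
  proof (intro equalityI subsetI)
    fix F assume "F \<in> (\<lambda>x. roof_rel alg line (target p) `` {x}) ` roofs alg line (target p)"
    then obtain x where x: "x \<in> roofs alg line (target p)" "F = roof_rel alg line (target p) `` {x}" by blast
    from x(1) obtain v where v: "lifts_to p x v" by (rule roof_lifts_to)
    show "F \<in> ext_class p ` ext_cocycles p"
      unfolding x(2) roof_rel_class[OF v] using lifts_to_cocycle[OF v] by blast
  next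
    fix F assume "F \<in> ext_class p ` ext_cocycles p"
    then obtain v where v: "v \<in> ext_cocycles p" "F = ext_class p v" by blast
    from v(1) obtain f where f: "lifts_to p (cone, aug, f) v" by (rule cocycle_roof)
    show "F \<in> (\<lambda>x. roof_rel alg line (target p) `` {x}) ` roofs alg line (target p)"
      unfolding v(2) roof_rel_class[OF f, symmetric] using lifts_to_roof[OF f] by blast
  qed
  finally show ?thesis .
qed

lemma ext_class_lift_cong:
  assumes "lifts_to p x v" "lifts_to p x v'"
  shows "v - v' \<in> ext_coboundaries p"
proof -
  have "(x, x) \<in> roof_rel alg line (target p)"
    unfolding roof_rel_iff_coords[OF assms(1) assms(1)] by (rule ext_coboundaries_refl)
  then show ?thesis unfolding roof_rel_iff_coords[OF assms] .
qed

lemma ext_class_member: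
  assumes "x \<in> ext_class p v" "lifts_to p x w"
  shows "w - v \<in> ext_coboundaries p"
proof -
  from assms(1) obtain u where "lifts_to p x u" "u - v \<in> ext_coboundaries p" by (rule ext_classE)
  with ext_class_lift_cong[OF assms(2)] show ?thesis using ext_coboundaries_diff_trans[of w u p v] by blast
qed

text \<open>The sum in \<open>derived_hom\<close> is a union over all pairs of roofs with a common
  left leg. A common lift makes coordinates additive, so all members of the family coincide, and
  roofs with apex \<open>cone\<close> show that the family is not empty.\<close>

lemma ext_space_add:
  assumes v: "v \<in> ext_cocycles p" and w: "w \<in> ext_cocycles p"
  shows "ext_class p v \<oplus>\<^bsub>ext_space p\<^esub> ext_class p w = ext_class p (v + w)"
proof -
  let ?S = "{roof_rel alg line (target p) `` {(X, s, \<lambda>a b m. f a b m + g a b m)} | X s f g.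
      (X, s, f) \<in> ext_class p v \<and> (X, s, g) \<in> ext_class p w}"
  have "F = ext_class p (v + w)" if "F \<in> ?S" for F
  proof -
    from that obtain X s f g where F: "F = roof_rel alg line (target p) `` {(X, s, \<lambda>a b m. f a b m + g a b m)}"
      and f: "(X, s, f) \<in> ext_class p v" and g: "(X, s, g) \<in> ext_class p w" by blast
    have rf: "(X, s, f) \<in> roofs alg line (target p)" and rg: "(X, s, g) \<in> roofs alg line (target p)"
      using f g by (auto elim!: ext_classE intro: lifts_to_roof)
    then have rfg: "(X, s, \<lambda>a b m. f a b m + g a b m) \<in> roofs alg line (target p)"
      using dg_hom_add[OF _ continuous_dg_module_target] by (auto simp: roofs_def)
    from lifts_to_exists[OF rf] obtain u where
      "\<forall>f'. (X, s, f') \<in> roofs alg line (target p) \<longrightarrow> lifts_to p (X, s, f') (coords (graded_comp f' u))" ..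
    then have u: "(X, s, f') \<in> roofs alg line (target p) \<Longrightarrow> lifts_to p (X, s, f') (coords (graded_comp f' u))" for f'
      by simp
    have "coords (graded_comp (\<lambda>a b m. f a b m + g a b m) u) = coords (graded_comp f u) + coords (graded_comp g u)"
      by (simp add: graded_comp_def coords_linear(1)[symmetric] o_def)
    then have "F = ext_class p (coords (graded_comp f u) + coords (graded_comp g u))"
      unfolding F using roof_rel_class[OF u[OF rfg]] by simp
    also have "\<dots> = ext_class p (v + w)"
    proof (subst ext_class_eq_iff)
      show "coords (graded_comp f u) + coords (graded_comp g u) \<in> ext_cocycles p"
        by (intro fscale.subspace_add[OF ext_subspaces(1)] lifts_to_cocycle[OF u[OF rf]] lifts_to_cocycle[OF u[OF rg]])
      have "(coords (graded_comp f u) - v) + (coords (graded_comp g u) - w) \<in> ext_coboundaries p"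
        by (intro fscale.subspace_add[OF ext_subspaces(2)] ext_class_member[OF f u[OF rf]] ext_class_member[OF g u[OF rg]])
      moreover have "coords (graded_comp f u) + coords (graded_comp g u) - (v + w) =
          (coords (graded_comp f u) - v) + (coords (graded_comp g u) - w)" by (simp only: add_diff_add)
      ultimately show "coords (graded_comp f u) + coords (graded_comp g u) - (v + w) \<in> ext_coboundaries p"
        by (simp only:)
    qed
    finally show ?thesis .
  qed
  moreover have "?S \<noteq> {}"
  proof -
    obtain f where f: "lifts_to p (cone, aug, f) v" using v by (rule cocycle_roof)
    obtain g where g: "lifts_to p (cone, aug, g) w" using w by (rule cocycle_roof)
    note ext_classI[OF f] ext_classI[OF g]
    then show ?thesis by blast
  qed
  ultimately have "\<Union>?S = ext_class p (v + w)" by blast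
  then show ?thesis by (simp add: derived_hom_def)
qed

lemma ext_space_smult:
  assumes v: "v \<in> ext_cocycles p"
  shows "c \<odot>\<^bsub>ext_space p\<^esub> ext_class p v = ext_class p (fscale c v)"
proof -
  let ?S = "{roof_rel alg line (target p) `` {(X, s, \<lambda>a b m. fscale c (f a b m))} | X s f.
      (X, s, f) \<in> ext_class p v}"
  have "F = ext_class p (fscale c v)" if "F \<in> ?S" for F
  proof -
    from that obtain X s f where F: "F = roof_rel alg line (target p) `` {(X, s, \<lambda>a b m. fscale c (f a b m))}"
      and f: "(X, s, f) \<in> ext_class p v" by blast
    have rf: "(X, s, f) \<in> roofs alg line (target p)"
      using f by (auto elim!: ext_classE intro: lifts_to_roof)
    then have rcf: "(X, s, \<lambda>a b m. fscale c (f a b m)) \<in> roofs alg line (target p)"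
      using dg_hom_scale[OF continuous_dg_module_target] by (auto simp: roofs_def)
    from lifts_to_exists[OF rf] obtain u where
      "\<forall>f'. (X, s, f') \<in> roofs alg line (target p) \<longrightarrow> lifts_to p (X, s, f') (coords (graded_comp f' u))" ..
    then have u: "(X, s, f') \<in> roofs alg line (target p) \<Longrightarrow> lifts_to p (X, s, f') (coords (graded_comp f' u))" for f'
      by simp
    have "coords (graded_comp (\<lambda>a b m. fscale c (f a b m)) u) = fscale c (coords (graded_comp f u))"
      by (simp add: graded_comp_def coords_linear(3)[symmetric] o_def)
    then have "F = ext_class p (fscale c (coords (graded_comp f u)))"
      unfolding F using roof_rel_class[OF u[OF rcf]] by simp
    also have "\<dots> = ext_class p (fscale c v)"
    proof (subst ext_class_eq_iff)
      show "fscale c (coords (graded_comp f u)) \<in> ext_cocycles p"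
        by (intro fscale.subspace_scale[OF ext_subspaces(1)] lifts_to_cocycle[OF u[OF rf]])
      show "fscale c (coords (graded_comp f u)) - fscale c v \<in> ext_coboundaries p"
        unfolding fscale_diff[symmetric]
        by (intro fscale.subspace_scale[OF ext_subspaces(2)] ext_class_member[OF f u[OF rf]])
    qed
    finally show ?thesis .
  qed
  moreover have "?S \<noteq> {}"
  proof -
    obtain f where f: "lifts_to p (cone, aug, f) v" using v by (rule cocycle_roof)
    note ext_classI[OF f]
    then show ?thesis by blast
  qed
  ultimately have "\<Union>?S = ext_class p (fscale c v)" by blast
  then show ?thesis by (simp add: derived_hom_def)
qed

text \<open>The roof chosen as zero has the identity of the line as left leg, through which
  \<open>aug\<close> lifts as itself.\<close>

lemma ext_space_zero: "\<zero>\<^bsub>ext_space p\<^esub> = ext_class p 0"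
proof -
  have "(line, (\<lambda>a b. id), (\<lambda>a b m. 0)) \<in> roofs alg line (target p)"
    using continuous_dg_module_line quasi_iso_id[OF continuous_dg_module_line]
      dg_hom_zero[OF continuous_dg_module_line continuous_dg_module_target] by (simp add: roofs_def)
  moreover have "coords (graded_comp (\<lambda>a b m. 0) aug) = 0"
    by (simp add: coords_def graded_comp_def fun_eq_iff)
  ultimately have "lifts_to p (line, (\<lambda>a b. id), (\<lambda>a b m. 0)) 0"
    unfolding lifts_to_def using quasi_isoD(1)[OF aug_quasi_iso] by auto
  from roof_rel_class[OF this] show ?thesis
    unfolding derived_hom_def by (simp add: zero_fun_def)
qed

lemma vectorspace_ext_space: "vectorspace class_ring (ext_space p)"
proof -
  note add = fscale.subspace_add[OF ext_subspaces(1)] and scale = fscale.subspace_scale[OF ext_subspaces(1)]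
    and zero = fscale.subspace_0[OF ext_subspaces(1)] and neg = fscale.subspace_neg[OF ext_subspaces(1)]
  have inv: "ext_class p v \<oplus>\<^bsub>ext_space p\<^esub> ext_class p (- v) = ext_class p 0" if "v \<in> ext_cocycles p" for v
    using that by (simp add: ext_space_add neg)
  have add_left: "fscale (a + b) v = fscale a v + fscale b v" for a b and v :: "'e option \<Rightarrow> complex"
    by (simp add: fun_eq_iff algebra_simps)
  show ?thesis
  proof (rule vs_criteria)
    show "field (class_ring :: complex ring)" by (rule class_field)
    show "\<forall>v\<in>carrier (ext_space p). \<exists>w\<in>carrier (ext_space p). v \<oplus>\<^bsub>ext_space p\<^esub> w = \<zero>\<^bsub>ext_space p\<^esub>"
      unfolding ext_space_carrier ext_space_zero using inv neg by blast
  qed (auto simp: ext_space_carrier ext_space_zero ext_space_add ext_space_smult add scale zero fscale_add add_left add_ac)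
qed

text \<open>The rank of \<open>cobd\<close> on \<open>cochains p\<close>; its image lies one degree
  higher, which explains the index.\<close>

definition rank :: "int \<Rightarrow> nat"
  where "rank p = vectorspace.dim class_ring (subspace_module (ext_coboundaries (p + 1)))"

lemma cochains_dim:
  "vectorspace.fin_dim class_ring (subspace_module (cochains p))"
  "vectorspace.dim class_ring (subspace_module (cochains p)) = card (gens_at p)"
proof -
  note b = supported_functions_basis[OF finite_gens_at[of p]]
  show "vectorspace.fin_dim class_ring (subspace_module (cochains p))"
    "vectorspace.dim class_ring (subspace_module (cochains p)) = card (gens_at p)"
    using subspace_module_basis[OF _ b(2,1)] finite_gens_at[of p] unfolding cochains_def b(3) by auto
qed

text \<open>Rank-nullity twice: for \<open>cobd\<close> on cochains, with kernel the cocycles, and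
  for the passage from cocycles to classes of roofs, with kernel the coboundaries.\<close>

lemma ext_dim_rank:
  "vectorspace.fin_dim class_ring (ext_space p)"
  "vectorspace.dim class_ring (ext_space p) + rank (p - 1) + rank p = card (gens_at p)"
proof -
  have 1: "rank p + vectorspace.dim class_ring (subspace_module (ext_cocycles p)) = card (gens_at p)"
    using subspace_module_rank_nullity(1)[OF cochains_subspace vectorspace_subspace_module[OF cochains_subspace[of "p + 1"]]
        cochains_dim(1)[of p], of cobd] cobd_mem[of _ p] cochains_dim(2)[of p]
    unfolding rank_def ext_coboundaries_def ext_cocycles_def by (simp add: cobd_linear)
  have fin: "vectorspace.fin_dim class_ring (subspace_module (ext_cocycles p))"
    by (rule subspace_module_fin_dim[OF ext_subspaces(1) finite_gens_at[of p]])
      (auto simp: ext_cocycles_def cochains_def)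
  have hom: "ext_class p \<in> ext_cocycles p \<rightarrow> carrier (ext_space p)" by (auto simp: ext_space_carrier)
  note rn = subspace_module_rank_nullity[OF ext_subspaces(1) vectorspace_ext_space fin hom
      ext_space_add[symmetric] ext_space_smult[symmetric]]
  show "vectorspace.fin_dim class_ring (ext_space p)"
    using rn(2) ext_space_carrier[of p] by simp
  have "{v \<in> ext_cocycles p. ext_class p v = \<zero>\<^bsub>ext_space p\<^esub>} = ext_coboundaries p"
    unfolding ext_space_zero using ext_class_eq_iff[of _ p 0] ext_coboundaries_subset[of p] by auto
  moreover have "(ext_space p)\<lparr>carrier := ext_class p ` ext_cocycles p\<rparr> = ext_space p"
    unfolding ext_space_carrier[symmetric] by simp
  ultimately have "vectorspace.dim class_ring (ext_space p) + rank (p - 1) =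
      vectorspace.dim class_ring (subspace_module (ext_cocycles p))"
    using rn(1) by (simp add: rank_def)
  with 1 show "vectorspace.dim class_ring (ext_space p) + rank (p - 1) + rank p = card (gens_at p)" by simp
qed

end


section \<open>The Euler matrix\<close>

text \<open>In the alternating sum every rank \<open>rk r p\<close> occurs for the degrees
  \<open>p\<close> and \<open>p + 1\<close> with opposite signs, so only the count of generators
  survives; it remains to see that all sums are finite.\<close>

lemma euler_characteristic_of_ranks:
  fixes h rk :: "int \<Rightarrow> int \<Rightarrow> nat" and a b :: "'c \<Rightarrow> int"
  assumes C: "finite C"
    and eq: "\<And>p r. h p r + rk r (p - 1) + rk r p = card {c \<in> C. a c = p \<and> b c = r}"
  shows "finite {(p, r). h p r \<noteq> 0}"
    and "Sum_any (\<lambda>(p, r). parity_sign p * of_nat (h p r) * tpow r) = (\<Sum>c\<in>C. parity_sign (a c) * tpow (b c))"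
proof -
  \<comment> \<open>The bound is strict, so no generator has degree \<open>M\<close> or
    \<open>- M\<close>; this kills the two end terms \<open>rk r M\<close> and
    \<open>rk r (- M - 1)\<close> of the telescoping sum.\<close>
  obtain M where M: "\<And>c. c \<in> C \<Longrightarrow> \<bar>a c\<bar> < M" and M0: "0 \<le> M"
  proof
    show "\<bar>a c\<bar> < 1 + (\<Sum>c\<in>C. \<bar>a c\<bar>)" if "c \<in> C" for c
      using member_le_sum[of c C "\<lambda>c. \<bar>a c\<bar>"] C that by simp
    show "0 \<le> 1 + (\<Sum>c\<in>C. \<bar>a c\<bar>)" by (simp add: sum_nonneg add_nonneg_nonneg)
  qed
  define A where "A = {- M..M}"
  define R where "R = b ` C"
  have fin: "finite A" "finite R" using C by (simp_all add: A_def R_def)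
  have zero: "h p r = 0 \<and> rk r (p - 1) = 0 \<and> rk r p = 0" if "\<forall>c\<in>C. \<not> (a c = p \<and> b c = r)" for p r
  proof -
    have "{c \<in> C. a c = p \<and> b c = r} = {}" using that by blast
    then have "card {c \<in> C. a c = p \<and> b c = r} = 0" by (simp only: card.empty)
    with eq[of p r] show ?thesis by simp
  qed
  have supp: "{(p, r). h p r \<noteq> 0} \<subseteq> A \<times> R"
  proof
    fix x assume "x \<in> {(p, r). h p r \<noteq> 0}"
    then obtain p r where x: "x = (p, r)" and "h p r \<noteq> 0" by auto
    with zero[of p r] have "\<exists>c\<in>C. a c = p \<and> b c = r" by auto
    then obtain c where "c \<in> C" "a c = p" "b c = r" by blast
    then show "x \<in> A \<times> R" using M[of c] by (auto simp: x A_def R_def)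
  qed
  show "finite {(p, r). h p r \<noteq> 0}"
    by (rule finite_subset[OF supp]) (use fin in simp)
  have tele: "(\<Sum>p\<in>A. parity_sign p * of_nat (rk r (p - 1))) + (\<Sum>p\<in>A. parity_sign p * of_nat (rk r p)) = (0 :: laurent)" for r
  proof -
    have out: "rk r M = 0" "rk r (- M - 1) = 0"
    proof -
      show "rk r M = 0" using zero[of M r] M by fastforce
      show "rk r (- M - 1) = 0" using zero[of "- M" r] M by fastforce
    qed
    have "(\<Sum>p\<in>A. parity_sign p * of_nat (rk r (p - 1))) =
        (\<Sum>p\<in>{- M - 1..M - 1}. parity_sign (p + 1) * of_nat (rk r p) :: laurent)"
      by (rule sum.reindex_bij_witness[of _ "\<lambda>p. p + 1" "\<lambda>p. p - 1"]) (auto simp: A_def)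
    also have "\<dots> = (\<Sum>p\<in>{- M..M - 1}. parity_sign (p + 1) * of_nat (rk r p))"
    proof (rule sum.mono_neutral_right)
      show "\<forall>p\<in>{- M - 1..M - 1} - {- M..M - 1}. parity_sign (p + 1) * of_nat (rk r p) = (0 :: laurent)"
      proof
        fix p assume "p \<in> {- M - 1..M - 1} - {- M..M - 1}"
        then have "p = - M - 1" by auto
        then show "parity_sign (p + 1) * of_nat (rk r p) = (0 :: laurent)" using out by simp
      qed
    qed auto
    also have "\<dots> = (\<Sum>p\<in>A. parity_sign (p + 1) * of_nat (rk r p))"
    proof (rule sum.mono_neutral_left)
      show "\<forall>p\<in>A - {- M..M - 1}. parity_sign (p + 1) * of_nat (rk r p) = (0 :: laurent)"
      proof
        fix p assume "p \<in> A - {- M..M - 1}"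
        then have "p = M" by (auto simp: A_def)
        then show "parity_sign (p + 1) * of_nat (rk r p) = (0 :: laurent)" using out by simp
      qed
    qed (auto simp: A_def)
    finally show ?thesis by (simp add: sum_negf)
  qed
  have "Sum_any (\<lambda>(p, r). parity_sign p * of_nat (h p r) * tpow r) =
      (\<Sum>x\<in>A \<times> R. parity_sign (fst x) * of_nat (h (fst x) (snd x)) * tpow (snd x))"
    unfolding case_prod_unfold
  proof (rule Sum_any.expand_superset)
    show "{x. parity_sign (fst x) * of_nat (h (fst x) (snd x)) * tpow (snd x) \<noteq> 0} \<subseteq> A \<times> R"
    proof
      fix x assume "x \<in> {x. parity_sign (fst x) * of_nat (h (fst x) (snd x)) * tpow (snd x) \<noteq> 0}"
      then have "h (fst x) (snd x) \<noteq> 0" by (intro notI) simp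
      then show "x \<in> A \<times> R" using supp by (cases x) auto
    qed
  qed (use fin in simp)
  also have "\<dots> = (\<Sum>r\<in>R. (\<Sum>p\<in>A. parity_sign p * of_nat (h p r)) * tpow r)"
    unfolding sum_distrib_right by (subst sum.swap) (simp add: sum.cartesian_product case_prod_unfold)
  also have "\<dots> = (\<Sum>r\<in>R. (\<Sum>p\<in>A. parity_sign p * of_nat (card {c \<in> C. a c = p \<and> b c = r})) * tpow r)"
  proof (rule sum.cong[OF refl])
    fix r
    have "(\<Sum>p\<in>A. parity_sign p * of_nat (card {c \<in> C. a c = p \<and> b c = r})) =
        (\<Sum>p\<in>A. parity_sign p * of_nat (h p r)) +
        ((\<Sum>p\<in>A. parity_sign p * of_nat (rk r (p - 1))) + (\<Sum>p\<in>A. parity_sign p * of_nat (rk r p)) :: laurent)"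
      unfolding eq[symmetric] by (simp add: sum.distrib distrib_left add.assoc)
    then show "(\<Sum>p\<in>A. parity_sign p * of_nat (h p r)) * tpow r =
        (\<Sum>p\<in>A. parity_sign p * of_nat (card {c \<in> C. a c = p \<and> b c = r})) * tpow r"
      unfolding tele by simp
  qed
  also have "\<dots> = (\<Sum>x\<in>A \<times> R. parity_sign (fst x) * of_nat (card {c \<in> C. a c = fst x \<and> b c = snd x}) * tpow (snd x))"
    unfolding sum_distrib_right by (subst sum.swap) (simp add: sum.cartesian_product case_prod_unfold)
  \<comment> \<open>Each cardinality becomes a sum over the generators of that bidegree, so that
    grouping by bidegree gives back the sum over \<open>C\<close>.\<close>
  also have "\<dots> = (\<Sum>x\<in>A \<times> R. \<Sum>c\<in>{c. c \<in> C \<and> (a c, b c) = x}. parity_sign (a c) * tpow (b c))"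
  proof (rule sum.cong[OF refl])
    fix x
    have "{c. c \<in> C \<and> (a c, b c) = x} = {c \<in> C. a c = fst x \<and> b c = snd x}" by (cases x) auto
    moreover have "(\<Sum>c\<in>{c \<in> C. a c = fst x \<and> b c = snd x}. parity_sign (a c) * tpow (b c)) =
        (\<Sum>c\<in>{c \<in> C. a c = fst x \<and> b c = snd x}. parity_sign (fst x) * tpow (snd x))"
      by (rule sum.cong) auto
    ultimately show "parity_sign (fst x) * of_nat (card {c \<in> C. a c = fst x \<and> b c = snd x}) * tpow (snd x) =
        (\<Sum>c\<in>{c. c \<in> C \<and> (a c, b c) = x}. parity_sign (a c) * tpow (b c))"
      by (simp add: mult_ac)
  qed
  also have "\<dots> = (\<Sum>c\<in>C. parity_sign (a c) * tpow (b c))"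
  proof (rule sum.group[OF C])
    show "(\<lambda>c. (a c, b c)) ` C \<subseteq> A \<times> R"
      using M by (force simp: A_def R_def)
  qed (use fin in simp)
  finally show "Sum_any (\<lambda>(p, r). parity_sign p * of_nat (h p r) * tpow r) = (\<Sum>c\<in>C. parity_sign (a c) * tpow (b c))" .
qed

text \<open>A finite quiver has countably many paths, and every infinite type contains a countably
  infinite set. This is where the size of the universe enters.\<close>

lemma (in fin_digraph) path_encoding:
  "\<exists>enc :: bool \<times> ('a, 'b) path \<Rightarrow> 'u::infinite. inj_on enc (UNIV \<times> paths G)"
proof -
  have "paths G \<subseteq> verts G \<times> lists (arcs G) \<times> verts G"
  proof
    fix z assume z: "z \<in> paths G"
    then have "psrc z \<in> verts G" "set (parcs z) \<subseteq> arcs G" "ptgt z \<in> verts G"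
      using psrc_in_verts[of z] ptgt_in_verts[of z] by (auto simp: path_iff_awalk)
    moreover have "z = (psrc z, parcs z, ptgt z)" by (rule path_eqI) simp_all
    ultimately show "z \<in> verts G \<times> lists (arcs G) \<times> verts G"
      by (metis SigmaI in_listsI subsetD)
  qed
  moreover have "countable (verts G \<times> lists (arcs G) \<times> verts G)"
    by (intro countable_SIGMA countable_lists countable_finite) auto
  ultimately have "countable (paths G)" by (rule countable_subset)
  then have "countable (UNIV \<times> paths G :: (bool \<times> ('a, 'b) path) set)"
    by (intro countable_SIGMA) auto
  then obtain f :: "bool \<times> ('a, 'b) path \<Rightarrow> nat" where f: "inj_on f (UNIV \<times> paths G)"
    unfolding countable_def by blast
  obtain g :: "nat \<Rightarrow> 'u" where "inj g"
    using infinite_countable_subset[OF infinite_UNIV] by blast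
  then have "inj_on (g \<circ> f) (UNIV \<times> paths G)"
    using f by (intro comp_inj_on) (auto intro: inj_on_subset)
  then show ?thesis by blast
qed

section \<open>Specialisation to the Ginzburg algebra\<close>

context graded_quiver_potential
begin

lemma ginzburg_eq_alg: "ginzburg Q W d = ginzburg.alg"
proof -
  have "ginzburg_comp Q d = bidegree_part GQ coh_degree (int_degree d)"
    by (simp add: fun_eq_iff ginzburg_comp_def bidegree_part_def)
  moreover have "ginzburg_diff Q W = path_diff GQ coh_degree (generator_diff Q W)"
    by (simp add: fun_eq_iff ginzburg_diff_def path_diff_def split_sum_def Let_def)
  ultimately show ?thesis
    by (simp add: ginzburg_def ginzburg.alg_def)
qed

lemma simple_module_eq: "simple_module i = line_module i"
  by (simp add: simple_module_def line_module_def)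

theorem euler_matrix_formula:
  fixes U :: "'u::infinite itself"
  assumes i: "i \<in> verts Q" and j: "j \<in> verts Q"
  shows "\<forall>p r. vectorspace.fin_dim class_ring (simple_ext U Q W d p r i j)"
    and "finite {(p, r). ext_dim U Q W d p r i j \<noteq> 0}"
    and "euler_matrix U Q W d i j =
      (1 - tpow 1) * (if i = j then 1 else 0)
      - (\<Sum>a \<in> {a \<in> arcs Q. tail Q a = j \<and> head Q a = i}. tpow (d a))
      + (\<Sum>a \<in> {a \<in> arcs Q. tail Q a = i \<and> head Q a = j}. tpow (1 - d a))"
proof -
  obtain enc :: "bool \<times> ('v, 'a) gpath \<Rightarrow> 'u" where enc: "inj_on enc (UNIV \<times> paths GQ)"
    using G.path_encoding by blast
  \<comment> \<open>The internal degree is a parameter of the locale, so one encoding is used for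
    all \<open>r\<close> simultaneously.\<close>
  interpret L: line_pair GQ coh_degree "int_degree d" "generator_diff Q W" i enc j r for r
    by unfold_locales (use i j enc in simp_all)
  have ext: "simple_ext U Q W d p r i j = L.ext_space r p" for p r
    by (simp add: simple_ext_def ginzburg_ext_def ginzburg_eq_alg simple_module_eq L.target_def)
  show "\<forall>p r. vectorspace.fin_dim class_ring (simple_ext U Q W d p r i j)"
    unfolding ext using L.ext_dim_rank(1) by blast
  define C where "C = {c \<in> L.gens. L.vtx c = j}"
  have C: "finite C" using L.finite_gens by (simp add: C_def)
  have "ext_dim U Q W d p r i j + L.rank r (p - 1) + L.rank r p =
      card {c \<in> C. - L.deg1 c = p \<and> L.deg2 c = r}" for p r
  proof -
    have "L.gens_at r p = {c \<in> C. - L.deg1 c = p \<and> L.deg2 c = r}"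
      by (auto simp: L.gens_at_def C_def)
    then show ?thesis unfolding ext using L.ext_dim_rank(2)[of r p] by simp
  qed
  note euler = euler_characteristic_of_ranks[OF C this]
  show "finite {(p, r). ext_dim U Q W d p r i j \<noteq> 0}" by (rule euler(1))
  let ?A = "{a \<in> arcs Q. tail Q a = j \<and> head Q a = i}"
  let ?B = "{a \<in> arcs Q. tail Q a = i \<and> head Q a = j}"
  let ?f = "\<lambda>c. parity_sign (- L.deg1 c) * tpow (L.deg2 c)"
  have mem_C: "c \<in> C \<longleftrightarrow> c = None \<and> i = j \<or> (\<exists>g\<in>arcs GQ. c = Some g \<and> head GQ g = i \<and> tail GQ g = j)" for c
    by (cases c) (auto simp only: C_def L.gens_simps L.incoming_def mem_Collect_eq option.inject option.distinct simp_thms)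
  \<comment> \<open>The generators for \<open>None\<close>, \<open>Arr a\<close>,
    \<open>Dual a\<close> and \<open>Loop i\<close> have cohomological degree 0, -1, -2 and -3,
    which gives the signs. A dual arrow from \<open>j\<close> to \<open>i\<close> belongs to an
    arrow from \<open>i\<close> to \<open>j\<close>, hence the reversed ends in
    \<open>?B\<close>.\<close>
  have "C = (if i = j then {None, Some (Loop i)} else {}) \<union> (Some ` Arr ` ?A \<union> Some ` Dual ` ?B)"
    using i by (auto simp: mem_C)
  moreover have "sum ?f ((if i = j then {None, Some (Loop i)} else {}) \<union> (Some ` Arr ` ?A \<union> Some ` Dual ` ?B)) =
      sum ?f (if i = j then {None, Some (Loop i)} else {}) + (sum ?f (Some ` Arr ` ?A) + sum ?f (Some ` Dual ` ?B))"
    by (subst sum.union_disjoint; (subst sum.union_disjoint)?) auto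
  moreover have "sum ?f (if i = j then {None, Some (Loop i)} else {}) = (1 - tpow 1) * (if i = j then 1 else 0)"
    by (cases "i = j") (simp_all add: parity_sign_def tpow_def)
  moreover have "sum ?f (Some ` Arr ` ?A) = - (\<Sum>a\<in>?A. tpow (d a))"
    by (subst sum.reindex; (subst sum.reindex)?) (auto simp: inj_on_def parity_sign_def sum_negf)
  moreover have "sum ?f (Some ` Dual ` ?B) = (\<Sum>a\<in>?B. tpow (1 - d a))"
    by (subst sum.reindex; (subst sum.reindex)?) (auto simp: inj_on_def parity_sign_def)
  ultimately show "euler_matrix U Q W d i j =
      (1 - tpow 1) * (if i = j then 1 else 0) - (\<Sum>a\<in>?A. tpow (d a)) + (\<Sum>a\<in>?B. tpow (1 - d a))"
    unfolding euler_matrix_def euler(2) by simp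
qed

end

text \<open>The two finiteness clauses accompany the formula because \<open>vectorspace.dim\<close>
  is meaningful only for finite-dimensional spaces and \<open>Sum_any\<close> only for finite
  support.\<close>

theorem proposition3p6:
  fixes Q :: "('v, 'a) pre_digraph" and W :: "('v, 'a) series set" and d :: "'a \<Rightarrow> int"
    and i j :: 'v and U :: "'u::infinite itself"
  assumes "graded_quiver_potential Q W d"
    and "i \<in> verts Q" and "j \<in> verts Q"
  shows "(\<forall>p r. vectorspace.fin_dim class_ring (simple_ext U Q W d p r i j)) \<and>
    finite {(p, r). ext_dim U Q W d p r i j \<noteq> 0} \<and>
    euler_matrix U Q W d i j =
      (1 - tpow 1) * (if i = j then 1 else 0)
      - (\<Sum>a \<in> {a \<in> arcs Q. tail Q a = j \<and> head Q a = i}. tpow (d a))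
      + (\<Sum>a \<in> {a \<in> arcs Q. tail Q a = i \<and> head Q a = j}. tpow (1 - d a))"
  using graded_quiver_potential.euler_matrix_formula[OF assms, of U] by blast

end
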